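(* Let $P$ be a standard RAP with parameters $k,m,n$ and set of zero positions $Z$. Then \[ E(P)=\frac{1}{mn}\sum_{i,j}\frac{d_{i,j}(P)}{\binom{m-1}{i}\binom{n-1}{j}}, \] the sum being over nonnegative integers $i,j$ with $i+j<k$.
   Context: Let $k,m,n$ be positive integers with $\min(m,n)\ge k$. A $k$-assignment in an $m\times n$ matrix is a set of $k$ positions, no two in the same row or column; its cost is the sum of the entries at these positions. A standard random assignment problem (standard RAP) $P$ is given by $k,m,n$ and a set $Z$ of positions of the $m\times n$ matrix: the entries at positions in $Z$ are $0$, and all other entries are independent random variables, each exponentially distributed with intensity $1$. $E(P)$ denotes the expected value of the minimal cost of a $k$-assignment. A set $\lambda$ of rows and columns covers $Z$ if every position in $Z$ lies in a row or a column belonging to $\lambda$; a cover consisting of $s$ rows and columns in total is an $s$-cover. A partial $(k-1)$-cover of $Z$ is a set of rows and columns that is a subset of some $(k-1)$-cover of $Z$. The cover coefficient $d_{i,j}(P)$ is the number of partial $(k-1)$-covers of $Z$ consisting of exactly $i$ rows and $j$ columns (it is $0$ unless $i,j\ge0$ and $i+j<k$). *)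

theory Defs
  imports "HOL-Probability.Probability"
begin

text \<open>The rows of an \<open>m\<close> by \<open>n\<close> matrix are indexed by \<open>{..<m}\<close>, its columns by \<open>{..<n}\<close>.\<close>

definition positions :: "nat \<Rightarrow> nat \<Rightarrow> (nat \<times> nat) set" where
  "positions m n = {..<m} \<times> {..<n}"

definition assignments :: "nat \<Rightarrow> nat \<Rightarrow> nat \<Rightarrow> (nat \<times> nat) set set" where
  "assignments k m n =
     {S. S \<subseteq> positions m n \<and> card S = k \<and> inj_on fst S \<and> inj_on snd S}"

definition cost :: "(nat \<times> nat \<Rightarrow> real) \<Rightarrow> (nat \<times> nat) set \<Rightarrow> real" where
  "cost A S = (\<Sum>p\<in>S. A p)"

text \<open>The set of assignments is finite, and it is nonempty if \<open>k \<le> min m n\<close>, so that the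
  minimum below is attained.\<close>

definition min_cost :: "nat \<Rightarrow> nat \<Rightarrow> nat \<Rightarrow> (nat \<times> nat \<Rightarrow> real) \<Rightarrow> real" where
  "min_cost k m n A = Min (cost A ` assignments k m n)"

text \<open>A set of rows and columns is represented by the pair \<open>(R, C)\<close> of its set of rows and
  its set of columns.\<close>

definition covers :: "nat set \<times> nat set \<Rightarrow> (nat \<times> nat) set \<Rightarrow> bool" where
  "covers L Z \<longleftrightarrow> (\<forall>(i, j)\<in>Z. i \<in> fst L \<or> j \<in> snd L)"

definition s_covers ::
    "nat \<Rightarrow> nat \<Rightarrow> nat \<Rightarrow> (nat \<times> nat) set \<Rightarrow> (nat set \<times> nat set) set" where
  "s_covers s m n Z =
     {(R, C). R \<subseteq> {..<m} \<and> C \<subseteq> {..<n} \<and> card R + card C = s \<and> covers (R, C) Z}"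

definition partial_s_covers ::
    "nat \<Rightarrow> nat \<Rightarrow> nat \<Rightarrow> (nat \<times> nat) set \<Rightarrow> (nat set \<times> nat set) set" where
  "partial_s_covers s m n Z =
     {(R, C). \<exists>(R', C')\<in>s_covers s m n Z. R \<subseteq> R' \<and> C \<subseteq> C'}"

definition cover_coeff ::
    "nat \<Rightarrow> nat \<Rightarrow> nat \<Rightarrow> (nat \<times> nat) set \<Rightarrow> nat \<Rightarrow> nat \<Rightarrow> nat" where
  "cover_coeff k m n Z i j =
     card {(R, C) \<in> partial_s_covers (k - 1) m n Z. card R = i \<and> card C = j}"

locale standard_RAP = prob_space M
  for k m n :: nat and Z :: "(nat \<times> nat) set" and M :: "'a measure"
    and X :: "nat \<times> nat \<Rightarrow> 'a \<Rightarrow> real" +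
  assumes k_pos: "0 < k"
    and k_le: "k \<le> min m n"
    and Z_subset: "Z \<subseteq> positions m n"
    and zero_entries: "\<And>p \<omega>. p \<in> Z \<Longrightarrow> \<omega> \<in> space M \<Longrightarrow> X p \<omega> = 0"
    and exponential_entries:
      "\<And>p. p \<in> positions m n - Z \<Longrightarrow> distributed M lborel (X p) (exponential_density 1)"
    and indep_entries: "indep_vars (\<lambda>_. borel) X (positions m n - Z)"

end

(* Deleting a column j together with one assigned entry lowers the minimal cost of a k-assignment by
   d_k(j), the largest cost in column j at which an additional row would still be used.  Let D_k be the
   sum of the d_k(j) over all columns.  By induction on k it suffices to compute E(D_k), since the cover
   formula satisfies the same recursion: the covers containing columns cancel, and there remains the
   sum over the partial (k-1)-covers R consisting of rows only of 1 / (m binom(m-1, |R|)), which is the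
   expected time that an urn process, drawing each row at rate 1, spends at such sets R.

   Sets of rows carry the matroid rank r(R), the least size of a cover of Z containing R.  Almost surely
   there is exactly one flat F of each rank s with r(0) <= s < k such that an optimal s-assignment uses
   the rows of F outside the columns J containing zeros of the remaining rows, and covers J by zeros.
   The next row l joining F carries the single entry minimizing a(l, j) plus a cost determined by the
   rows of F alone, and the new flat is the closure of F + l.  An additional row with Lebesgue measure
   on its entries joins at this stage exactly when lowering an entry of l to the same value would make
   l join, for any l outside F, so integration by parts against the exponential density gives
   E(D_(s+1) - D_s; F) = P(F, l joins).  Hence all l are equally likely, the flats evolve as the
   closures in the urn process, and E(D_k) is the row sum above. *)

theory Submission
  imports Defs
begin

section \<open>Matchings and exchanges along alternating paths\<close>

text \<open>The rate-1 exponential law enters through one property: its density equals its tail.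
  Hence the probability that the entry \<open>(l, j)\<close> joins is the mean length of the set of
  values to which it could be lowered so as to join. Given that \<open>F\<close> is tight, this set
  is an interval whose ends do not involve \<open>l\<close>; that is the only source of symmetry
  among the rows, which the zeros otherwise destroy. The ends lose \<open>l\<close> because flatness
  leaves one row to spare when the columns containing zeros are matched: every row outside a tight
  flat is avoided by some optimal assignment, so deleting it does not change the minima that matter.

  Uniqueness of the flat cannot come from uniqueness of optimal assignments, since zeros create
  ties. It comes from the rows common to all optimal assignments: they lie in every tight flat of
  that rank, and their closure contains the flat built step by step.

  All cost comparisons rest on exchanges along alternating paths, which conserve the total cost.
  Those along augmenting paths move exactly one row and one column from a larger matching to a
  smaller one.\<close>

definition matching :: "('a \<times> 'b) set \<Rightarrow> bool" where
  "matching S \<longleftrightarrow> finite S \<and> inj_on fst S \<and> inj_on snd S"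

lemma matching_subset: "matching S \<Longrightarrow> T \<subseteq> S \<Longrightarrow> matching T"
  unfolding matching_def by (meson inj_on_subset finite_subset)

lemma matching_card: "matching S \<Longrightarrow> card (fst ` S) = card S" "matching S \<Longrightarrow> card (snd ` S) = card S"
  unfolding matching_def by (auto simp: card_image)

lemma matching_Un:
  assumes "matching S" "matching T" "fst ` S \<inter> fst ` T = {}" "snd ` S \<inter> snd ` T = {}"
  shows "matching (S \<union> T)"
  using assms unfolding matching_def by (auto simp: inj_on_Un)

lemma card_matching_Un:
  assumes "matching S" "matching T" "fst ` S \<inter> fst ` T = {}"
  shows "card (S \<union> T) = card S + card T"
  using assms unfolding matching_def by (intro card_Un_disjoint) auto

lemma matching_Diff:
  assumes "matching S" "T \<subseteq> S"
  shows "fst ` (S - T) = fst ` S - fst ` T" "snd ` (S - T) = snd ` S - snd ` T"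
  using assms unfolding matching_def by (metis Diff_subset inj_on_image_set_diff)+

text \<open>Disjointness in rows and in columns, not merely as sets of positions: this is what
  allows pieces of two matchings to be recombined.\<close>

definition separated :: "('a \<times> 'b) set \<Rightarrow> ('a \<times> 'b) set \<Rightarrow> bool" where
  "separated S T \<longleftrightarrow> fst ` S \<inter> fst ` T = {} \<and> snd ` S \<inter> snd ` T = {}"

lemma separated_mono: "separated A B \<Longrightarrow> A' \<subseteq> A \<Longrightarrow> B' \<subseteq> B \<Longrightarrow> separated A' B'"
  unfolding separated_def by (meson disjoint_iff image_mono subsetD)

lemma separated_sym: "separated A B \<Longrightarrow> separated B A"
  unfolding separated_def by (simp add: Int_commute)

lemma separated_Un: "separated A B \<Longrightarrow> separated A C \<Longrightarrow> separated A (B \<union> C)"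
  unfolding separated_def by (simp add: image_Un Int_Un_distrib)

text \<open>Follow the component of the two matchings that starts at row \<open>l\<close>;
  \<open>T\<close> and \<open>S\<close> collect its entries from \<open>v\<close> and from
  \<open>u\<close>. It ends in a column free of \<open>u\<close>, and then \<open>T\<close> has one
  entry more, or in a row free of \<open>v\<close>, and then the numbers agree. Either way the
  columns of \<open>S\<close> occur in \<open>T\<close>, so a swap brings no new column into
  \<open>v\<close>.\<close>

lemma alternating_path:
  assumes "matching u" "matching v" "l \<in> fst ` v" "l \<notin> fst ` u"
  shows "\<exists>S T. S \<subseteq> u \<and> T \<subseteq> v \<and> separated (S \<union> T) ((u - S) \<union> (v - T)) \<and>
    l \<in> fst ` T \<and> snd ` S \<subseteq> snd ` T \<and>
    (card T = Suc (card S) \<and> fst ` S \<subseteq> fst ` T \<or> card T = card S)"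
  using assms
proof (induction "card v" arbitrary: u v l rule: less_induct)
  case less
  have fin: "finite v" "finite u" using less.prems unfolding matching_def by auto
  obtain c where lc: "(l, c) \<in> v" using less.prems by auto
  have l0: "(l, x) \<notin> u" for x using less.prems(4) by force
  have lc': "l \<notin> fst ` (v - {(l, c)})" "c \<notin> snd ` (v - {(l, c)})"
    using matching_Diff[OF less.prems(2), of "{(l, c)}"] lc by simp_all
  show ?case
  proof (cases "c \<in> snd ` u")
    case False
    have "separated ({} \<union> {(l, c)}) ((u - {}) \<union> (v - {(l, c)}))"
      unfolding separated_def image_Un using less.prems(4) False lc' by simp
    then show ?thesis using lc by (intro exI[of _ "{}"] exI[of _ "{(l, c)}"]) auto
  next
    case True
    then obtain r where rc: "(r, c) \<in> u" by auto
    have rl: "r \<noteq> l" using rc l0 by blast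
    have rc': "r \<notin> fst ` (u - {(r, c)})" "c \<notin> snd ` (u - {(r, c)})"
      using matching_Diff[OF less.prems(1), of "{(r, c)}"] rc by simp_all
    show ?thesis
    proof (cases "r \<in> fst ` v")
      case False
      then have "r \<notin> fst ` (v - {(l, c)})" by blast
      moreover have "l \<notin> fst ` (u - {(r, c)})" using less.prems(4) by blast
      ultimately have "separated ({(r, c)} \<union> {(l, c)}) ((u - {(r, c)}) \<union> (v - {(l, c)}))"
        unfolding separated_def image_Un using lc' rc' by simp
      then show ?thesis using lc rc by (intro exI[of _ "{(r, c)}"] exI[of _ "{(l, c)}"]) auto
    next
      case True
      \<comment> \<open>With both entries of column \<open>c\<close> removed, row \<open>r\<close>
        is free of the rest of \<open>u\<close> and starts the remaining path.\<close>
      define u0 where "u0 = u - {(r, c)}"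
      define v0 where "v0 = v - {(l, c)}"
      have m: "matching u0" "matching v0"
        unfolding u0_def v0_def using less.prems(1,2)[THEN matching_subset] by (simp_all add: Diff_subset)
      have "card v0 < card v" unfolding v0_def using lc fin by (intro psubset_card_mono) auto
      moreover have "r \<in> fst ` v0" using True rl matching_Diff(1)[OF less.prems(2), of "{(l, c)}"] lc unfolding v0_def by simp
      moreover have r1: "r \<notin> fst ` u0" using rc' unfolding u0_def by blast
      ultimately obtain S T where ST: "S \<subseteq> u0" "T \<subseteq> v0"
        "separated (S \<union> T) ((u0 - S) \<union> (v0 - T))" "r \<in> fst ` T" "snd ` S \<subseteq> snd ` T"
        "card T = Suc (card S) \<and> fst ` S \<subseteq> fst ` T \<or> card T = card S"
        using less.hyps[of v0 u0 r] m by blast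
      have c1: "c \<notin> snd ` u0" "c \<notin> snd ` v0" using rc' lc' unfolding u0_def v0_def by blast+
      have l1: "l \<notin> fst ` u0" "l \<notin> fst ` v0" using less.prems(4) lc' unfolding u0_def v0_def by blast+
      have finST: "finite S" "finite T" using ST fin unfolding u0_def v0_def
        by (meson Diff_subset finite_subset)+
      have e: "u - insert (r, c) S = u0 - S" "v - insert (l, c) T = v0 - T"
        unfolding u0_def v0_def by auto
      have ni: "(r, c) \<notin> S" "(l, c) \<notin> T" using ST unfolding u0_def v0_def by auto
      have rr: "r \<notin> fst ` ((u0 - S) \<union> (v0 - T))" using ST(3,4) unfolding separated_def by blast
      have ll: "l \<notin> fst ` ((u0 - S) \<union> (v0 - T))" using l1 by blast
      have cc: "c \<notin> snd ` ((u0 - S) \<union> (v0 - T))" using c1 by blast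
      have "separated (insert (r, c) S \<union> insert (l, c) T)
          ((u - insert (r, c) S) \<union> (v - insert (l, c) T))"
        unfolding e using ST(3) rr ll cc unfolding separated_def by (simp add: image_Un)
      moreover have "insert (r, c) S \<subseteq> u" "insert (l, c) T \<subseteq> v"
        using ST rc lc unfolding u0_def v0_def by auto
      moreover have "snd ` insert (r, c) S \<subseteq> snd ` insert (l, c) T" using ST(5) by auto
      moreover have "card (insert (l, c) T) = Suc (card (insert (r, c) S)) \<and>
          fst ` insert (r, c) S \<subseteq> fst ` insert (l, c) T
          \<or> card (insert (l, c) T) = card (insert (r, c) S)"
        using ST(4,6) ni finST by (elim disjE) (simp_all add: subset_insertI2)
      moreover have "l \<in> fst ` insert (l, c) T" by simp
      ultimately show ?thesis
        by - (rule exI[of _ "insert (r, c) S"], rule exI[of _ "insert (l, c) T"], intro conjI; assumption)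
    qed
  qed
qed

text \<open>A path taking equally many entries from both matchings can be discarded:
  \<open>v\<close> stays larger than \<open>u\<close>, and \<open>u\<close> shrinks, so eventually a
  path of the unbalanced kind appears.\<close>

lemma augmenting_path:
  assumes "matching u" "matching v" "card u < card v"
  shows "\<exists>S T. S \<subseteq> u \<and> T \<subseteq> v \<and> separated (S \<union> T) ((u - S) \<union> (v - T)) \<and>
    snd ` S \<subseteq> snd ` T \<and> card T = Suc (card S) \<and> fst ` S \<subseteq> fst ` T"
  using assms
proof (induction "card u" arbitrary: u v rule: less_induct)
  case less
  have fin: "finite v" "finite u" using less.prems unfolding matching_def by auto
  have "card (fst ` u) < card (fst ` v)" using less.prems by (simp add: matching_card)
  then have "\<not> fst ` v \<subseteq> fst ` u"
    using card_mono[of "fst ` u" "fst ` v"] fin by (meson finite_imageI not_le)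
  then obtain l where l: "l \<in> fst ` v" "l \<notin> fst ` u" by blast
  obtain S T where ST: "S \<subseteq> u" "T \<subseteq> v" "separated (S \<union> T) ((u - S) \<union> (v - T))"
    "l \<in> fst ` T" "snd ` S \<subseteq> snd ` T"
    "card T = Suc (card S) \<and> fst ` S \<subseteq> fst ` T \<or> card T = card S"
    using alternating_path[OF less.prems(1,2) l] by blast
  have finST: "finite S" "finite T" using ST fin by (meson finite_subset)+
  show ?case
  proof (cases "card T = Suc (card S) \<and> fst ` S \<subseteq> fst ` T")
    case True
    then show ?thesis using ST by blast
  next
    case False
    then have eq: "card T = card S" using ST(6) by blast
    have "card T > 0" using ST(4) finST by (auto simp: card_gt_0_iff)
    have c1: "card (u - S) = card u - card S" using ST finST by (simp add: card_Diff_subset)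
    have c2: "card (v - T) = card v - card T" using ST finST by (simp add: card_Diff_subset)
    have le: "card S \<le> card u" using ST fin card_mono by blast
    have "card (u - S) < card u" using c1 le eq \<open>card T > 0\<close> by linarith
    moreover have "matching (u - S)" "matching (v - T)"
      using less.prems(1,2)[THEN matching_subset] by (simp_all add: Diff_subset)
    moreover have "card (u - S) < card (v - T)" using c1 c2 eq le less.prems(3) by linarith
    ultimately obtain S0 T0 where S0: "S0 \<subseteq> u - S" "T0 \<subseteq> v - T"
      "separated (S0 \<union> T0) ((u - S - S0) \<union> (v - T - T0))"
      "snd ` S0 \<subseteq> snd ` T0" "card T0 = Suc (card S0)" "fst ` S0 \<subseteq> fst ` T0"
      using less.hyps[of "u - S" "v - T"] by blast
    \<comment> \<open>The discarded path is separated from everything left, hence from the path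
      found in the remainder.\<close>
    have "(u - S0) \<union> (v - T0) \<subseteq> ((u - S - S0) \<union> (v - T - T0)) \<union> (S \<union> T)" by blast
    moreover have "S0 \<union> T0 \<subseteq> (u - S) \<union> (v - T)" using S0(1,2) by (rule Un_mono)
    then have "separated (S0 \<union> T0) (S \<union> T)"
      using separated_mono[OF separated_sym[OF ST(3)]] by simp
    ultimately have "separated (S0 \<union> T0) ((u - S0) \<union> (v - T0))"
      using separated_mono[OF separated_Un[OF S0(3)] subset_refl] by simp
    moreover have "S0 \<subseteq> u" "T0 \<subseteq> v" using S0(1,2) by auto
    ultimately show ?thesis using S0(4-6) by blast
  qed
qed

lemma swap_matching:
  assumes "matching u" "matching v" "S \<subseteq> u" "T \<subseteq> v" "separated (S \<union> T) ((u - S) \<union> (v - T))"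
  shows "matching ((u - S) \<union> T)" "card ((u - S) \<union> T) + card S = card u + card T"
    "\<And>f :: _ \<Rightarrow> real. sum f ((u - S) \<union> T) = sum f u - sum f S + sum f T"
proof -
  have fin: "finite u" "finite v" "finite S" "finite T"
    using assms unfolding matching_def by (auto intro: finite_subset)
  have m: "matching (u - S)" "matching T"
    using assms(1,2)[THEN matching_subset] assms(4) by (simp_all add: Diff_subset)
  have d: "fst ` (u - S) \<inter> fst ` T = {}" "snd ` (u - S) \<inter> snd ` T = {}"
    using assms(5) unfolding separated_def by blast+
  show "matching ((u - S) \<union> T)" using matching_Un[OF m d] .
  have "card ((u - S) \<union> T) = card (u - S) + card T" using card_matching_Un[OF m d(1)] .
  moreover have "card (u - S) = card u - card S" using assms(3) fin by (simp add: card_Diff_subset)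
  moreover have "card S \<le> card u" using assms(3) fin card_mono by blast
  ultimately show "card ((u - S) \<union> T) + card S = card u + card T" by linarith
  fix f :: "_ \<Rightarrow> real"
  have "(u - S) \<inter> T = {}" using d by blast
  then have "sum f ((u - S) \<union> T) = sum f (u - S) + sum f T" using fin by (simp add: sum.union_disjoint)
  then show "sum f ((u - S) \<union> T) = sum f u - sum f S + sum f T"
    using assms(3) fin by (simp add: sum_diff)
qed

lemma set_exchange:
  assumes "A \<subseteq> X" "B \<subseteq> Y" "B - A = {l}" "A \<subseteq> B" "(X - A) \<inter> B = {}"
  shows "l \<in> Y - X \<and> (X - A) \<union> B = insert l X \<and> (Y - B) \<union> A = Y - {l}"
  using assms by blast

text \<open>One row and one column pass from \<open>v\<close> to \<open>u\<close>. The equation for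
  all real weights says that entries are conserved with multiplicity; taking the matrix for
  \<open>f\<close>, it conserves the total cost.\<close>

definition exchange ::
    "('a \<times> 'b) set \<Rightarrow> ('a \<times> 'b) set \<Rightarrow> ('a \<times> 'b) set \<Rightarrow> ('a \<times> 'b) set \<Rightarrow> 'a \<Rightarrow> 'b \<Rightarrow> bool" where
  "exchange u v u' v' l j \<longleftrightarrow> matching u' \<and> matching v' \<and> u' \<union> v' \<subseteq> u \<union> v \<and>
    card u' = Suc (card u) \<and> Suc (card v') = card v \<and>
    l \<in> fst ` v - fst ` u \<and> fst ` u' = insert l (fst ` u) \<and> fst ` v' = fst ` v - {l} \<and>
    j \<in> snd ` v - snd ` u \<and> snd ` u' = insert j (snd ` u) \<and> snd ` v' = snd ` v - {j} \<and>
    (\<forall>f :: _ \<Rightarrow> real. sum f u' + sum f v' = sum f u + sum f v)"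

lemma exchangeD:
  assumes "exchange u v u' v' l j"
  shows "matching u'" "matching v'" "u' \<union> v' \<subseteq> u \<union> v" "card u' = Suc (card u)"
    "Suc (card v') = card v" "l \<in> fst ` v - fst ` u" "fst ` u' = insert l (fst ` u)"
    "fst ` v' = fst ` v - {l}" "j \<in> snd ` v - snd ` u" "snd ` u' = insert j (snd ` u)"
    "snd ` v' = snd ` v - {j}" "\<And>f :: _ \<Rightarrow> real. sum f u' + sum f v' = sum f u + sum f v"
  using assms unfolding exchange_def by simp_all

text \<open>Swap along an augmenting path. Its inner rows and columns are met by both matchings, so
  only the two ends change sides.\<close>

lemma matching_exchange:
  fixes u v :: "('a \<times> 'b) set"
  assumes "matching u" "matching v" "card u < card v"
  obtains u' v' l j where "exchange u v u' v' l j"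
proof -
  obtain S T where ST: "S \<subseteq> u" "T \<subseteq> v" "separated (S \<union> T) ((u - S) \<union> (v - T))"
    "snd ` S \<subseteq> snd ` T" "card T = Suc (card S)" "fst ` S \<subseteq> fst ` T"
    using augmenting_path[OF assms] by blast
  have sep2: "separated (T \<union> S) ((v - T) \<union> (u - S))" using ST(3) by (simp add: Un_commute)
  have fin: "finite u" "finite v" "finite S" "finite T"
    using assms ST unfolding matching_def by (auto intro: finite_subset)
  have m: "matching S" "matching T" using ST(1,2) assms(1,2)[THEN matching_subset] by simp_all
  note a = swap_matching[OF assms(1,2) ST(1-3)] and b = swap_matching[OF assms(2,1) ST(2,1) sep2]
  have "card (fst ` T - fst ` S) = 1"
    using ST(5,6) m fin by (simp add: card_Diff_subset matching_card)
  then obtain l where l: "fst ` T - fst ` S = {l}" by (auto simp: card_1_singleton_iff)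
  have "card (snd ` T - snd ` S) = 1"
    using ST(5,4) m fin by (simp add: card_Diff_subset matching_card)
  then obtain j where j: "snd ` T - snd ` S = {j}" by (auto simp: card_1_singleton_iff)
  have fT: "fst ` T = insert l (fst ` S)" "snd ` T = insert j (snd ` S)" using l j ST by auto
  have d: "(fst ` u - fst ` S) \<inter> fst ` T = {}" "(snd ` u - snd ` S) \<inter> snd ` T = {}"
    using separated_mono[OF ST(3), of T "u - S"] matching_Diff[OF assms(1) ST(1)]
    unfolding separated_def by auto
  have e: "fst ` ((u - S) \<union> T) = (fst ` u - fst ` S) \<union> fst ` T"
    "fst ` ((v - T) \<union> S) = (fst ` v - fst ` T) \<union> fst ` S"
    "snd ` ((u - S) \<union> T) = (snd ` u - snd ` S) \<union> snd ` T"
    "snd ` ((v - T) \<union> S) = (snd ` v - snd ` T) \<union> snd ` S"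
    using matching_Diff[OF assms(1) ST(1)] matching_Diff[OF assms(2) ST(2)] by (simp_all add: image_Un)
  have f: "l \<in> fst ` v - fst ` u \<and> (fst ` u - fst ` S) \<union> fst ` T = insert l (fst ` u) \<and>
      (fst ` v - fst ` T) \<union> fst ` S = fst ` v - {l}"
    by (rule set_exchange[OF image_mono[OF ST(1)] image_mono[OF ST(2)]]) (fact l ST(6) d(1))+
  have g: "j \<in> snd ` v - snd ` u \<and> (snd ` u - snd ` S) \<union> snd ` T = insert j (snd ` u) \<and>
      (snd ` v - snd ` T) \<union> snd ` S = snd ` v - {j}"
    by (rule set_exchange[OF image_mono[OF ST(1)] image_mono[OF ST(2)]]) (fact j ST(4) d(2))+
  show ?thesis
  proof (rule that[of "(u - S) \<union> T" "(v - T) \<union> S" l j], unfold exchange_def, intro conjI allI)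
    show "l \<in> fst ` v - fst ` u" "fst ` ((u - S) \<union> T) = insert l (fst ` u)"
      "fst ` ((v - T) \<union> S) = fst ` v - {l}"
      using f unfolding e by blast+
    show "j \<in> snd ` v - snd ` u" "snd ` ((u - S) \<union> T) = insert j (snd ` u)"
      "snd ` ((v - T) \<union> S) = snd ` v - {j}"
      using g unfolding e by blast+
    show "matching ((u - S) \<union> T)" "matching ((v - T) \<union> S)" using a(1) b(1) .
    show "(u - S) \<union> T \<union> ((v - T) \<union> S) \<subseteq> u \<union> v" using ST(1,2) by auto
    show "card ((u - S) \<union> T) = Suc (card u)" "Suc (card ((v - T) \<union> S)) = card v"
      using a(2) b(2) ST(5) by linarith+
    show "sum f ((u - S) \<union> T) + sum f ((v - T) \<union> S) = sum f u + sum f v" for f :: "_ \<Rightarrow> real"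
      using a(3)[of f] b(3)[of f] by linarith
  qed
qed

text \<open>Induction on the size of \<open>U\<close>. If a proper nonempty subset has exactly as
  many neighbours as elements, it and its complement are matched separately; otherwise each such
  subset has a neighbour to spare, and any single edge may be chosen first.\<close>

lemma hall:
  fixes E :: "('a \<times> 'b) set"
  assumes "finite U" "finite E" "\<And>T. T \<subseteq> U \<Longrightarrow> card T \<le> card (E `` T)"
  shows "\<exists>W\<subseteq>E. matching W \<and> fst ` W = U"
  using assms
proof (induction "card U" arbitrary: U E rule: less_induct)
  case less
  have finI: "finite (E `` T)" for T using less.prems(2) by (simp add: finite_Image)
  show ?case
  proof (cases "U = {}")
    case True
    then show ?thesis by (intro exI[of _ "{}"]) (auto simp: matching_def)
  next
    case False
    show ?thesis
    proof (cases "\<exists>T. T \<subset> U \<and> T \<noteq> {} \<and> card (E `` T) = card T")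
      case True
      then obtain T where T: "T \<subset> U" "T \<noteq> {}" "card (E `` T) = card T" by blast
      have finT: "finite T" using T less.prems finite_subset by blast
      have "card T < card U" using T less.prems psubset_card_mono by blast
      moreover have "card X \<le> card (E `` X)" if "X \<subseteq> T" for X
        using that T by (intro less.prems(3)) auto
      ultimately obtain W1 where W1: "W1 \<subseteq> E" "matching W1" "fst ` W1 = T"
        using less.hyps[of T E] finT less.prems(2) by blast
      \<comment> \<open>Removing the neighbours of \<open>T\<close> keeps the condition on
        \<open>U - T\<close>: the condition for \<open>X \<union> T\<close> leaves at least
        \<open>card X\<close> neighbours of \<open>X\<close> outside those of
        \<open>T\<close>.\<close>
      define E2 where "E2 = E - UNIV \<times> (E `` T)"
      have E2im: "E2 `` X = E `` X - E `` T" for X unfolding E2_def by auto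
      have "card (U - T) < card U" using T less.prems finT
        by (intro psubset_card_mono) auto
      moreover have "card X \<le> card (E2 `` X)" if "X \<subseteq> U - T" for X
      proof -
        have finX: "finite X" using that less.prems finite_subset by blast
        have "card (X \<union> T) \<le> card (E `` (X \<union> T))" using that T by (intro less.prems(3)) auto
        moreover have "card (X \<union> T) = card X + card T" using that finX finT
          by (intro card_Un_disjoint) auto
        moreover have "E `` (X \<union> T) = E2 `` X \<union> E `` T" unfolding E2im by auto
        moreover have "card (E2 `` X \<union> E `` T) \<le> card (E2 `` X) + card (E `` T)"
          by (rule card_Un_le)
        ultimately show ?thesis using T(3) by simp
      qed
      ultimately obtain W2 where W2: "W2 \<subseteq> E2" "matching W2" "fst ` W2 = U - T"
        using less.hyps[of "U - T" E2] less.prems(1,2) unfolding E2_def by blast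
      have "snd ` W1 \<subseteq> E `` T" using W1 by force
      moreover have "snd ` W2 \<inter> E `` T = {}" using W2(1) unfolding E2_def by fastforce
      ultimately have "matching (W1 \<union> W2)" using W1 W2 by (intro matching_Un) auto
      moreover have "fst ` (W1 \<union> W2) = U" using W1 W2 T by auto
      ultimately show ?thesis using W1 W2 unfolding E2_def by (intro exI[of _ "W1 \<union> W2"]) auto
    next
      case False
      have tight: "card T < card (E `` T)" if "T \<subset> U" "T \<noteq> {}" for T
      proof -
        have "card T \<le> card (E `` T)" using that(1) by (intro less.prems(3)) auto
        moreover have "card (E `` T) \<noteq> card T" using False that by blast
        ultimately show ?thesis by linarith
      qed
      obtain u where u: "u \<in> U" using \<open>U \<noteq> {}\<close> by blast
      have "card {u} \<le> card (E `` {u})" using u by (intro less.prems(3)) auto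
      then have "E `` {u} \<noteq> {}" by auto
      then obtain v where uv: "(u, v) \<in> E" by auto
      define E2 where "E2 = E - UNIV \<times> {v}"
      have E2im: "E2 `` X = E `` X - {v}" for X unfolding E2_def by auto
      have "card (U - {u}) < card U" using u less.prems(1) by (intro psubset_card_mono) auto
      moreover have "card X \<le> card (E2 `` X)" if "X \<subseteq> U - {u}" for X
      proof (cases "X = {}")
        case False
        then have "card X < card (E `` X)" using that u by (intro tight) auto
        moreover have "card (E `` X) \<le> Suc (card (E `` X - {v}))"
          using finI[of X] by (cases "v \<in> E `` X") (auto simp: card_Diff_singleton)
        ultimately show ?thesis unfolding E2im by linarith
      qed auto
      ultimately obtain W2 where W2: "W2 \<subseteq> E2" "matching W2" "fst ` W2 = U - {u}"
        using less.hyps[of "U - {u}" E2] less.prems(1,2) unfolding E2_def by blast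
      have "v \<notin> snd ` W2" using W2(1) unfolding E2_def by auto
      then have "matching ({(u, v)} \<union> W2)" using W2(2,3)
        by (intro matching_Un) (auto simp: matching_def)
      moreover have "fst ` ({(u, v)} \<union> W2) = U" using W2 u by auto
      ultimately show ?thesis using W2 uv unfolding E2_def by (intro exI[of _ "{(u, v)} \<union> W2"]) auto
    qed
  qed
qed

section \<open>Minimal costs of assignments\<close>

text \<open>The row and column sets are parameters because the induction deletes columns and the
  exchange arguments delete rows.\<close>

definition assigns :: "nat \<Rightarrow> nat set \<Rightarrow> nat set \<Rightarrow> (nat \<times> nat) set set" where
  "assigns s I K = {S. S \<subseteq> I \<times> K \<and> matching S \<and> card S = s}"

definition opt :: "(nat \<times> nat \<Rightarrow> real) \<Rightarrow> nat \<Rightarrow> nat set \<Rightarrow> nat set \<Rightarrow> real" where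
  "opt A s I K = Min (cost A ` assigns s I K)"

lemma assignsD:
  assumes "S \<in> assigns s I K"
  shows "S \<subseteq> I \<times> K" "matching S" "card S = s" "finite S" "fst ` S \<subseteq> I" "snd ` S \<subseteq> K"
  using assms unfolding assigns_def matching_def by auto

lemma assignsI: "matching S \<Longrightarrow> card S = s \<Longrightarrow> fst ` S \<subseteq> I \<Longrightarrow> snd ` S \<subseteq> K \<Longrightarrow> S \<in> assigns s I K"
  unfolding assigns_def by force

lemma finite_assigns: "finite I \<Longrightarrow> finite K \<Longrightarrow> finite (assigns s I K)"
  unfolding assigns_def by (rule finite_subset[of _ "Pow (I \<times> K)"]) auto

lemma assigns_nonempty:
  assumes "finite I" "finite K" "s \<le> card I" "s \<le> card K"
  shows "assigns s I K \<noteq> {}"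
proof -
  obtain R where R: "R \<subseteq> I" "card R = s" using assms obtain_subset_with_card_n by metis
  obtain C where C: "C \<subseteq> K" "card C = s" using assms obtain_subset_with_card_n by metis
  have fin: "finite R" "finite C" using R C assms finite_subset by auto
  obtain f where f: "bij_betw f R C" using finite_same_card_bij[OF fin] R C by auto
  have "inj_on fst ((\<lambda>i. (i, f i)) ` R)" by (auto simp: inj_on_def)
  moreover have "inj_on snd ((\<lambda>i. (i, f i)) ` R)" using f unfolding bij_betw_def inj_on_def by auto
  moreover have "card ((\<lambda>i. (i, f i)) ` R) = s" using R by (subst card_image) (auto simp: inj_on_def)
  moreover have "(\<lambda>i. (i, f i)) ` R \<subseteq> I \<times> K" using R C f unfolding bij_betw_def by auto
  ultimately show ?thesis using fin unfolding assigns_def matching_def by blast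
qed

lemma cost_insert: "finite S \<Longrightarrow> p \<notin> S \<Longrightarrow> cost A (insert p S) = A p + cost A S"
  unfolding cost_def by simp

lemma cost_Diff: "finite S \<Longrightarrow> p \<in> S \<Longrightarrow> cost A (S - {p}) = cost A S - A p"
  unfolding cost_def by (simp add: sum_diff1)

lemma cost_Un: "finite S \<Longrightarrow> finite T \<Longrightarrow> S \<inter> T = {} \<Longrightarrow> cost A (S \<union> T) = cost A S + cost A T"
  unfolding cost_def by (rule sum.union_disjoint)

lemma opt_le:
  assumes "finite I" "finite K" "S \<in> assigns s I K"
  shows "opt A s I K \<le> cost A S"
  unfolding opt_def using assms finite_assigns by (intro Min_le) auto

lemma opt_attained:
  assumes "finite I" "finite K" "s \<le> card I" "s \<le> card K"
  obtains S where "S \<in> assigns s I K" "cost A S = opt A s I K"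
proof -
  have "opt A s I K \<in> cost A ` assigns s I K"
    unfolding opt_def using finite_assigns[OF assms(1,2)] assigns_nonempty[OF assms]
    by (intro Min_in) auto
  then show ?thesis using that by auto
qed

lemma opt_antimono:
  assumes "finite I" "finite K" "I' \<subseteq> I" "K' \<subseteq> K" "s \<le> card I'" "s \<le> card K'"
  shows "opt A s I K \<le> opt A s I' K'"
proof -
  have f: "finite I'" "finite K'" using assms finite_subset by auto
  obtain S where S: "S \<in> assigns s I' K'" "cost A S = opt A s I' K'"
    using opt_attained[OF f assms(5,6)] .
  have "S \<in> assigns s I K" using S(1) assms(3,4) unfolding assigns_def by auto
  then show ?thesis using opt_le[OF assms(1,2)] S(2) by metis
qed

lemma opt_0: "opt A 0 I K = 0"
proof -
  have "assigns 0 I K = {{}}" unfolding assigns_def matching_def by auto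
  then show ?thesis unfolding opt_def cost_def by simp
qed

lemma opt_nonneg:
  assumes "finite I" "finite K" "s \<le> card I" "s \<le> card K" "\<And>p. A p \<ge> 0"
  shows "opt A s I K \<ge> 0"
proof -
  obtain S where S: "S \<in> assigns s I K" "cost A S = opt A s I K" using opt_attained[OF assms(1-4)] .
  show ?thesis unfolding S(2)[symmetric] cost_def using assms(5) by (intro sum_nonneg) auto
qed

lemma opt_cong:
  assumes "\<And>p. p \<in> I \<times> K \<Longrightarrow> A p = B p"
  shows "opt A s I K = opt B s I K"
proof -
  have "cost A S = cost B S" if "S \<in> assigns s I K" for S
    unfolding cost_def using assms assignsD(1)[OF that] by (intro sum.cong) auto
  then show ?thesis unfolding opt_def by (metis (no_types, lifting) image_cong)
qed

section \<open>Deleting a column and changing one entry\<close>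

lemma opt_remove_col_le:
  assumes "finite I" "finite K" "Suc s \<le> card I" "Suc s \<le> card K" "\<And>p. A p \<ge> 0"
  shows "opt A s I (K - {j}) \<le> opt A (Suc s) I K"
proof -
  obtain S where S: "S \<in> assigns (Suc s) I K" "cost A S = opt A (Suc s) I K"
    using opt_attained[OF assms(1-4)] .
  note D = assignsD[OF S(1)]
  \<comment> \<open>The entry in column \<open>j\<close> if there is one, otherwise any entry: the
    size has to drop by one in either case.\<close>
  obtain p where p: "p \<in> S" "j \<in> snd ` S \<longrightarrow> snd p = j"
  proof (cases "j \<in> snd ` S")
    case True
    then show ?thesis using that by auto
  next
    case False
    moreover obtain p where "p \<in> S" using D(3) by (cases "S = {}") auto
    ultimately show ?thesis using that by blast
  qed
  have "snd ` (S - {p}) = snd ` S - {snd p}" using matching_Diff(2)[OF D(2), of "{p}"] p by simp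
  then have "snd ` (S - {p}) \<subseteq> K - {j}" using D(6) p(2) by auto
  moreover have "fst ` (S - {p}) \<subseteq> I" using D(5) by auto
  moreover have "card (S - {p}) = s" using D(3,4) p(1) by simp
  ultimately have "S - {p} \<in> assigns s I (K - {j})"
    using matching_subset[OF D(2), of "S - {p}"] by (intro assignsI) auto
  then have "opt A s I (K - {j}) \<le> cost A (S - {p})" using assms(1,2) by (intro opt_le) auto
  also have "\<dots> \<le> cost A S" using cost_Diff[OF D(4) p(1), of A] assms(5)[of p] by linarith
  finally show ?thesis using S(2) by simp
qed

lemma opt_update_le:
  assumes "finite I" "finite K" "Suc s \<le> card I" "Suc s \<le> card K" "(l, j) \<in> I \<times> K"
  shows "opt (A((l, j) := t)) (Suc s) I K \<le> t + opt A s (I - {l}) (K - {j})"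
proof -
  have f: "finite (I - {l})" "finite (K - {j})" using assms by auto
  have c: "s \<le> card (I - {l})" "s \<le> card (K - {j})" using assms by auto
  obtain S where S: "S \<in> assigns s (I - {l}) (K - {j})" "cost A S = opt A s (I - {l}) (K - {j})"
    using opt_attained[OF f c] .
  note D = assignsD[OF S(1)]
  have n: "(l, j) \<notin> S" using D(1) by auto
  have "matching ({(l, j)} \<union> S)" using D(2,5,6) by (intro matching_Un) (auto simp: matching_def)
  then have "insert (l, j) S \<in> assigns (Suc s) I K"
    using D(3-6) n assms(5) by (intro assignsI) auto
  then have "opt (A((l, j) := t)) (Suc s) I K \<le> cost (A((l, j) := t)) (insert (l, j) S)"
    by (rule opt_le[OF assms(1,2)])
  also have "\<dots> = t + cost (A((l, j) := t)) S" using cost_insert[OF D(4) n] by simp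
  also have "cost (A((l, j) := t)) S = cost A S" unfolding cost_def using n by (intro sum.cong) auto
  finally show ?thesis unfolding S(2) .
qed

text \<open>An assignment through \<open>(l, j)\<close> pays \<open>t\<close> plus an assignment off
  its row and column; any other assignment does not see the change.\<close>

lemma opt_update_ge:
  assumes "finite I" "finite K" "Suc s \<le> card I" "Suc s \<le> card K"
  shows "min (opt A (Suc s) I K) (t + opt A s (I - {l}) (K - {j})) \<le> opt (A((l, j) := t)) (Suc s) I K"
proof -
  obtain S where S: "S \<in> assigns (Suc s) I K"
    "cost (A((l, j) := t)) S = opt (A((l, j) := t)) (Suc s) I K"
    using opt_attained[OF assms(1-4)] .
  note D = assignsD[OF S(1)]
  show ?thesis
  proof (cases "(l, j) \<in> S")
    case True
    have m: "fst ` (S - {(l, j)}) = fst ` S - {l}" "snd ` (S - {(l, j)}) = snd ` S - {j}"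
      using matching_Diff[OF D(2), of "{(l, j)}"] True by auto
    have "S - {(l, j)} \<in> assigns s (I - {l}) (K - {j})"
      using matching_subset[OF D(2), of "S - {(l, j)}"] m D(3-6) True by (intro assignsI) auto
    then have "opt A s (I - {l}) (K - {j}) \<le> cost A (S - {(l, j)})"
      using assms(1,2) by (intro opt_le) auto
    also have "cost A (S - {(l, j)}) = cost (A((l, j) := t)) (S - {(l, j)})"
      unfolding cost_def by (intro sum.cong) auto
    also have "\<dots> = cost (A((l, j) := t)) S - t" using cost_Diff[OF D(4) True] by simp
    finally show ?thesis using S(2) by simp
  next
    case False
    have "cost (A((l, j) := t)) S = cost A S" unfolding cost_def using False by (intro sum.cong) auto
    then show ?thesis using opt_le[OF assms(1,2) S(1), of A] S(2) by simp
  qed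
qed

lemma opt_mono:
  assumes "finite I" "finite K" "s \<le> card I" "s \<le> card K" "\<And>p. A p \<le> B p"
  shows "opt A s I K \<le> opt B s I K"
proof -
  obtain S where S: "S \<in> assigns s I K" "cost B S = opt B s I K" using opt_attained[OF assms(1-4)] .
  have "cost A S \<le> cost B S" unfolding cost_def using assms(5) by (intro sum_mono) auto
  then show ?thesis using opt_le[OF assms(1,2) S(1), of A] S(2) by simp
qed

section \<open>Exchange inequalities between minimal costs\<close>

lemma card_matching_row: "matching S \<Longrightarrow> card {p \<in> S. fst p = l} \<le> 1"
proof -
  assume S: "matching S"
  have "card {p \<in> S. fst p = l} = card (fst ` {p \<in> S. fst p = l})"
    using matching_card(1)[OF matching_subset[OF S, of "{p \<in> S. fst p = l}"]] by auto
  also have "\<dots> \<le> card {l}" by (rule card_mono) auto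
  finally show ?thesis by simp
qed

lemma card_matching_col: "matching S \<Longrightarrow> card {p \<in> S. snd p = l} \<le> 1"
proof -
  assume S: "matching S"
  have "card {p \<in> S. snd p = l} = card (snd ` {p \<in> S. snd p = l})"
    using matching_card(2)[OF matching_subset[OF S, of "{p \<in> S. snd p = l}"]] by auto
  also have "\<dots> \<le> card {l}" by (rule card_mono) auto
  finally show ?thesis by simp
qed

text \<open>If row \<open>l\<close> can be avoided at no extra cost at size \<open>Suc s\<close>,
  this inequality lets it be avoided at no extra cost at size \<open>s\<close> off column
  \<open>j\<close>. The alternating path from \<open>l\<close> moves that row from \<open>w\<close>
  to \<open>u\<close>; the modified \<open>w\<close> gains no column and so still avoids
  \<open>j\<close>.\<close>

lemma opt_row_col_exchange:
  assumes fin: "finite I" "finite K" and s: "Suc s \<le> card (I - {l})" "Suc s \<le> card K"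
  shows "opt A (Suc s) I K + opt A s (I - {l}) (K - {j})
    \<le> opt A (Suc s) (I - {l}) K + opt A s I (K - {j})"
proof -
  have f: "finite (I - {l})" "finite (K - {j})" using fin by auto
  have cI: "s \<le> card I" using s(1) card_mono[of I "I - {l}"] fin by auto
  have cK: "s \<le> card (K - {j})" using s(2) fin by (cases "j \<in> K") auto
  obtain u where u: "u \<in> assigns (Suc s) (I - {l}) K" "cost A u = opt A (Suc s) (I - {l}) K"
    using opt_attained[OF f(1) fin(2) s] .
  obtain w where w: "w \<in> assigns s I (K - {j})" "cost A w = opt A s I (K - {j})"
    using opt_attained[OF fin(1) f(2) cI cK] .
  note S = assignsD[OF u(1)] and M = assignsD[OF w(1)]
  have "\<exists>u'\<in>assigns (Suc s) I K. \<exists>w'\<in>assigns s (I - {l}) (K - {j}).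
      cost A u' + cost A w' = cost A u + cost A w"
  proof (cases "l \<in> fst ` w")
    case False
    have "u \<in> assigns (Suc s) I K" using S by (intro assignsI) auto
    moreover have "w \<in> assigns s (I - {l}) (K - {j})" using M False by (intro assignsI) auto
    ultimately show ?thesis by blast
  next
    case True
    have l: "l \<notin> fst ` u" using S(5) by blast
    obtain S0 T where P: "S0 \<subseteq> u" "T \<subseteq> w" "separated (S0 \<union> T) ((u - S0) \<union> (w - T))"
      "l \<in> fst ` T" "snd ` S0 \<subseteq> snd ` T"
      "card T = Suc (card S0) \<and> fst ` S0 \<subseteq> fst ` T \<or> card T = card S0"
      using alternating_path[OF S(2) M(2) True l] by blast
    have sep2: "separated (T \<union> S0) ((w - T) \<union> (u - S0))" using P(3) by (simp add: Un_commute)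
    define u1 where "u1 = (u - S0) \<union> T"
    define w1 where "w1 = (w - T) \<union> S0"
    note a = swap_matching[OF S(2) M(2) P(1-3), folded u1_def]
      and b = swap_matching[OF M(2) S(2) P(2,1) sep2, folded w1_def]
    have sum1: "cost A u1 + cost A w1 = cost A u + cost A w"
      unfolding cost_def using a(3)[of A] b(3)[of A] by linarith
    have "fst ` w1 \<subseteq> (fst ` w - fst ` T) \<union> fst ` u"
      unfolding w1_def image_Un using matching_Diff(1)[OF M(2) P(2)] P(1) by auto
    then have rw1: "fst ` w1 \<subseteq> I - {l}" using P(4) M(5) S(5) by blast
    have "snd ` w1 \<subseteq> snd ` w" unfolding w1_def image_Un using P(2,5) by blast
    then have cw1: "snd ` w1 \<subseteq> K - {j}" using M(6) by auto
    have "u1 \<subseteq> u \<union> w" unfolding u1_def using P(2) by auto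
    then have rcu1: "fst ` u1 \<subseteq> I" "snd ` u1 \<subseteq> K" using S(5,6) M(5,6) by blast+
    show ?thesis
    proof (cases "card T = card S0")
      case True
      have "card u1 = Suc s" "card w1 = s" using a(2) b(2) True S(3) M(3) by auto
      then have "u1 \<in> assigns (Suc s) I K" "w1 \<in> assigns s (I - {l}) (K - {j})"
        using a(1) b(1) rw1 cw1 rcu1 by (auto intro: assignsI)
      then show ?thesis using sum1 by blast
    next
      case False
      then have cT: "card T = Suc (card S0)" using P(6) by blast
      have c1: "card u1 = Suc (Suc s)" "Suc (card w1) = s" using a(2) b(2) cT S(3) M(3) by auto
      \<comment> \<open>The path changed the sizes to \<open>s + 2\<close> and \<open>s - 1\<close>.
        At most two entries of \<open>u1\<close> meet row \<open>l\<close> or column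
        \<open>j\<close>, so the part \<open>v\<close> off both is larger than \<open>w1\<close>,
        and a second exchange inside it restores the sizes without touching \<open>l\<close> or
        \<open>j\<close>.\<close>
      define v where "v = {p \<in> u1. fst p \<noteq> l \<and> snd p \<noteq> j}"
      have v: "v \<subseteq> u1" "matching v" unfolding v_def using matching_subset[OF a(1)] by auto
      have fin1: "finite u1" using a(1) unfolding matching_def by blast
      have "card (u1 - v) \<le> card ({p \<in> u1. fst p = l} \<union> {p \<in> u1. snd p = j})"
        unfolding v_def using fin1 by (intro card_mono) auto
      also have "\<dots> \<le> 2"
        using card_Un_le[of "{p \<in> u1. fst p = l}" "{p \<in> u1. snd p = j}"]
          card_matching_row[OF a(1), of l] card_matching_col[OF a(1), of j] by linarith
      finally have "card (u1 - v) \<le> 2" .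
      moreover have cd: "card (u1 - v) + card v = card u1"
        using card_Diff_subset[of v u1] v(1) fin1 card_mono[OF fin1 v(1)] finite_subset by force
      ultimately have lt: "card w1 < card v" using c1 by linarith
      obtain w2 v2 l' j' where ex: "exchange w1 v w2 v2 l' j'"
        using matching_exchange[OF b(1) v(2) lt] by blast
      note E = exchangeD[OF ex]
      have "l' \<noteq> l" "j' \<noteq> j" "l' \<in> I" "j' \<in> K" using E(6,9) rcu1 unfolding v_def by auto
      then have "w2 \<in> assigns s (I - {l}) (K - {j})"
        using E(1,4,7,10) c1(2) rw1 cw1 by (intro assignsI) auto
      moreover have d: "fst ` v2 \<inter> fst ` (u1 - v) = {}" "snd ` v2 \<inter> snd ` (u1 - v) = {}"
        using matching_Diff[OF a(1) v(1)] E(8,11) by auto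
      have m: "matching (u1 - v)" using matching_subset[OF a(1)] by auto
      have "matching (v2 \<union> (u1 - v))" by (rule matching_Un[OF E(2) m d])
      moreover have "card (v2 \<union> (u1 - v)) = Suc s"
        using card_matching_Un[OF E(2) m d(1)] cd c1 E(5) by linarith
      moreover have "fst ` (v2 \<union> (u1 - v)) \<subseteq> I" "snd ` (v2 \<union> (u1 - v)) \<subseteq> K"
        using image_mono[OF v(1), of fst] image_mono[OF v(1), of snd]
          image_mono[OF Diff_subset, of fst u1 v] image_mono[OF Diff_subset, of snd u1 v] rcu1
        unfolding image_Un E(8,11) by (meson Diff_subset Un_least subset_trans)+
      ultimately have "w2 \<in> assigns s (I - {l}) (K - {j})" "v2 \<union> (u1 - v) \<in> assigns (Suc s) I K"
        by (auto intro: assignsI)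
      moreover have "cost A (v2 \<union> (u1 - v)) + cost A w2 = cost A u1 + cost A w1"
      proof -
        have "cost A (v2 \<union> (u1 - v)) = cost A v2 + cost A (u1 - v)"
          using E(2) m d(1) unfolding matching_def by (intro cost_Un) auto
        moreover have "cost A (u1 - v) = cost A u1 - cost A v"
          unfolding cost_def using fin1 v(1) by (simp add: sum_diff)
        ultimately show ?thesis using E(12)[of A] unfolding cost_def by linarith
      qed
      ultimately show ?thesis using sum1 by (metis (no_types, lifting))
    qed
  qed
  then obtain u' w' where "u' \<in> assigns (Suc s) I K" "w' \<in> assigns s (I - {l}) (K - {j})"
      "cost A u' + cost A w' = cost A u + cost A w" by blast
  then show ?thesis using opt_le[OF fin, of u' _ A] opt_le[OF f, of w' _ A] u(2) w(2) by fastforce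
qed

text \<open>Discrete convexity, needed to make \<open>delta\<close> nondecreasing in the size. In
  one exchange the column that passes over is either \<open>j\<close>, and then the larger
  assignment loses it, or another one, and then the smaller assignment still avoids
  \<open>j\<close>.\<close>

lemma opt_col_convex:
  assumes fin: "finite I" "finite K" and s: "Suc (Suc s) \<le> card I" "Suc (Suc s) \<le> card K"
  shows "opt A (Suc s) I K + opt A (Suc s) I (K - {j})
    \<le> opt A (Suc (Suc s)) I K + opt A s I (K - {j})"
proof -
  have f: "finite (K - {j})" using fin by auto
  have c: "s \<le> card I" "s \<le> card (K - {j})" using s fin by (auto simp: card_Diff_singleton_if)
  obtain w where w: "w \<in> assigns (Suc (Suc s)) I K" "cost A w = opt A (Suc (Suc s)) I K"
    using opt_attained[OF fin s] .
  obtain z where z: "z \<in> assigns s I (K - {j})" "cost A z = opt A s I (K - {j})"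
    using opt_attained[OF fin(1) f c] .
  note M = assignsD[OF w(1)] and N = assignsD[OF z(1)]
  have lt: "card z < card w" using M(3) N(3) by simp
  obtain z' w' l' j' where ex: "exchange z w z' w' l' j'"
    using matching_exchange[OF N(2) M(2) lt] by blast
  note E = exchangeD[OF ex]
  have r: "fst ` z' \<subseteq> I" "fst ` w' \<subseteq> I" "snd ` z' \<subseteq> K" "snd ` w' \<subseteq> K" "l' \<in> I" "j' \<in> K"
    using E(6-11) M(5,6) N(5,6) by auto
  have cc: "card z' = Suc s" "card w' = Suc s" using E(4,5) M(3) N(3) by auto
  have sum: "cost A z' + cost A w' = cost A z + cost A w" using E(12)[of A] unfolding cost_def .
  have i: "z' \<in> assigns (Suc s) I K" "w' \<in> assigns (Suc s) I K" using E(1,2) r cc by (auto intro: assignsI)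
  show ?thesis
  proof (cases "j' = j")
    case True
    have "w' \<in> assigns (Suc s) I (K - {j})" using E(2,11) r cc True by (intro assignsI) auto
    then show ?thesis
      using opt_le[OF fin(1) f, of w' _ A] opt_le[OF fin i(1), of A] sum w(2) z(2) by fastforce
  next
    case False
    have "z' \<in> assigns (Suc s) I (K - {j})"
      using E(1,10) r cc False N(6) by (intro assignsI) auto
    then show ?thesis
      using opt_le[OF fin(1) f, of z' _ A] opt_le[OF fin i(2), of A] sum w(2) z(2) by fastforce
  qed
qed

section \<open>Flats of the zero pattern\<close>

locale zero_pattern =
  fixes I K :: "nat set" and Z :: "(nat \<times> nat) set"
  assumes fin: "finite I" "finite K"
begin

definition zero_cols :: "nat set \<Rightarrow> nat set" where
  "zero_cols T = {j \<in> K. \<exists>i\<in>T. (i, j) \<in> Z}"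

text \<open>The least size of a cover whose rows are exactly \<open>F\<close>: every column with a
  zero outside \<open>F\<close> is forced.\<close>

definition cover_size :: "nat set \<Rightarrow> nat" where
  "cover_size F = card F + card (zero_cols (I - F))"

text \<open>The strict inequality makes \<open>F\<close> the largest row set among the minimum
  covers containing it, so that \<open>cover_size F\<close> is its rank.\<close>

definition flat :: "nat set \<Rightarrow> bool" where
  "flat F \<longleftrightarrow> F \<subseteq> I \<and> (\<forall>F'. F \<subset> F' \<and> F' \<subseteq> I \<longrightarrow> cover_size F < cover_size F')"

definition is_closure :: "nat set \<Rightarrow> nat set \<Rightarrow> bool" where
  "is_closure R F \<longleftrightarrow> R \<subseteq> F \<and> F \<subseteq> I \<and>
    (\<forall>F'. R \<subseteq> F' \<and> F' \<subseteq> I \<longrightarrow> cover_size F \<le> cover_size F' \<and>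
      (cover_size F' = cover_size F \<longrightarrow> F' \<subseteq> F))"

definition cl :: "nat set \<Rightarrow> nat set" where
  "cl R = (SOME F. is_closure R F)"

lemma zero_cols_subset: "zero_cols T \<subseteq> K"
  unfolding zero_cols_def by auto

lemma finite_zero_cols: "finite (zero_cols T)"
  using zero_cols_subset fin(2) finite_subset by blast

lemma zero_cols_mono: "S \<subseteq> T \<Longrightarrow> zero_cols S \<subseteq> zero_cols T"
  unfolding zero_cols_def by auto

lemma zero_cols_Un: "zero_cols (S \<union> T) = zero_cols S \<union> zero_cols T"
  unfolding zero_cols_def by auto

lemma finite_rows: "F \<subseteq> I \<Longrightarrow> finite F"
  using fin(1) finite_subset by blast

lemma cover_size_submodular:
  assumes "A \<subseteq> I" "B \<subseteq> I"
  shows "cover_size (A \<union> B) + cover_size (A \<inter> B) \<le> cover_size A + cover_size B"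
proof -
  let ?X = "zero_cols (I - A)" and ?Y = "zero_cols (I - B)"
  have "card A + card B = card (A \<union> B) + card (A \<inter> B)"
    using assms finite_rows by (intro card_Un_Int) auto
  moreover have "card ?X + card ?Y = card (?X \<union> ?Y) + card (?X \<inter> ?Y)"
    by (intro card_Un_Int finite_zero_cols)
  moreover have "zero_cols (I - A \<inter> B) = ?X \<union> ?Y"
    by (simp add: zero_cols_Un[symmetric] Diff_Int)
  moreover have "card (zero_cols (I - (A \<union> B))) \<le> card (?X \<inter> ?Y)"
    using zero_cols_mono[of "I - (A \<union> B)" "I - A"] zero_cols_mono[of "I - (A \<union> B)" "I - B"]
      finite_zero_cols by (intro card_mono) auto
  ultimately show ?thesis unfolding cover_size_def by simp
qed

text \<open>By submodularity the union of two row sets attaining the least \<open>cover_size\<close>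
  attains it too, so one with the most rows contains all the others.\<close>

lemma closure_exists:
  assumes R: "R \<subseteq> I"
  shows "\<exists>F. is_closure R F"
proof -
  define S where "S = {F. R \<subseteq> F \<and> F \<subseteq> I}"
  have S: "finite S" "R \<in> S" unfolding S_def using fin R by auto
  define h where "h = Min (cover_size ` S)"
  define S' where "S' = {F \<in> S. cover_size F = h}"
  have "h \<in> cover_size ` S" unfolding h_def using S by (intro Min_in) auto
  then have S': "finite S'" "S' \<noteq> {}" unfolding S'_def using S by auto
  have hle: "h \<le> cover_size F" if "F \<in> S" for F unfolding h_def using S that by auto
  obtain F where F: "F \<in> S'" "\<And>F'. F' \<in> S' \<Longrightarrow> card F' \<le> card F"
  proof -
    have "Max (card ` S') \<in> card ` S'" using S' by (intro Max_in) auto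
    then obtain F where "F \<in> S'" "card F = Max (card ` S')" by auto
    then show ?thesis using that[of F] S'(1) by auto
  qed
  have FI: "R \<subseteq> F" "F \<subseteq> I" "cover_size F = h" using F(1) unfolding S'_def S_def by auto
  have mx: "F' \<subseteq> F" if F': "R \<subseteq> F'" "F' \<subseteq> I" "cover_size F' = h" for F'
  proof -
    have "cover_size (F \<union> F') + cover_size (F \<inter> F') \<le> h + h"
      using cover_size_submodular[OF FI(2) F'(2)] FI(3) F'(3) by simp
    moreover have "h \<le> cover_size (F \<inter> F')" using FI F' by (intro hle) (auto simp: S_def)
    moreover have i: "F \<union> F' \<in> S" using FI F' by (auto simp: S_def)
    moreover have "h \<le> cover_size (F \<union> F')" using i by (rule hle)
    ultimately have "F \<union> F' \<in> S'" unfolding S'_def by auto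
    then have "card (F \<union> F') \<le> card F" by (rule F(2))
    then have "F = F \<union> F'" using FI F' finite_rows by (intro card_seteq) auto
    then show ?thesis by blast
  qed
  have "is_closure R F" unfolding is_closure_def
  proof (intro conjI allI impI FI(1,2))
    fix F' assume F': "R \<subseteq> F' \<and> F' \<subseteq> I"
    show "cover_size F \<le> cover_size F'" unfolding FI(3) using F' by (intro hle) (simp add: S_def)
    show "F' \<subseteq> F" if "cover_size F' = cover_size F" using F' that FI(3) by (intro mx) simp_all
  qed
  then show ?thesis ..
qed

lemma closure_cl: "R \<subseteq> I \<Longrightarrow> is_closure R (cl R)"
  unfolding cl_def using closure_exists by (rule someI_ex)

lemma
  assumes "R \<subseteq> I"
  shows subset_cl: "R \<subseteq> cl R" and cl_subset: "cl R \<subseteq> I"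
    and cover_size_cl_le: "R \<subseteq> F' \<Longrightarrow> F' \<subseteq> I \<Longrightarrow> cover_size (cl R) \<le> cover_size F'"
    and flat_cl: "flat (cl R)"
proof -
  note c = closure_cl[OF assms, unfolded is_closure_def]
  show "R \<subseteq> cl R" "cl R \<subseteq> I" using c by blast+
  show "R \<subseteq> F' \<Longrightarrow> F' \<subseteq> I \<Longrightarrow> cover_size (cl R) \<le> cover_size F'" using c by simp
  show "flat (cl R)" unfolding flat_def
  proof (intro conjI allI impI)
    show "cl R \<subseteq> I" using c by blast
    fix F' assume F': "cl R \<subset> F' \<and> F' \<subseteq> I"
    then have "R \<subseteq> F'" using c by blast
    then have "cover_size (cl R) \<le> cover_size F'" "cover_size F' = cover_size (cl R) \<longrightarrow> F' \<subseteq> cl R"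
      using c F' by simp_all
    then show "cover_size (cl R) < cover_size F'" using F' by (metis le_neq_implies_less not_less psubset_eq subset_antisym)
  qed
qed

lemma flat_subset: "flat F \<Longrightarrow> F \<subseteq> I"
  unfolding flat_def by blast

lemma flat_less: "flat F \<Longrightarrow> F \<subset> F' \<Longrightarrow> F' \<subseteq> I \<Longrightarrow> cover_size F < cover_size F'"
  unfolding flat_def by blast

text \<open>Otherwise flatness makes the \<open>cover_size\<close> of \<open>cl R \<union> F\<close>
  exceed that of \<open>F\<close>, and by submodularity \<open>cl R \<inter> F\<close>, which still
  contains \<open>R\<close>, would beat \<open>cl R\<close>.\<close>

lemma cl_least:
  assumes "R \<subseteq> F" "flat F"
  shows "cl R \<subseteq> F"
proof (rule ccontr)
  assume n: "\<not> cl R \<subseteq> F"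
  have FI: "F \<subseteq> I" "R \<subseteq> I" using assms flat_subset by blast+
  note c = subset_cl[OF FI(2)] cl_subset[OF FI(2)]
  have "cover_size (cl R \<union> F) + cover_size (cl R \<inter> F) \<le> cover_size (cl R) + cover_size F"
    using cover_size_submodular[OF c(2) FI(1)] .
  moreover have "cover_size (cl R) \<le> cover_size (cl R \<inter> F)"
    using c assms(1) FI by (intro cover_size_cl_le) auto
  moreover have "cover_size F < cover_size (cl R \<union> F)"
    using n c(2) FI by (intro flat_less[OF assms(2)]) auto
  ultimately show False by linarith
qed

lemma cl_mono: "R \<subseteq> S \<Longrightarrow> S \<subseteq> I \<Longrightarrow> cl R \<subseteq> cl S"
  using subset_cl[of S] flat_cl[of S] by (intro cl_least) auto

lemma flat_eqI: "flat F \<Longrightarrow> flat F' \<Longrightarrow> F \<subseteq> F' \<Longrightarrow> cover_size F = cover_size F' \<Longrightarrow> F = F'"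
  using flat_less[of F F'] flat_subset[of F'] by (metis less_irrefl psubsetI)

text \<open>One more row enlarges the cover by at most one, and flatness forces at least one. Ranks
  of flats therefore advance in step with sizes of assignments.\<close>

lemma cover_size_cl_insert:
  assumes F: "flat F" and l: "l \<in> I - F"
  shows "cover_size (cl (insert l F)) = Suc (cover_size F)"
proof -
  have lF: "insert l F \<subseteq> I" using l flat_subset[OF F] by blast
  have "cover_size (cl (insert l F)) \<le> cover_size (insert l F)"
    using cover_size_cl_le[OF lF subset_refl lF] .
  also have "\<dots> \<le> Suc (cover_size F)"
    unfolding cover_size_def using l finite_rows[OF flat_subset[OF F]]
      card_mono[OF finite_zero_cols zero_cols_mono[of "I - insert l F" "I - F"]] by auto
  finally have "cover_size (cl (insert l F)) \<le> Suc (cover_size F)" .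
  moreover have "cover_size F < cover_size (cl (insert l F))"
    using l subset_cl[OF lF] cl_subset[OF lF] by (intro flat_less[OF F]) auto
  ultimately show ?thesis by linarith
qed

section \<open>Matchings by zeros, from Hall's condition\<close>

lemma matching_flip: "matching W \<Longrightarrow> matching (prod.swap ` W)"
  unfolding matching_def by (auto simp: inj_on_def)

text \<open>Flatness of \<open>F\<close> is Hall's condition with one row to spare.\<close>

lemma zero_matching_cols:
  assumes F: "flat F" and l: "l \<in> I - F"
  obtains W where "W \<subseteq> Z" "matching W" "fst ` W \<subseteq> I - F - {l}" "snd ` W = zero_cols (I - F)"
proof -
  let ?J = "zero_cols (I - F)"
  define E where "E = {(j, i). j \<in> ?J \<and> i \<in> I - F - {l} \<and> (i, j) \<in> Z}"
  have finE: "finite E" by (rule finite_subset[of _ "?J \<times> I"]) (auto simp: E_def fin finite_zero_cols)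
  have H: "card T \<le> card (E `` T)" if T: "T \<subseteq> ?J" for T
  proof (cases "T = {}")
    case False
    \<comment> \<open>Adding the rows \<open>T0\<close> to \<open>F\<close> frees the columns
      \<open>T\<close> from the cover, so flatness makes \<open>T0\<close> strictly larger than
      \<open>T\<close>; the strictness pays for leaving out row \<open>l\<close>.\<close>
    define T0 where "T0 = {i \<in> I - F. \<exists>j\<in>T. (i, j) \<in> Z}"
    have T0: "finite T0" "T0 \<subseteq> I - F" unfolding T0_def using fin by auto
    obtain j where "j \<in> T" using False by blast
    then have "T0 \<noteq> {}" using T unfolding T0_def zero_cols_def by blast
    then have "cover_size F < cover_size (F \<union> T0)"
      using T0 flat_subset[OF F] by (intro flat_less[OF F]) auto
    moreover have "card (F \<union> T0) = card F + card T0"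
      using T0 finite_rows[OF flat_subset[OF F]] by (intro card_Un_disjoint) auto
    moreover have "zero_cols (I - (F \<union> T0)) \<subseteq> ?J - T" unfolding zero_cols_def T0_def by auto
    then have "card (zero_cols (I - (F \<union> T0))) \<le> card (?J - T)"
      using finite_zero_cols by (intro card_mono) auto
    moreover have "card (?J - T) = card ?J - card T" "card T \<le> card ?J"
      using T finite_subset[OF T finite_zero_cols] card_mono[OF finite_zero_cols T]
      by (simp_all add: card_Diff_subset)
    ultimately have "card T < card T0" unfolding cover_size_def by linarith
    moreover have "T0 - {l} \<subseteq> E `` T" unfolding T0_def E_def using T by auto
    then have "card (T0 - {l}) \<le> card (E `` T)" using finE by (intro card_mono) (auto simp: finite_Image)
    moreover have "card T0 \<le> Suc (card (T0 - {l}))" using T0(1) by (auto simp: card_Diff_singleton_if)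
    ultimately show ?thesis by linarith
  qed simp
  obtain W where W: "W \<subseteq> E" "matching W" "fst ` W = ?J"
    using hall[OF finite_zero_cols finE H] by blast
  show ?thesis
  proof (rule that[of "prod.swap ` W"])
    show "prod.swap ` W \<subseteq> Z" using W(1) unfolding E_def by auto
    show "matching (prod.swap ` W)" using W(2) by (rule matching_flip)
    show "fst ` prod.swap ` W \<subseteq> I - F - {l}" using W(1) unfolding E_def by auto
    show "snd ` prod.swap ` W = ?J" using W(3) by (simp add: image_comp comp_def)
  qed
qed

text \<open>Minimality of \<open>cl R\<close> is Hall's condition for the added rows: dropping
  \<open>T\<close> from the cover saves \<open>card T\<close> rows and forces only new columns that
  carry zeros of \<open>T\<close>, so there are at least \<open>card T\<close> of these.\<close>

lemma zero_matching_closure: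
  assumes R: "R \<subseteq> I"
  obtains W where "W \<subseteq> Z" "matching W" "fst ` W = cl R - R"
    "snd ` W \<subseteq> zero_cols (I - R) - zero_cols (I - cl R)"
proof -
  let ?J = "zero_cols (I - R)" and ?J' = "zero_cols (I - cl R)"
  define E where "E = Z \<inter> ((cl R - R) \<times> (?J - ?J'))"
  have c: "R \<subseteq> cl R" "cl R \<subseteq> I" using subset_cl[OF R] cl_subset[OF R] .
  have f: "finite (cl R)" using c finite_rows by blast
  have finE: "finite E"
    by (rule finite_subset[of _ "cl R \<times> ?J"]) (auto simp: E_def f finite_zero_cols)
  have H: "card T \<le> card (E `` T)" if T: "T \<subseteq> cl R - R" for T
  proof -
    have fT: "finite T" using T f finite_subset by blast
    have "cover_size (cl R) \<le> cover_size (cl R - T)"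
      using c T by (intro cover_size_cl_le[OF R]) auto
    moreover have "card (cl R - T) = card (cl R) - card T" "card T \<le> card (cl R)"
      using T f fT by (auto intro: card_Diff_subset card_mono)
    moreover have "I - (cl R - T) = (I - cl R) \<union> T" using T c by auto
    then have "card (zero_cols (I - (cl R - T))) \<le> card ?J' + card (zero_cols T - ?J')"
      using card_Un_le[of ?J' "zero_cols T - ?J'"] by (simp add: zero_cols_Un)
    moreover have "zero_cols T - ?J' \<subseteq> E `` T"
    proof
      fix x assume x: "x \<in> zero_cols T - ?J'"
      then obtain i where i: "i \<in> T" "(i, x) \<in> Z" "x \<in> K" unfolding zero_cols_def by blast
      have "i \<in> I - R" using i(1) T c by blast
      then have "x \<in> ?J" using i(2,3) unfolding zero_cols_def by blast
      then show "x \<in> E `` T" using i x T unfolding E_def by blast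
    qed
    then have "card (zero_cols T - ?J') \<le> card (E `` T)"
      using finE by (intro card_mono) (auto simp: finite_Image)
    ultimately show ?thesis unfolding cover_size_def by linarith
  qed
  obtain W where W: "W \<subseteq> E" "matching W" "fst ` W = cl R - R"
    using hall[OF finite_Diff[OF f] finE H] by blast
  show ?thesis by (rule that[of W]) (use W in \<open>force simp: E_def\<close>)+
qed

section \<open>Costs attached to a flat\<close>

definition free_cols :: "nat set \<Rightarrow> nat set" where
  "free_cols F = K - zero_cols (I - F)"

definition flat_cost :: "(nat \<times> nat \<Rightarrow> real) \<Rightarrow> nat set \<Rightarrow> real" where
  "flat_cost A F = opt A (card F) F (free_cols F)"

definition flat_cost_minus :: "(nat \<times> nat \<Rightarrow> real) \<Rightarrow> nat set \<Rightarrow> nat \<Rightarrow> real" where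
  "flat_cost_minus A F j = opt A (card F) F (free_cols F - {j})"

text \<open>The rows of \<open>F\<close> alone account for the minimum of size
  \<open>cover_size F\<close>; the remaining entries can be zeros in the columns
  \<open>zero_cols (I - F)\<close>.\<close>

definition tight :: "(nat \<times> nat \<Rightarrow> real) \<Rightarrow> nat set \<Rightarrow> bool" where
  "tight A F \<longleftrightarrow> opt A (cover_size F) I K = flat_cost A F"

definition link_cost :: "(nat \<times> nat \<Rightarrow> real) \<Rightarrow> nat set \<Rightarrow> nat \<times> nat \<Rightarrow> real" where
  "link_cost A F p = A p + flat_cost_minus A F (snd p)"

text \<open>Strictness leaves at most one such entry among those outside \<open>F\<close> in free
  columns; \<open>generic\<close> will provide one.\<close>

definition chosen :: "(nat \<times> nat \<Rightarrow> real) \<Rightarrow> nat set \<Rightarrow> nat \<times> nat \<Rightarrow> bool" where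
  "chosen A F p \<longleftrightarrow>
    (\<forall>q\<in>(I - F) \<times> free_cols F. q \<noteq> p \<longrightarrow> link_cost A F p < link_cost A F q)"

lemma free_cols_subset: "free_cols F \<subseteq> K"
  unfolding free_cols_def by blast

lemma finite_free_cols: "finite (free_cols F)"
  using free_cols_subset fin(2) finite_subset by blast

lemma card_free_cols: "card (free_cols F) + card (zero_cols (I - F)) = card K"
  unfolding free_cols_def using zero_cols_subset finite_zero_cols fin(2)
  by (simp add: card_Diff_subset card_mono)

text \<open>Padding at no cost: zeros in rows outside \<open>F\<close> fill all columns in
  \<open>zero_cols (I - F)\<close>, even with the prescribed row \<open>l\<close> left out.\<close>

lemma flat_extend_zero:
  assumes F: "flat F" and A: "\<And>p. p \<in> Z \<Longrightarrow> A p = 0"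
    and l: "l \<in> I - F" and R: "R \<inter> (I - F - {l}) = {}" "R \<subseteq> I"
    and u: "u \<in> assigns s R C" "C \<subseteq> free_cols F"
  obtains u' where "u' \<in> assigns (s + card (zero_cols (I - F))) (R \<union> (I - F - {l}))
      (C \<union> zero_cols (I - F))" "cost A u' = cost A u"
proof -
  obtain W where W: "W \<subseteq> Z" "matching W" "fst ` W \<subseteq> I - F - {l}" "snd ` W = zero_cols (I - F)"
    using zero_matching_cols[OF F l] .
  note S = assignsD[OF u(1)]
  have d: "fst ` u \<inter> fst ` W = {}" using S(5) W(3) R by blast
  have d2: "snd ` u \<inter> snd ` W = {}" using S(6) W(4) u(2) unfolding free_cols_def by blast
  have cW: "card W = card (zero_cols (I - F))" using matching_card(2)[OF W(2)] W(4) by simp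
  have m: "matching (u \<union> W)" by (rule matching_Un[OF S(2) W(2) d d2])
  have "u \<union> W \<in> assigns (s + card (zero_cols (I - F))) (R \<union> (I - F - {l})) (C \<union> zero_cols (I - F))"
    using m card_matching_Un[OF S(2) W(2) d] S W cW by (intro assignsI) (auto simp: image_Un)
  moreover have "cost A (u \<union> W) = cost A u + cost A W"
    using S(4) W(2) d unfolding matching_def by (intro cost_Un) auto
  moreover have "cost A W = 0" unfolding cost_def using W(1) A by (intro sum.neutral) auto
  ultimately show ?thesis using that by simp
qed

end

section \<open>Augmentation beyond a tight flat\<close>

lemma disjoint_subset_left: "A \<inter> B = {} \<Longrightarrow> A' \<subseteq> A \<Longrightarrow> A' \<inter> B = {}"
  by blast

locale weighted_zero_pattern = zero_pattern +
  fixes A :: "nat \<times> nat \<Rightarrow> real"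
  assumes nonneg: "\<And>p. A p \<ge> 0" and zero: "\<And>p. p \<in> Z \<Longrightarrow> A p = 0"
begin

lemma flat_cost_attained:
  assumes F: "flat F" and s: "cover_size F \<le> card K"
  obtains u where "u \<in> assigns (card F) F (free_cols F)" "cost A u = flat_cost A F"
proof -
  have "card F \<le> card (free_cols F)" using s card_free_cols[of F] unfolding cover_size_def by linarith
  then obtain u where "u \<in> assigns (card F) F (free_cols F)" "cost A u = opt A (card F) F (free_cols F)"
    using opt_attained[OF finite_rows[OF flat_subset[OF F]] finite_free_cols order_refl] by metis
  then show ?thesis using that unfolding flat_cost_def by blast
qed

lemma flat_cost_minus_attained:
  assumes F: "flat F" and s: "cover_size F < card K"
  obtains u where "u \<in> assigns (card F) F (free_cols F - {j})" "cost A u = flat_cost_minus A F j"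
proof -
  have "card (free_cols F) \<le> Suc (card (free_cols F - {j}))"
    using finite_free_cols by (auto simp: card_Diff_singleton_if)
  then have "card F \<le> card (free_cols F - {j})"
    using s card_free_cols[of F] unfolding cover_size_def by linarith
  then obtain u where "u \<in> assigns (card F) F (free_cols F - {j})"
    "cost A u = opt A (card F) F (free_cols F - {j})"
    using opt_attained[OF finite_rows[OF flat_subset[OF F]] finite_Diff[OF finite_free_cols] order_refl]
    by metis
  then show ?thesis using that unfolding flat_cost_minus_def by blast
qed

lemma flat_cost_le:
  assumes F: "flat F" and u: "u \<in> assigns (card F) F (free_cols F)"
  shows "flat_cost A F \<le> cost A u"
  unfolding flat_cost_def by (rule opt_le[OF finite_rows[OF flat_subset[OF F]] finite_free_cols u])

lemma flat_cost_minus_le: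
  assumes F: "flat F" and u: "u \<in> assigns (card F) F (free_cols F - {j})"
  shows "flat_cost_minus A F j \<le> cost A u"
  unfolding flat_cost_minus_def
  by (rule opt_le[OF finite_rows[OF flat_subset[OF F]] _ u]) (simp add: finite_free_cols)

lemma flat_extend:
  assumes F: "flat F" and l: "l \<in> I - F"
    and u: "u \<in> assigns (card F) F (free_cols F)"
  obtains u' where "u' \<in> assigns (cover_size F) (I - {l}) K" "cost A u' = cost A u"
proof -
  obtain u' where s: "u' \<in> assigns (card F + card (zero_cols (I - F))) (F \<union> (I - F - {l}))
      (free_cols F \<union> zero_cols (I - F))" "cost A u' = cost A u"
  proof (rule flat_extend_zero[where A = A, OF F zero l _ flat_subset[OF F] u subset_refl])
    show "F \<inter> (I - F - {l}) = {}" by blast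
  qed auto
  have "F \<union> (I - F - {l}) = I - {l}" using l flat_subset[OF F] by blast
  moreover have "free_cols F \<union> zero_cols (I - F) = K"
    unfolding free_cols_def using zero_cols_subset by blast
  ultimately show ?thesis using s that unfolding cover_size_def by simp
qed

lemma flat_extend_insert:
  assumes F: "flat F" and l: "l \<in> I - F"
    and u: "u \<in> assigns (Suc (card F)) (insert l F) (free_cols F)"
  shows "opt A (Suc (cover_size F)) I K \<le> cost A u"
proof -
  obtain u' where s: "u' \<in> assigns (Suc (card F) + card (zero_cols (I - F)))
      (insert l F \<union> (I - F - {l})) (free_cols F \<union> zero_cols (I - F))" "cost A u' = cost A u"
  proof (rule flat_extend_zero[where A = A, OF F zero l _ _ u subset_refl])
    show "insert l F \<inter> (I - F - {l}) = {}" "insert l F \<subseteq> I" using l flat_subset[OF F] by blast+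
  qed auto
  have "insert l F \<union> (I - F - {l}) = I" using l flat_subset[OF F] by blast
  moreover have "free_cols F \<union> zero_cols (I - F) = K"
    unfolding free_cols_def using zero_cols_subset by blast
  ultimately have "u' \<in> assigns (Suc (cover_size F)) I K" using s(1) unfolding cover_size_def by simp
  then show ?thesis using opt_le[OF fin, of u' _ A] s(2) by simp
qed

lemma flat_extend_minus:
  assumes F: "flat F" and l: "l \<in> I - F" and j: "j \<in> free_cols F"
    and u: "u \<in> assigns (card F) F (free_cols F - {j})"
  shows "opt A (cover_size F) I (K - {j}) \<le> cost A u"
proof -
  obtain u' where s: "u' \<in> assigns (card F + card (zero_cols (I - F)))
      (F \<union> (I - F - {l})) ((free_cols F - {j}) \<union> zero_cols (I - F))" "cost A u' = cost A u"
  proof (rule flat_extend_zero[where A = A, OF F zero l _ flat_subset[OF F] u Diff_subset])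
    show "F \<inter> (I - F - {l}) = {}" by blast
  qed auto
  have "(free_cols F - {j}) \<union> zero_cols (I - F) = K - {j}"
    using j unfolding free_cols_def using zero_cols_subset by blast
  then have "u' \<in> assigns (cover_size F) I (K - {j})"
    using s(1) flat_subset[OF F] unfolding cover_size_def assigns_def by auto
  then show ?thesis using opt_le[OF fin(1) _, of "K - {j}" u' _ A] s(2) fin(2) by simp
qed

lemma row_outside_flat:
  assumes F: "flat F" and s: "cover_size F < card I"
  obtains l where "l \<in> I - F"
proof -
  have "card F < card I" using s unfolding cover_size_def by linarith
  then have "\<not> I \<subseteq> F" using card_mono[OF finite_rows[OF flat_subset[OF F]]] by (meson not_less)
  then show ?thesis using that by blast
qed

lemma opt_le_flat_cost:
  assumes F: "flat F" and s: "cover_size F < card I" "cover_size F \<le> card K"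
  shows "opt A (cover_size F) I K \<le> flat_cost A F"
proof -
  obtain l where l: "l \<in> I - F" using row_outside_flat[OF F s(1)] .
  obtain u where u: "u \<in> assigns (card F) F (free_cols F)" "cost A u = flat_cost A F"
    using flat_cost_attained[OF F s(2)] .
  obtain u' where u': "u' \<in> assigns (cover_size F) (I - {l}) K" "cost A u' = cost A u"
    using flat_extend[OF F l u(1)] .
  have "u' \<in> assigns (cover_size F) I K" using u'(1) unfolding assigns_def by auto
  then show ?thesis using opt_le[OF fin, of u' _ A] u' u by simp
qed

text \<open>The spare row in the zero matching makes every row outside a tight flat
  dispensable.\<close>

lemma tight_avoid_row:
  assumes F: "flat F" and s: "cover_size F \<le> card K" and t: "tight A F" and l: "l \<in> I - F"
  obtains w where "w \<in> assigns (cover_size F) (I - {l}) K" "cost A w = opt A (cover_size F) I K"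
proof -
  obtain u where u: "u \<in> assigns (card F) F (free_cols F)" "cost A u = flat_cost A F"
    using flat_cost_attained[OF F s] .
  obtain u' where u': "u' \<in> assigns (cover_size F) (I - {l}) K" "cost A u' = cost A u"
    using flat_extend[OF F l u(1)] .
  then show ?thesis using that[of u'] u(2) t unfolding tight_def by simp
qed

lemma opt_le_link_cost:
  assumes F: "flat F" and s: "cover_size F < card K" and p: "l \<in> I - F" "j \<in> free_cols F"
  shows "opt A (Suc (cover_size F)) I K \<le> link_cost A F (l, j)"
proof -
  obtain u where u: "u \<in> assigns (card F) F (free_cols F - {j})" "cost A u = flat_cost_minus A F j"
    using flat_cost_minus_attained[OF F s] .
  note S = assignsD[OF u(1)]
  have n: "(l, j) \<notin> u" using S(1) by auto
  have "matching ({(l, j)} \<union> u)" using S(2,5,6) p by (intro matching_Un) (auto simp: matching_def)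
  then have "insert (l, j) u \<in> assigns (Suc (card F)) (insert l F) (free_cols F)"
    using S(3-6) n p by (intro assignsI) auto
  then show ?thesis
    using flat_extend_insert[OF F p(1)] cost_insert[OF S(4) n, of A] u(2) unfolding link_cost_def by force
qed

text \<open>Exchanging an optimal assignment of the rows of \<open>F\<close> with the part of \<open>w\<close> in the free
  columns leaves a single entry outside the rows of \<open>F\<close>.\<close>

lemma link_cost_le:
  assumes F: "flat F" and s: "cover_size F < card K" and t: "tight A F"
    and w: "w \<in> assigns (Suc (cover_size F)) I K"
  obtains l j where "l \<in> I - F" "l \<in> fst ` w" "j \<in> free_cols F" "link_cost A F (l, j) \<le> cost A w"
proof -
  note M = assignsD[OF w]
  obtain u where u: "u \<in> assigns (card F) F (free_cols F)" "cost A u = flat_cost A F"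
    using flat_cost_attained[OF F less_imp_le[OF s]] .
  note S = assignsD[OF u(1)]
  define v where "v = {p \<in> w. snd p \<in> free_cols F}"
  have v: "v \<subseteq> w" "matching v" "matching (w - v)"
    unfolding v_def using matching_subset[OF M(2)] by auto
  \<comment> \<open>Outside the free columns \<open>w\<close> has at most
    \<open>card (zero_cols (I - F))\<close> entries, so more than \<open>card F\<close> of its
    entries are in \<open>v\<close>.\<close>
  have "snd ` (w - v) \<subseteq> zero_cols (I - F)" unfolding v_def using M(6) by (auto simp: free_cols_def)
  then have "card (w - v) \<le> card (zero_cols (I - F))"
    using card_mono[OF finite_zero_cols] matching_card(2)[OF v(3)] by metis
  moreover have cd: "card v + card (w - v) = Suc (cover_size F)"
    using card_Diff_subset[of v w] card_mono[OF M(4) v(1)] finite_subset[OF v(1) M(4)] v(1) M(3)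
    by linarith
  ultimately have lt: "card u < card v" using S(3) unfolding cover_size_def by linarith
  obtain u' v' l j' where ex: "exchange u v u' v' l j'"
    using matching_exchange[OF S(2) v(2) lt] by blast
  note E = exchangeD[OF ex]
  have sF: "fst ` u = F"
    using S(3,5) matching_card(1)[OF S(2)] finite_rows[OF flat_subset[OF F]] by (intro card_seteq) auto
  have d: "fst ` v' \<inter> fst ` (w - v) = {}" "snd ` v' \<inter> snd ` (w - v) = {}"
    using matching_Diff[OF M(2) v(1)] E(8,11) by auto
  have r: "fst ` v' \<subseteq> I" "snd ` v' \<subseteq> K" "fst ` (w - v) \<subseteq> I" "snd ` (w - v) \<subseteq> K"
    unfolding E(8,11) using image_mono[OF v(1), of fst] image_mono[OF v(1), of snd] M(5,6)
    by (meson Diff_subset image_mono subset_trans)+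
  \<comment> \<open>What remains of \<open>w\<close> has \<open>cover_size F\<close> entries and
    costs at least \<open>flat_cost A F\<close>; by conservation \<open>u'\<close> then costs at
    most as much as \<open>w\<close>.\<close>
  have "v' \<union> (w - v) \<in> assigns (cover_size F) I K"
    using matching_Un[OF E(2) v(3) d] card_matching_Un[OF E(2) v(3) d(1)] cd E(5) r
    by (intro assignsI) (simp_all add: image_Un)
  then have "flat_cost A F \<le> cost A (v' \<union> (w - v))" using opt_le[OF fin, of _ _ A] t unfolding tight_def by metis
  also have "\<dots> = cost A v' + cost A (w - v)"
    using E(2) v(3) d(1) unfolding matching_def by (intro cost_Un) auto
  also have "cost A (w - v) = cost A w - cost A v" unfolding cost_def using M(4) v(1) by (simp add: sum_diff)
  finally have le: "cost A u' \<le> cost A w" using E(12)[of A] u(2) unfolding cost_def by linarith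
  have lt': "l \<in> fst ` v" "l \<notin> F" using E(6) sF by auto
  then have lI: "l \<in> I - F" "l \<in> fst ` w" using v(1) M(5) by (auto dest: subsetD)
  have "l \<in> fst ` u'" using E(7) by blast
  then obtain j where j: "(l, j) \<in> u'" by auto
  have "snd ` v \<subseteq> free_cols F" unfolding v_def by auto
  then have cu': "snd ` u' \<subseteq> free_cols F" unfolding E(10) using E(9) S(6) by blast
  have jf: "j \<in> free_cols F" using cu' imageI[OF j, of snd] by auto
  have rm: "fst ` (u' - {(l, j)}) = fst ` u' - {l}" "snd ` (u' - {(l, j)}) = snd ` u' - {j}"
    using matching_Diff[OF E(1), of "{(l, j)}"] j by auto
  have finu': "finite u'" using E(1) unfolding matching_def by blast
  have "u' - {(l, j)} \<in> assigns (card F) F (free_cols F - {j})"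
    using matching_subset[OF E(1), of "u' - {(l, j)}"] rm E(4,7) j cu' S(3) sF finu'
    by (intro assignsI) auto
  then have "flat_cost_minus A F j \<le> cost A (u' - {(l, j)})" by (rule flat_cost_minus_le[OF F])
  then have "link_cost A F (l, j) \<le> cost A w"
    using le cost_Diff[OF finu' j, of A] unfolding link_cost_def by simp
  then show ?thesis using that lI jf by blast
qed

text \<open>The first alternative says that the threshold \<open>delta\<close> for column
  \<open>j\<close> does not grow at this stage, the second that the optimum off column
  \<open>j\<close> is no cheaper than one using the rows of \<open>F\<close> alone. An exchange
  between the optimum of \<open>F\<close> and the optimum \<open>w\<close> off column
  \<open>j\<close> decides, according to the row that passes over.\<close>

lemma opt_minus_dichotomy:
  assumes F: "flat F" and s: "cover_size F < card K" "cover_size F < card I" and t: "tight A F"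
  shows "opt A (Suc (cover_size F)) I K + opt A (cover_size F - 1) I (K - {j})
      \<le> opt A (cover_size F) I K + opt A (cover_size F) I (K - {j})
    \<or> j \<notin> zero_cols (I - F) \<and> flat_cost_minus A F j \<le> opt A (cover_size F) I (K - {j})"
proof -
  \<comment> \<open>A dummy row outside the matrix, whose single entry will occupy column
    \<open>j\<close>.\<close>
  obtain e where e: "e \<notin> I" using ex_new_if_finite[OF infinite_UNIV_nat fin(1)] by blast
  have fK: "finite (K - {j})" using fin(2) by blast
  have c: "cover_size F \<le> card I" "cover_size F \<le> card (K - {j})"
    using s fin by (auto simp: card_Diff_singleton_if)
  obtain w where w: "w \<in> assigns (cover_size F) I (K - {j})" "cost A w = opt A (cover_size F) I (K - {j})"
    using opt_attained[OF fin(1) fK c] .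
  note M = assignsD[OF w(1)]
  obtain u where u: "u \<in> assigns (card F) F (free_cols F)" "cost A u = flat_cost A F"
    using flat_cost_attained[OF F less_imp_le[OF s(1)]] .
  note S = assignsD[OF u(1)]
  define v where "v = {p \<in> w. snd p \<in> free_cols F}"
  have v: "v \<subseteq> w" "matching v" "matching (w - v)" "finite v" "snd ` v \<subseteq> free_cols F"
    unfolding v_def using matching_subset[OF M(2)] M(4) by auto
  have cm: "snd ` (w - v) \<subseteq> zero_cols (I - F) - {j}"
    unfolding v_def using M(6) by (auto simp: free_cols_def)
  then have "card (w - v) \<le> card (zero_cols (I - F) - {j})"
    using card_mono[OF finite_Diff[OF finite_zero_cols]] matching_card(2)[OF v(3)] by metis
  moreover have cd: "card v + card (w - v) = cover_size F"
    using card_Diff_subset[of v w] card_mono[OF M(4) v(1)] v(4) v(1) M(3) by linarith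
  ultimately have cv: "card F + card (zero_cols (I - F)) \<le> card v + card (zero_cols (I - F) - {j})"
    unfolding cover_size_def by linarith
  have sF: "fst ` u = F"
    using S(3,5) matching_card(1)[OF S(2)] finite_rows[OF flat_subset[OF F]] by (intro card_seteq) auto
  have rt: "fst ` v \<subseteq> I" "fst ` (w - v) \<subseteq> I" "snd ` v \<subseteq> K - {j}" "snd ` (w - v) \<subseteq> K - {j}"
    using v(1) M(5,6) by (meson Diff_subset image_mono subset_trans)+
  have dd: "fst ` v \<inter> fst ` (w - v) = {}" "snd ` v \<inter> snd ` (w - v) = {}"
    using matching_Diff[OF M(2) v(1)] by auto
  have costw: "cost A (w - v) = cost A w - cost A v"
    unfolding cost_def using M(4) v(1) by (simp add: sum_diff)
  \<comment> \<open>If a genuine row passed over, \<open>u'\<close> extends by zeros to size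
    \<open>Suc (cover_size F)\<close>, while \<open>v'\<close> with the rest of \<open>w\<close> has
    one entry less than \<open>w\<close> and still avoids \<open>j\<close>.\<close>
  have first: "opt A (Suc (cover_size F)) I K + opt A (cover_size F - 1) I (K - {j})
      \<le> opt A (cover_size F) I K + opt A (cover_size F) I (K - {j})"
    if u': "u' \<in> assigns (Suc (card F)) (insert l F) (free_cols F)" "l \<in> I - F"
      and v': "matching v'" "Suc (card v') = card v" "fst ` v' \<subseteq> fst ` v" "snd ` v' \<subseteq> snd ` v"
      and sum: "cost A u' + cost A v' = cost A u + cost A v" for u' v' l
  proof -
    have d: "fst ` v' \<inter> fst ` (w - v) = {}" "snd ` v' \<inter> snd ` (w - v) = {}"
      using disjoint_subset_left[OF dd(1) v'(3)] disjoint_subset_left[OF dd(2) v'(4)] .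
    have "v' \<union> (w - v) \<in> assigns (cover_size F - 1) I (K - {j})"
      using matching_Un[OF v'(1) v(3) d] card_matching_Un[OF v'(1) v(3) d(1)] cd v'(2) rt
        subset_trans[OF v'(3) rt(1)] subset_trans[OF v'(4) rt(3)]
      by (intro assignsI) (simp_all add: image_Un)
    then have "opt A (cover_size F - 1) I (K - {j}) \<le> cost A (v' \<union> (w - v))"
      by (rule opt_le[OF fin(1) fK])
    also have "\<dots> = cost A v' + cost A (w - v)"
      using v'(1) v(3) d(1) unfolding matching_def by (intro cost_Un) auto
    finally show ?thesis
      using flat_extend_insert[OF F u'(2,1)] sum costw w(2) u(2) t unfolding tight_def by linarith
  qed
  show ?thesis
  proof (cases "j \<in> zero_cols (I - F)")
    case True
    \<comment> \<open>Since \<open>w\<close> misses the zero column \<open>j\<close>, its part in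
      the free columns already outnumbers \<open>F\<close>.\<close>
    have "card u < card v"
      using cv S(3) card_Suc_Diff1[OF finite_zero_cols True] by linarith
    then obtain u' v' l j' where ex: "exchange u v u' v' l j'"
      using matching_exchange[OF S(2) v(2)] by blast
    note E = exchangeD[OF ex]
    have l: "l \<in> I - F" using E(6) sF rt(1) by blast
    have "j' \<in> free_cols F" using E(9) v(5) by blast
    then have "snd ` u' \<subseteq> free_cols F" unfolding E(10) using S(6) by blast
    then have s': "u' \<in> assigns (Suc (card F)) (insert l F) (free_cols F)"
      using E(1,4,7) S(3) sF by (intro assignsI) auto
    have sub: "fst ` v' \<subseteq> fst ` v" "snd ` v' \<subseteq> snd ` v" unfolding E(8,11) by blast+
    have sum: "cost A u' + cost A v' = cost A u + cost A v" using E(12)[of A] unfolding cost_def .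
    show ?thesis by (rule disjI1) (rule first[OF s' l E(2,5) sub sum])
  next
    case False
    \<comment> \<open>Without the dummy entry \<open>v\<close> might have only \<open>card F\<close>
      entries. Its weight \<open>A (e, j)\<close> is arbitrary and cancels.\<close>
    define v1 where "v1 = insert (e, j) v"
    have n: "(e, j) \<notin> v" using rt(1) e by force
    have m1: "matching ({(e, j)} \<union> v)"
      using v(2) rt(1,3) e by (intro matching_Un) (auto simp: matching_def)
    then have m1: "matching v1" unfolding v1_def by simp
    have c1: "card v1 = Suc (card v)" unfolding v1_def using n v(4) by simp
    have f1: "fst ` v1 = insert e (fst ` v)" "snd ` v1 = insert j (snd ` v)" unfolding v1_def by auto
    have "card u < card v1" using c1 cv S(3) False by simp
    then obtain u' v' l j' where ex: "exchange u v1 u' v' l j'"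
      using matching_exchange[OF S(2) m1] by blast
    note E = exchangeD[OF ex]
    have fin': "finite u'" "finite v'" using E(1,2) unfolding matching_def by blast+
    have eu: "e \<notin> fst ` u" using sF flat_subset[OF F] e by blast
    have ev: "e \<notin> fst ` v" using rt(1) e by blast
    have ej: "x = j" if "(e, x) \<in> u' \<union> v'" for x
    proof -
      have "(e, x) \<in> u \<union> v1" using E(3) that by blast
      moreover have "(e, x) \<notin> u" "(e, x) \<notin> v" using eu ev by force+
      ultimately show ?thesis unfolding v1_def by blast
    qed
    have sum: "cost A u' + cost A v' = cost A u + cost A v + A (e, j)"
      using E(12)[of A] n v(4) unfolding cost_def v1_def by simp
    have jK: "j \<notin> zero_cols (I - F)" using False .
    have "j' \<in> insert j (snd ` v)" using E(9) unfolding f1 by simp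
    then have j'F: "j' \<in> insert j (free_cols F)" using v(5) by blast
    show ?thesis
    proof (cases "l = e")
      case True
      \<comment> \<open>The dummy row passed over: the rest of \<open>u'\<close> assigns the rows of
        \<open>F\<close> off column \<open>j\<close>.\<close>
      have "e \<in> fst ` u'" using E(7) True by blast
      then obtain x where "(e, x) \<in> u'" by auto
      then have "(e, j) \<in> u'" using ej[of x] by simp
      have rm: "fst ` (u' - {(e, j)}) = fst ` u' - {e}" "snd ` (u' - {(e, j)}) = snd ` u' - {j}"
        using matching_Diff[OF E(1), of "{(e, j)}"] \<open>(e, j) \<in> u'\<close> by auto
      have "snd ` u' \<subseteq> insert j (free_cols F)" unfolding E(10) using j'F S(6) by blast
      then have "snd ` (u' - {(e, j)}) \<subseteq> free_cols F - {j}" unfolding rm by blast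
      moreover have "fst ` (u' - {(e, j)}) \<subseteq> F" unfolding rm E(7) sF True by blast
      ultimately have "u' - {(e, j)} \<in> assigns (card F) F (free_cols F - {j})"
        using matching_subset[OF E(1), of "u' - {(e, j)}"] E(4) S(3) fin' \<open>(e, j) \<in> u'\<close>
        by (intro assignsI) auto
      then have "flat_cost_minus A F j \<le> cost A (u' - {(e, j)})" by (rule flat_cost_minus_le[OF F])
      then have 1: "flat_cost_minus A F j \<le> cost A u' - A (e, j)"
        using cost_Diff[OF fin'(1) \<open>(e, j) \<in> u'\<close>, of A] by simp
      have ft: "fst ` v' = fst ` v" unfolding E(8) f1 True using ev by blast
      then have "(e, j) \<notin> v'" using ev by force
      then have "v' \<subseteq> u \<union> v" using E(3) unfolding v1_def by blast
      then have st: "snd ` v' \<subseteq> free_cols F" using S(6) v(5) by blast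
      have d: "fst ` v' \<inter> fst ` (w - v) = {}" "snd ` v' \<inter> snd ` (w - v) = {}"
      proof -
        show "fst ` v' \<inter> fst ` (w - v) = {}" using dd(1) ft by simp
        have "snd ` (w - v) \<inter> free_cols F = {}" unfolding free_cols_def using cm by blast
        then show "snd ` v' \<inter> snd ` (w - v) = {}" using st by blast
      qed
      have "v' \<union> (w - v) \<in> assigns (cover_size F) I K"
        using matching_Un[OF E(2) v(3) d] card_matching_Un[OF E(2) v(3) d(1)] cd E(5) c1
          ft rt subset_trans[OF st free_cols_subset] by (intro assignsI) (auto simp: image_Un)
      then have "flat_cost A F \<le> cost A (v' \<union> (w - v))"
        using opt_le[OF fin, of _ _ A] t unfolding tight_def by metis
      also have "\<dots> = cost A v' + cost A (w - v)"
        using E(2) v(3) d(1) unfolding matching_def by (intro cost_Un) auto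
      finally have "flat_cost_minus A F j \<le> cost A w" using 1 sum u(2) costw by linarith
      then show ?thesis using jK w(2) by simp
    next
      case False
      then have lI: "l \<in> fst ` v" "l \<in> I - F" using E(6) f1(1) sF rt(1) by blast+
      have "e \<in> fst ` v'" unfolding E(8) f1 using False by simp
      then obtain x where "(e, x) \<in> v'" by auto
      then have et: "(e, j) \<in> v'" using ej[of x] by simp
      have "j \<in> snd ` v'" using imageI[OF et, of snd] by simp
      then have j': "j' \<noteq> j" unfolding E(11) by blast
      have c': "snd ` u' \<subseteq> free_cols F" unfolding E(10) using j'F S(6) j' by blast
      have r': "fst ` u' \<subseteq> insert l F" unfolding E(7) sF by blast
      have s': "u' \<in> assigns (Suc (card F)) (insert l F) (free_cols F)"
        using E(1,4) S(3) c' r' by (intro assignsI) auto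
      have rm: "fst ` (v' - {(e, j)}) = fst ` v' - {e}" "snd ` (v' - {(e, j)}) = snd ` v' - {j}"
        using matching_Diff[OF E(2), of "{(e, j)}"] et by auto
      have sub: "fst ` (v' - {(e, j)}) \<subseteq> fst ` v" "snd ` (v' - {(e, j)}) \<subseteq> snd ` v"
        unfolding rm E(8,11) f1 by blast+
      have c2: "Suc (card (v' - {(e, j)})) = card v"
        using E(5) c1 card_Suc_Diff1[OF fin'(2) et] by linarith
      have m2: "matching (v' - {(e, j)})" using matching_subset[OF E(2) Diff_subset] .
      have sum2: "cost A u' + cost A (v' - {(e, j)}) = cost A u + cost A v"
        using sum cost_Diff[OF fin'(2) et, of A] by simp
      show ?thesis by (rule disjI1) (rule first[OF s' lI(2) m2 c2 sub sum2])
    qed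
  qed
qed

end

section \<open>Growth of the tight flat\<close>

context zero_pattern
begin

text \<open>For \<open>s > 0\<close>, an additional row with entry \<open>t\<close> in column
  \<open>j\<close> lowers the minimum of size \<open>s\<close> exactly if \<open>t\<close> is below
  this threshold. At \<open>s = 0\<close> the truncated \<open>s - 1\<close> leaves two empty
  assignments and the value 0.\<close>

definition delta :: "(nat \<times> nat \<Rightarrow> real) \<Rightarrow> nat \<Rightarrow> nat \<Rightarrow> real" where
  "delta A s j = opt A s I K - opt A (s - 1) I (K - {j})"

text \<open>A set determined by the matrix without reference to any flat; comparison with it gives
  uniqueness of the tight flat.\<close>

definition essential :: "(nat \<times> nat \<Rightarrow> real) \<Rightarrow> nat \<Rightarrow> nat set" where
  "essential A s = {i \<in> I. \<forall>S\<in>assigns s I K. cost A S = opt A s I K \<longrightarrow> i \<in> fst ` S}"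

text \<open>Only ties between single link costs are excluded; optimal assignments may still be far
  from unique because of the zeros.\<close>

definition generic :: "(nat \<times> nat \<Rightarrow> real) \<Rightarrow> bool" where
  "generic A \<longleftrightarrow> (\<forall>F\<in>Pow I. \<forall>p\<in>(I - F) \<times> free_cols F. \<forall>q\<in>(I - F) \<times> free_cols F.
     p \<noteq> q \<longrightarrow> link_cost A F p \<noteq> link_cost A F q)"

lemma delta_0: "delta A 0 j = 0"
  unfolding delta_def by (simp add: opt_0)

end

context weighted_zero_pattern
begin

lemma delta_mono:
  assumes "s < card I" "s < card K"
  shows "delta A s j \<le> delta A (Suc s) j"
proof (cases s)
  case 0
  have "0 \<le> opt A (Suc 0) I K" using assms 0 nonneg by (intro opt_nonneg fin) auto
  then show ?thesis unfolding 0 delta_0 by (simp add: delta_def opt_0)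
next
  case (Suc s')
  have "opt A (Suc s') I K + opt A (Suc s') I (K - {j})
      \<le> opt A (Suc (Suc s')) I K + opt A s' I (K - {j})"
    using assms Suc by (intro opt_col_convex fin) auto
  then show ?thesis unfolding delta_def Suc by simp
qed

text \<open>Padding bounds the optimum off column \<open>j\<close> by
  \<open>flat_cost_minus A F j\<close>; by the dichotomy either equality holds or
  \<open>delta\<close> stays constant. The right side is the length of the interval of values
  \<open>t\<close> in \<open>lowered_entry_chosen_iff\<close>, and this agreement drives the
  probabilistic part.\<close>

lemma delta_increment:
  assumes F: "flat F" and s: "cover_size F < card I" "cover_size F < card K" and t: "tight A F"
    and j: "j \<in> free_cols F"
  shows "delta A (Suc (cover_size F)) j - delta A (cover_size F) j =
    max 0 (opt A (Suc (cover_size F)) I K - flat_cost_minus A F j - delta A (cover_size F) j)"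
proof -
  obtain l where l: "l \<in> I - F" using row_outside_flat[OF F s(1)] .
  obtain u where u: "u \<in> assigns (card F) F (free_cols F - {j})" "cost A u = flat_cost_minus A F j"
    using flat_cost_minus_attained[OF F s(2)] .
  have 1: "opt A (cover_size F) I (K - {j}) \<le> flat_cost_minus A F j"
    using flat_extend_minus[OF F l j u(1)] u(2) by simp
  have 2: "delta A (cover_size F) j \<le> delta A (Suc (cover_size F)) j" by (rule delta_mono[OF s])
  show ?thesis
    using opt_minus_dichotomy[OF F s(2,1) t, of j] 1 2 unfolding delta_def by (auto simp: max_def)
qed

lemma delta_increment_zero:
  assumes F: "flat F" and s: "cover_size F < card I" "cover_size F < card K" and t: "tight A F"
    and j: "j \<in> zero_cols (I - F)"
  shows "delta A (Suc (cover_size F)) j = delta A (cover_size F) j"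
  using opt_minus_dichotomy[OF F s(2,1) t, of j] j delta_mono[OF s, of j] unfolding delta_def by auto

section \<open>Lowering one entry outside the flat\<close>

lemma flat_cost_update:
  assumes "l \<notin> F"
  shows "flat_cost (A((l, j) := t)) F = flat_cost A F"
    "flat_cost_minus (A((l, j) := t)) F j' = flat_cost_minus A F j'"
proof -
  have "(A((l, j) := t)) p = A p" if "p \<in> F \<times> C" for p C using that assms by auto
  then show "flat_cost (A((l, j) := t)) F = flat_cost A F"
    "flat_cost_minus (A((l, j) := t)) F j' = flat_cost_minus A F j'"
    unfolding flat_cost_def flat_cost_minus_def by (metis opt_cong)+
qed

text \<open>The costs of \<open>F\<close> do not see row \<open>l\<close>, so tightness survives
  exactly if the minimum does not drop. The new competitor is \<open>t\<close> plus an optimum off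
  row \<open>l\<close> and column \<open>j\<close>; as row \<open>l\<close> is avoidable,
  \<open>opt_row_col_exchange\<close> restores \<open>l\<close> to the row set, and the condition
  becomes free of \<open>l\<close>.\<close>

lemma tight_update:
  assumes F: "flat F" and s: "cover_size F < card I" "cover_size F < card K"
    and p: "l \<in> I - F" "j \<in> free_cols F" and t: "0 \<le> t" "t \<le> A (l, j)"
  shows "tight (A((l, j) := t)) F \<longleftrightarrow> tight A F \<and> delta A (cover_size F) j \<le> t"
proof (cases "cover_size F")
  case 0
  then have "card F = 0" unfolding cover_size_def by simp
  then show ?thesis unfolding tight_def flat_cost_def 0 delta_0 using t by (simp add: opt_0)
next
  case (Suc s')
  let ?A = "A((l, j) := t)"
  have lj: "(l, j) \<in> I \<times> K" using p free_cols_subset by blast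
  have c: "Suc s' \<le> card I" "Suc s' \<le> card K" using s Suc by auto
  have cl: "Suc s' \<le> card (I - {l})" "s' \<le> card (I - {l})" "s' \<le> card (K - {j})"
    using s Suc fin p by (auto simp: card_Diff_singleton_if)
  have ub1: "opt ?A (Suc s') I K \<le> opt A (Suc s') I K"
    by (rule opt_mono[OF fin c]) (use t in auto)
  have ub2: "opt ?A (Suc s') I K \<le> t + opt A s' (I - {l}) (K - {j})"
    by (rule opt_update_le[OF fin c lj])
  have lb: "min (opt A (Suc s') I K) (t + opt A s' (I - {l}) (K - {j})) \<le> opt ?A (Suc s') I K"
    by (rule opt_update_ge[OF fin c])
  have g: "flat_cost ?A F = flat_cost A F" by (rule flat_cost_update) (use p in auto)
  have le: "opt A (Suc s') I K \<le> flat_cost A F"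
    using opt_le_flat_cost[OF F s(1)] s(2) Suc by simp
  show ?thesis
  proof
    assume "tight ?A F"
    then have e: "opt ?A (Suc s') I K = flat_cost A F" unfolding tight_def g Suc .
    then have tA: "tight A F" unfolding tight_def Suc using ub1 le by linarith
    obtain w where w: "w \<in> assigns (cover_size F) (I - {l}) K" "cost A w = opt A (cover_size F) I K"
      using tight_avoid_row[OF F less_imp_le[OF s(2)] tA p(1)] .
    have "opt A (Suc s') (I - {l}) K \<le> opt A (Suc s') I K"
      using opt_le[OF finite_Diff[OF fin(1)] fin(2) w(1), of A] w(2) Suc by simp
    moreover have "opt A (Suc s') I K + opt A s' (I - {l}) (K - {j})
        \<le> opt A (Suc s') (I - {l}) K + opt A s' I (K - {j})"
      by (rule opt_row_col_exchange[OF fin cl(1) c(2)])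
    ultimately have "delta A (cover_size F) j \<le> t"
      unfolding delta_def Suc using ub2 e le by simp
    then show "tight A F \<and> delta A (cover_size F) j \<le> t" using tA by simp
  next
    assume a: "tight A F \<and> delta A (cover_size F) j \<le> t"
    have "opt A s' I (K - {j}) \<le> opt A s' (I - {l}) (K - {j})"
      using fin cl by (intro opt_antimono) auto
    then have "opt A (Suc s') I K \<le> opt ?A (Suc s') I K" using a lb unfolding delta_def Suc by simp
    then show "tight ?A F" using a ub1 unfolding tight_def g Suc by simp
  qed
qed

lemma chosen_opt:
  assumes F: "flat F" and s: "cover_size F < card I" "cover_size F < card K" and t: "tight A F"
    and p: "p \<in> (I - F) \<times> free_cols F" and c: "chosen A F p"
  shows "opt A (Suc (cover_size F)) I K = link_cost A F p"
proof (rule antisym)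
  obtain w where w: "w \<in> assigns (Suc (cover_size F)) I K" "cost A w = opt A (Suc (cover_size F)) I K"
    using opt_attained[OF fin, of "Suc (cover_size F)" A] s by auto
  obtain l j where q: "l \<in> I - F" "l \<in> fst ` w" "j \<in> free_cols F" "link_cost A F (l, j) \<le> cost A w"
    using link_cost_le[OF F s(2) t w(1)] .
  have "link_cost A F p \<le> link_cost A F (l, j)"
    using c q(1,3) unfolding chosen_def by (cases "(l, j) = p") (simp_all add: less_imp_le)
  then show "link_cost A F p \<le> opt A (Suc (cover_size F)) I K" using q(4) w(2) by simp
  show "opt A (Suc (cover_size F)) I K \<le> link_cost A F p"
    using opt_le_link_cost[OF F s(2), of "fst p" "snd p"] p by auto
qed

text \<open>Entering a new row with the single entry \<open>t\<close> in column \<open>j\<close> after stage \<open>cover_size F\<close> is the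
  same as lowering the entry \<open>(l, j)\<close> to \<open>t\<close>, for any row \<open>l\<close> outside \<open>F\<close>.\<close>

lemma lowered_entry_chosen_iff:
  assumes F: "flat F" and s: "cover_size F < card I" "cover_size F < card K"
    and p: "l \<in> I - F" "j \<in> free_cols F" and t: "0 \<le> t"
  shows "t < A (l, j) \<and> tight (A((l, j) := t)) F \<and> chosen (A((l, j) := t)) F (l, j) \<longleftrightarrow>
    tight A F \<and> delta A (cover_size F) j \<le> t \<and>
    t + flat_cost_minus A F j < opt A (Suc (cover_size F)) I K"
proof -
  let ?A = "A((l, j) := t)"
  have lc: "link_cost ?A F q = (if q = (l, j) then t + flat_cost_minus A F j else link_cost A F q)" for q
    unfolding link_cost_def using flat_cost_update(2)[of l F j t] p by (cases q) auto
  have ch: "chosen ?A F (l, j) \<longleftrightarrow>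
      (\<forall>q\<in>(I - F) \<times> free_cols F. q \<noteq> (l, j) \<longrightarrow> t + flat_cost_minus A F j < link_cost A F q)"
    unfolding chosen_def lc by auto
  have lcp: "link_cost A F (l, j) = A (l, j) + flat_cost_minus A F j" unfolding link_cost_def by simp
  have up: "opt A (Suc (cover_size F)) I K \<le> link_cost A F q" if "q \<in> (I - F) \<times> free_cols F" for q
    using opt_le_link_cost[OF F s(2), of "fst q" "snd q"] that by auto
  show ?thesis
  proof
    assume a: "t < A (l, j) \<and> tight ?A F \<and> chosen ?A F (l, j)"
    then have tA: "tight A F" "delta A (cover_size F) j \<le> t"
      using tight_update[OF F s p t] by auto
    obtain w where w: "w \<in> assigns (Suc (cover_size F)) I K" "cost A w = opt A (Suc (cover_size F)) I K"
      using opt_attained[OF fin, of "Suc (cover_size F)" A] s by auto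
    obtain l' j' where q: "l' \<in> I - F" "l' \<in> fst ` w" "j' \<in> free_cols F" "link_cost A F (l', j') \<le> cost A w"
      using link_cost_le[OF F s(2) tA(1) w(1)] .
    have "t + flat_cost_minus A F j < link_cost A F (l', j')"
      using a ch q(1,3) lcp by (cases "(l', j') = (l, j)") auto
    then show "tight A F \<and> delta A (cover_size F) j \<le> t \<and>
        t + flat_cost_minus A F j < opt A (Suc (cover_size F)) I K" using tA q(4) w(2) by simp
  next
    assume a: "tight A F \<and> delta A (cover_size F) j \<le> t \<and>
        t + flat_cost_minus A F j < opt A (Suc (cover_size F)) I K"
    have lt: "t < A (l, j)" using up[of "(l, j)"] lcp a p by auto
    moreover have "tight ?A F" using tight_update[OF F s p t] lt a by auto
    moreover have "chosen ?A F (l, j)" unfolding ch using up a by fastforce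
    ultimately show "t < A (l, j) \<and> tight ?A F \<and> chosen ?A F (l, j)" by blast
  qed
qed

lemma chosen_exists:
  assumes g: "generic A" and F: "flat F" and s: "cover_size F < card I" "cover_size F < card K"
  obtains p where "p \<in> (I - F) \<times> free_cols F" "chosen A F p"
proof -
  let ?S = "(I - F) \<times> free_cols F"
  obtain l where l: "l \<in> I - F" using row_outside_flat[OF F s(1)] .
  have "0 < card (free_cols F)" using s(2) card_free_cols[of F] unfolding cover_size_def by linarith
  then have "free_cols F \<noteq> {}" by auto
  then have ne: "?S \<noteq> {}" using l by blast
  have f: "finite ?S" using fin(1) finite_free_cols by blast
  have "Min (link_cost A F ` ?S) \<in> link_cost A F ` ?S" using ne f by (intro Min_in) auto
  then obtain p where p: "p \<in> ?S" "link_cost A F p = Min (link_cost A F ` ?S)" by auto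
  have "chosen A F p" unfolding chosen_def
  proof (intro ballI impI)
    fix q assume q: "q \<in> ?S" "q \<noteq> p"
    have "link_cost A F p \<le> link_cost A F q" unfolding p(2) using f q(1) by (intro Min_le) auto
    moreover have "F \<in> Pow I" using flat_subset[OF F] by blast
    then have "link_cost A F p \<noteq> link_cost A F q"
      using g p(1) q unfolding generic_def by metis
    ultimately show "link_cost A F p < link_cost A F q" by simp
  qed
  then show ?thesis using that p(1) by blast
qed

lemma chosen_unique:
  assumes "p \<in> (I - F) \<times> free_cols F" "q \<in> (I - F) \<times> free_cols F" "chosen A F p" "chosen A F q"
  shows "p = q"
proof (rule ccontr)
  assume "p \<noteq> q"
  then have "link_cost A F p < link_cost A F q" "link_cost A F q < link_cost A F p"
    using assms unfolding chosen_def by metis+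
  then show False by simp
qed

text \<open>Koenig's theorem for the zeros, \<open>cover_size (cl {})\<close> being the least size
  of a cover: minimality matches the rows of the closure, flatness matches the remaining columns,
  and the two matchings share no row or column.\<close>

lemma zero_matching_exists:
  obtains W where "W \<subseteq> Z" "matching W" "fst ` W \<subseteq> I" "snd ` W \<subseteq> K" "card W = cover_size (cl {})"
proof -
  have e: "{} \<subseteq> I" by simp
  obtain W1 where W1: "W1 \<subseteq> Z" "matching W1" "fst ` W1 = cl {} - {}"
    "snd ` W1 \<subseteq> zero_cols (I - {}) - zero_cols (I - cl {})"
    using zero_matching_closure[OF e] .
  obtain W2 where W2: "W2 \<subseteq> Z" "matching W2" "fst ` W2 \<subseteq> I - cl {}" "snd ` W2 = zero_cols (I - cl {})"
  proof (cases "I - cl {} = {}")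
    case True
    show ?thesis by (rule that[of "{}"]) (unfold True, auto simp: matching_def zero_cols_def)
  next
    case False
    then obtain l where l: "l \<in> I - cl {}" by blast
    obtain W where "W \<subseteq> Z" "matching W" "fst ` W \<subseteq> I - cl {} - {l}" "snd ` W = zero_cols (I - cl {})"
      using zero_matching_cols[OF flat_cl[OF e] l] .
    then show ?thesis using that by blast
  qed
  have d: "fst ` W1 \<inter> fst ` W2 = {}" unfolding W1(3) using W2(3) by blast
  have d2: "snd ` W1 \<inter> snd ` W2 = {}" unfolding W2(4) using W1(4) by blast
  have "card (W1 \<union> W2) = cover_size (cl {})"
    using card_matching_Un[OF W1(2) W2(2) d] matching_card(1)[OF W1(2)] matching_card(2)[OF W2(2)]
    unfolding W1(3) W2(4) cover_size_def by simp
  moreover have "fst ` (W1 \<union> W2) \<subseteq> I" unfolding image_Un W1(3) using W2(3) cl_subset[OF e] by blast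
  moreover have "snd ` (W1 \<union> W2) \<subseteq> K" unfolding image_Un W2(4) using W1(4) zero_cols_subset by blast
  ultimately show ?thesis using that[of "W1 \<union> W2"] matching_Un[OF W1(2) W2(2) d d2] W1(1) W2(1) by blast
qed

lemma cost_zero: "W \<subseteq> Z \<Longrightarrow> cost A W = 0"
  unfolding cost_def using zero by (intro sum.neutral) auto

lemma opt_eq_0:
  assumes s: "s \<le> card I" "s \<le> card K" "s \<le> cover_size (cl {})"
  shows "opt A s I K = 0"
proof -
  obtain W where W: "W \<subseteq> Z" "matching W" "fst ` W \<subseteq> I" "snd ` W \<subseteq> K" "card W = cover_size (cl {})"
    using zero_matching_exists .
  obtain S where S: "S \<subseteq> W" "card S = s" using s(3) W(5) obtain_subset_with_card_n by metis
  have "S \<in> assigns s I K"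
    using matching_subset[OF W(2) S(1)] S(2) subset_trans[OF image_mono[OF S(1)] W(3)]
      subset_trans[OF image_mono[OF S(1)] W(4)] by (rule assignsI)
  then have "opt A s I K \<le> 0" using opt_le[OF fin, of S s A] cost_zero[OF subset_trans[OF S(1) W(1)]] by simp
  moreover have "0 \<le> opt A s I K" using opt_nonneg[OF fin s(1,2)] nonneg by blast
  ultimately show ?thesis by simp
qed

lemma delta_eq_0:
  assumes s: "s \<le> card I" "s \<le> card K" "s \<le> cover_size (cl {})"
  shows "delta A s j = 0"
proof (cases s)
  case 0
  then show ?thesis by (simp add: delta_0)
next
  case (Suc s')
  have "opt A s' I (K - {j}) \<le> opt A (Suc s') I K"
    using s Suc nonneg by (intro opt_remove_col_le fin) auto
  moreover have "0 \<le> opt A s' I (K - {j})"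
    using s Suc fin nonneg by (intro opt_nonneg) (auto simp: card_Diff_singleton_if)
  ultimately show ?thesis unfolding delta_def using opt_eq_0[OF s] Suc by simp
qed

lemma tight_base:
  assumes s: "cover_size (cl {}) < card I" "cover_size (cl {}) \<le> card K"
  shows "tight A (cl {})"
proof -
  have e: "{} \<subseteq> I" by simp
  obtain W1 where W1: "W1 \<subseteq> Z" "matching W1" "fst ` W1 = cl {} - {}"
    "snd ` W1 \<subseteq> zero_cols (I - {}) - zero_cols (I - cl {})"
    using zero_matching_closure[OF e] .
  have "snd ` W1 \<subseteq> free_cols (cl {})"
    using W1(4) zero_cols_subset[of "I - {}"] unfolding free_cols_def by blast
  then have "W1 \<in> assigns (card (cl {})) (cl {}) (free_cols (cl {}))"
    using W1(2,3) matching_card(1)[OF W1(2)] by (intro assignsI) auto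
  then have "flat_cost A (cl {}) \<le> 0" using flat_cost_le[OF flat_cl[OF e]] cost_zero[OF W1(1)] by metis
  moreover have "opt A (cover_size (cl {})) I K \<le> flat_cost A (cl {})"
    by (rule opt_le_flat_cost[OF flat_cl[OF e] s])
  moreover have "opt A (cover_size (cl {})) I K = 0" using s by (intro opt_eq_0) auto
  ultimately show ?thesis unfolding tight_def by simp
qed

text \<open>The rows that closure adds to \<open>insert l F\<close> are matched by zeros in columns
  that have left the cover. The new flat is thus assigned at the link cost of the chosen entry,
  which is the minimum by \<open>chosen_opt\<close>.\<close>

lemma tight_step:
  assumes F: "flat F" and s: "Suc (cover_size F) < card I" "Suc (cover_size F) \<le> card K" and t: "tight A F"
    and p: "l \<in> I - F" "j \<in> free_cols F" and c: "chosen A F (l, j)"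
  shows "tight A (cl (insert l F))"
proof -
  let ?R = "insert l F"
  have R: "?R \<subseteq> I" using p flat_subset[OF F] by blast
  have s': "cover_size F < card I" "cover_size F < card K" using s by auto
  have cs: "cover_size (cl ?R) = Suc (cover_size F)" by (rule cover_size_cl_insert[OF F p(1)])
  obtain W where W: "W \<subseteq> Z" "matching W" "fst ` W = cl ?R - ?R"
    "snd ` W \<subseteq> zero_cols (I - ?R) - zero_cols (I - cl ?R)" using zero_matching_closure[OF R] .
  obtain u where u: "u \<in> assigns (card F) F (free_cols F - {j})" "cost A u = flat_cost_minus A F j"
    using flat_cost_minus_attained[OF F s'(2)] .
  note S = assignsD[OF u(1)]
  have n: "(l, j) \<notin> u" using S(1) by auto
  have m1: "matching ({(l, j)} \<union> u)" using S(2,5,6) p by (intro matching_Un) (auto simp: matching_def)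
  have m1: "matching (insert (l, j) u)" using m1 by simp
  have r1: "fst ` insert (l, j) u \<subseteq> ?R" "snd ` insert (l, j) u \<subseteq> free_cols F" using S(5,6) p by auto
  have zc: "zero_cols (I - ?R) \<subseteq> zero_cols (I - F)" by (rule zero_cols_mono) blast
  have d: "fst ` insert (l, j) u \<inter> fst ` W = {}" using r1(1) unfolding W(3) by blast
  have d2: "snd ` insert (l, j) u \<inter> snd ` W = {}"
    using r1(2) W(4) zc unfolding free_cols_def by blast
  have m: "matching (insert (l, j) u \<union> W)" by (rule matching_Un[OF m1 W(2) d d2])
  have cR: "card ?R = Suc (card F)" using p finite_rows[OF flat_subset[OF F]] by simp
  have "card W = card (cl ?R) - card ?R"
    using matching_card(1)[OF W(2)] finite_rows[OF R] subset_cl[OF R]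
    unfolding W(3) by (simp add: card_Diff_subset)
  moreover have "card ?R \<le> card (cl ?R)"
    using card_mono[OF finite_rows[OF cl_subset[OF R]] subset_cl[OF R]] .
  moreover have "card (insert (l, j) u) = Suc (card F)" using n S(3,4) by simp
  ultimately have "card (insert (l, j) u \<union> W) = card (cl ?R)"
    using card_matching_Un[OF m1 W(2) d] cR by linarith
  moreover have "fst ` (insert (l, j) u \<union> W) \<subseteq> cl ?R"
    unfolding image_Un W(3) using r1(1) subset_cl[OF R] by blast
  moreover have "zero_cols (I - cl ?R) \<subseteq> zero_cols (I - F)"
    using subset_cl[OF R] by (intro zero_cols_mono) blast
  then have "snd ` (insert (l, j) u \<union> W) \<subseteq> free_cols (cl ?R)"
    unfolding image_Un free_cols_def using r1(2) W(4) zero_cols_subset[of "I - ?R"]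
    unfolding free_cols_def by blast
  ultimately have "insert (l, j) u \<union> W \<in> assigns (card (cl ?R)) (cl ?R) (free_cols (cl ?R))"
    using m by (intro assignsI)
  then have "flat_cost A (cl ?R) \<le> cost A (insert (l, j) u \<union> W)" by (rule flat_cost_le[OF flat_cl[OF R]])
  also have "\<dots> = cost A (insert (l, j) u) + cost A W"
  proof (rule cost_Un)
    show "finite (insert (l, j) u)" using S(4) by simp
    show "finite W" using W(2) unfolding matching_def by (rule conjunct1)
    show "insert (l, j) u \<inter> W = {}" using d by (meson disjoint_iff imageI)
  qed
  also have "\<dots> = link_cost A F (l, j)"
    using cost_insert[OF S(4) n, of A] cost_zero[OF W(1)] u(2) unfolding link_cost_def by simp
  also have "\<dots> = opt A (Suc (cover_size F)) I K" using chosen_opt[OF F s' t _ c] p by simp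
  finally have "flat_cost A (cl ?R) \<le> opt A (cover_size (cl ?R)) I K" unfolding cs .
  moreover have "opt A (cover_size (cl ?R)) I K \<le> flat_cost A (cl ?R)"
    using s cs by (intro opt_le_flat_cost flat_cl[OF R]) auto
  ultimately show ?thesis unfolding tight_def by simp
qed

section \<open>Uniqueness of the tight flat through the essential rows\<close>

lemma essential_subset_tight:
  assumes F: "flat F" and s: "cover_size F \<le> card K" and t: "tight A F"
  shows "essential A (cover_size F) \<subseteq> F"
proof
  fix i assume i: "i \<in> essential A (cover_size F)"
  show "i \<in> F"
  proof (rule ccontr)
    assume "i \<notin> F"
    moreover have "i \<in> I" using i unfolding essential_def by blast
    ultimately have l: "i \<in> I - F" by blast
    obtain w where w: "w \<in> assigns (cover_size F) (I - {i}) K" "cost A w = opt A (cover_size F) I K"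
      using tight_avoid_row[OF F s t l] .
    have "w \<in> assigns (cover_size F) I K" using w(1) unfolding assigns_def by auto
    then have "i \<in> fst ` w" using i w(2) unfolding essential_def by blast
    then show False using assignsD(5)[OF w(1)] by blast
  qed
qed

lemma essentialI:
  assumes "i \<in> I" "\<And>S. S \<in> assigns s I K \<Longrightarrow> cost A S = opt A s I K \<Longrightarrow> i \<in> fst ` S"
  shows "i \<in> essential A s"
  unfolding essential_def using assms by blast

text \<open>Exchanging optima of sizes \<open>s\<close> and \<open>Suc s\<close> yields optima
  again, because the total is conserved; the new optimum of size \<open>s\<close> uses only rows of
  the larger one.\<close>

lemma essential_Suc:
  assumes s: "s < card I" "s < card K"
  shows "essential A s \<subseteq> essential A (Suc s)"
proof
  fix i assume i: "i \<in> essential A s"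
  obtain u where u: "u \<in> assigns s I K" "cost A u = opt A s I K"
    using opt_attained[OF fin, of s A] s by auto
  note S = assignsD[OF u(1)]
  have "i \<in> fst ` w" if w: "w \<in> assigns (Suc s) I K" "cost A w = opt A (Suc s) I K" for w
  proof -
    note M = assignsD[OF w(1)]
    have lt: "card u < card w" using S(3) M(3) by simp
    obtain u' w' l j where ex: "exchange u w u' w' l j"
      using matching_exchange[OF S(2) M(2) lt] by blast
    note E = exchangeD[OF ex]
    have "fst ` u' \<subseteq> I" "snd ` u' \<subseteq> K" unfolding E(7,10) using E(6,9) S(5,6) M(5,6) by blast+
    then have i1: "u' \<in> assigns (Suc s) I K" using E(1,4) S(3) by (intro assignsI) auto
    have "fst ` w' \<subseteq> I" "snd ` w' \<subseteq> K" unfolding E(8,11) using M(5,6) by blast+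
    then have i2: "w' \<in> assigns s I K" using E(2,5) M(3) by (intro assignsI) auto
    have "cost A w' = opt A s I K"
      using opt_le[OF fin i1, of A] opt_le[OF fin i2, of A] E(12)[of A] u(2) w(2)
      unfolding cost_def by linarith
    then have "i \<in> fst ` w'" using i i2 unfolding essential_def by blast
    then show ?thesis unfolding E(8) by blast
  qed
  moreover have "i \<in> I" using i unfolding essential_def by blast
  ultimately show "i \<in> essential A (Suc s)" by (intro essentialI)
qed

text \<open>An optimum avoiding row \<open>l\<close> would, by \<open>link_cost_le\<close>, pay at
  least the link cost of a different entry, which is strictly larger.\<close>

lemma chosen_essential:
  assumes F: "flat F" and s: "cover_size F < card I" "cover_size F < card K" and t: "tight A F"
    and p: "l \<in> I - F" "j \<in> free_cols F" and c: "chosen A F (l, j)"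
  shows "l \<in> essential A (Suc (cover_size F))"
proof -
  have "l \<in> fst ` w" if w: "w \<in> assigns (Suc (cover_size F)) I K"
    "cost A w = opt A (Suc (cover_size F)) I K" for w
  proof (rule ccontr)
    assume n: "l \<notin> fst ` w"
    obtain l' j' where q: "l' \<in> I - F" "l' \<in> fst ` w" "j' \<in> free_cols F" "link_cost A F (l', j') \<le> cost A w"
      using link_cost_le[OF F s(2) t w(1)] .
    have "(l', j') \<noteq> (l, j)" using q(2) n by auto
    then have "link_cost A F (l, j) < link_cost A F (l', j')" using c q(1,3) unfolding chosen_def by simp
    moreover have "cost A w = link_cost A F (l, j)" using w(2) chosen_opt[OF F s t _ c] p by simp
    ultimately show False using q(4) by simp
  qed
  moreover have "l \<in> I" using p(1) by blast
  ultimately show ?thesis by (intro essentialI)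
qed

lemma essential_in_I: "essential A s \<subseteq> I"
  unfolding essential_def by blast

text \<open>The clause \<open>F \<subseteq> cl (essential A s)\<close> is carried along for
  \<open>tight_unique\<close>: the essential rows, and so their closure, lie in every tight flat of
  rank \<open>s\<close>.\<close>

lemma tight_exists:
  assumes g: "generic A" and s: "cover_size (cl {}) \<le> s" "s < card I" "s < card K"
  shows "\<exists>F. flat F \<and> cover_size F = s \<and> tight A F \<and> F \<subseteq> cl (essential A s)"
  using s
proof (induction s rule: dec_induct)
  case base
  show ?case
    using tight_base flat_cl[of "{}"] cl_mono[OF empty_subsetI essential_in_I] base by (intro exI[of _ "cl {}"]) auto
next
  case (step s)
  then obtain F where F: "flat F" "cover_size F = s" "tight A F" "F \<subseteq> cl (essential A s)" by auto
  have s: "cover_size F < card I" "cover_size F < card K" "Suc (cover_size F) < card I" "Suc (cover_size F) \<le> card K"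
    using step F(2) by auto
  obtain l j where p: "l \<in> I - F" "j \<in> free_cols F" "chosen A F (l, j)"
    using chosen_exists[OF g F(1) s(1,2)] by (metis mem_Sigma_iff prod.collapse)
  let ?F = "cl (insert l F)"
  have R: "insert l F \<subseteq> I" using p flat_subset[OF F(1)] by blast
  have "l \<in> essential A (Suc s)" using chosen_essential[OF F(1) s(1,2) F(3) p] F(2) by simp
  moreover have "essential A s \<subseteq> essential A (Suc s)" using s F(2) by (intro essential_Suc) auto
  then have "cl (essential A s) \<subseteq> cl (essential A (Suc s))" by (rule cl_mono[OF _ essential_in_I])
  ultimately have "insert l F \<subseteq> cl (essential A (Suc s))"
    using F(4) subset_cl[OF essential_in_I, of "Suc s"] by blast
  then have "?F \<subseteq> cl (essential A (Suc s))" by (rule cl_least[OF _ flat_cl[OF essential_in_I]])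
  moreover have "tight A ?F" by (rule tight_step[OF F(1) s(3,4) F(3) p])
  moreover have "cover_size ?F = Suc s" using cover_size_cl_insert[OF F(1) p(1)] F(2) by simp
  ultimately show ?case using flat_cl[OF R] by blast
qed

lemma tight_unique:
  assumes g: "generic A" and s: "cover_size F < card I" "cover_size F < card K"
    and F: "flat F" "tight A F" and F': "flat F'" "tight A F'" and eq: "cover_size F' = cover_size F"
  shows "F' = F"
proof -
  have "cover_size (cl {}) \<le> cover_size F" using cover_size_cl_le[of "{}" F] flat_subset[OF F(1)] by simp
  then obtain F0 where F0: "flat F0" "cover_size F0 = cover_size F" "tight A F0"
      "F0 \<subseteq> cl (essential A (cover_size F))"
    using tight_exists[OF g _ s] by blast
  have *: "F0 = G" if G: "flat G" "tight A G" "cover_size G = cover_size F" for G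
  proof (rule flat_eqI[OF F0(1) G(1)])
    have "essential A (cover_size F) \<subseteq> G" using essential_subset_tight[OF G(1) _ G(2)] G(3) s by simp
    then have "cl (essential A (cover_size F)) \<subseteq> G" by (rule cl_least[OF _ G(1)])
    then show "F0 \<subseteq> G" using F0(4) by blast
    show "cover_size F0 = cover_size G" using F0(2) G(3) by simp
  qed
  show ?thesis using *[OF F refl] *[OF F' eq] by simp
qed

end

section \<open>Products of exponential distributions\<close>

definition exp_measure :: "real measure" where
  "exp_measure = density lborel (exponential_density 1)"

lemma sets_exp_measure [simp, measurable_cong]: "sets exp_measure = sets borel"
  unfolding exp_measure_def by simp

lemma space_exp_measure [simp]: "space exp_measure = UNIV"
  unfolding exp_measure_def by simp

lemma prob_space_exp_measure: "prob_space exp_measure"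
  unfolding exp_measure_def by (rule prob_space_exponential_density) simp

interpretation exp: prob_space exp_measure
  by (rule prob_space_exp_measure)

interpretation exp_prod: product_sigma_finite "\<lambda>_. exp_measure"
  by (intro product_sigma_finite.intro exp.sigma_finite_measure_axioms)

lemma distributed_exp_measure: "distributed exp_measure lborel (\<lambda>x. x) (exponential_density 1)"
  unfolding distributed_def exp_measure_def
  by (auto simp: distr_id2[of lborel, simplified] distr_id2)

lemma emeasure_exp_greaterThan: "0 \<le> t \<Longrightarrow> emeasure exp_measure {t<..} = ennreal (exp (- t))"
  using exp.exponential_distributedD_gt[OF distributed_exp_measure, of t]
  by (simp add: exp.emeasure_eq_measure greaterThan_def)

lemma borel_measurable_times_indicator_Ico:
  fixes f :: "'a \<Rightarrow> ennreal" and u v :: "'a \<Rightarrow> real"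
  assumes [measurable]: "f \<in> borel_measurable N" "u \<in> borel_measurable N" "v \<in> borel_measurable N"
  shows "(\<lambda>z. f z * indicator {0..<u z} (v z)) \<in> borel_measurable N"
  unfolding indicator_def atLeastLessThan_iff by measurable

text \<open>The density at \<open>t\<close> equals the probability of exceeding \<open>t\<close>, so
  after interchanging the integrals the inner one is the density.\<close>

lemma exp_nn_integral_primitive:
  assumes [measurable]: "f \<in> borel_measurable borel"
  shows "(\<integral>\<^sup>+y. (\<integral>\<^sup>+t. f t * indicator {0..<y} t \<partial>lborel) \<partial>exp_measure) = (\<integral>\<^sup>+t. f t \<partial>exp_measure)"
proof -
  interpret P: pair_sigma_finite lborel exp_measure
    by (intro pair_sigma_finite.intro lborel.sigma_finite_measure_axioms exp.sigma_finite_measure_axioms)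
  have m: "(\<lambda>(t, y). f t * indicator {0..<y} t) \<in> borel_measurable (lborel \<Otimes>\<^sub>M exp_measure)"
    unfolding indicator_def atLeastLessThan_iff by measurable
  have "(\<integral>\<^sup>+y. (\<integral>\<^sup>+t. f t * indicator {0..<y} t \<partial>lborel) \<partial>exp_measure) =
      (\<integral>\<^sup>+t. (\<integral>\<^sup>+y. f t * indicator {0..<y} t \<partial>exp_measure) \<partial>lborel)"
    using P.Fubini[OF m] by simp
  also have "\<dots> = (\<integral>\<^sup>+t. f t * ennreal (exponential_density 1 t) \<partial>lborel)"
  proof (rule nn_integral_cong)
    fix t :: real
    have "(\<integral>\<^sup>+y. f t * indicator {0..<y} t \<partial>exp_measure) =
        (\<integral>\<^sup>+y. (f t * indicator {0..} t) * indicator {t<..} y \<partial>exp_measure)"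
      by (rule nn_integral_cong) (simp add: indicator_def)
    also have "\<dots> = (f t * indicator {0..} t) * emeasure exp_measure {t<..}"
      by (rule nn_integral_cmult_indicator) simp
    also have "\<dots> = f t * ennreal (exponential_density 1 t)"
      by (cases "0 \<le> t") (simp_all add: emeasure_exp_greaterThan exponential_density_def)
    finally show "(\<integral>\<^sup>+y. f t * indicator {0..<y} t \<partial>exp_measure) = f t * ennreal (exponential_density 1 t)" .
  qed
  also have "\<dots> = (\<integral>\<^sup>+t. f t \<partial>exp_measure)"
    unfolding exp_measure_def by (subst nn_integral_density) (auto simp: mult.commute)
  finally show ?thesis .
qed

definition exp_product :: "'i set \<Rightarrow> ('i \<Rightarrow> real) measure" where
  "exp_product P = PiM P (\<lambda>_. exp_measure)"

lemma prob_space_exp_product: "prob_space (exp_product P)"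
  unfolding exp_product_def by (intro prob_space_PiM prob_space_exp_measure)

lemma measurable_exp_product_component:
  "p \<in> P \<Longrightarrow> (\<lambda>A. A p) \<in> borel_measurable (exp_product P)"
  unfolding exp_product_def using measurable_component_singleton[of p P "\<lambda>_. exp_measure"]
  by (simp cong: measurable_cong_sets)

lemma measurable_exp_product_update:
  assumes "p \<in> P"
  shows "(\<lambda>(A, t). A(p := t)) \<in> measurable (exp_product P \<Otimes>\<^sub>M lborel) (exp_product P)"
proof -
  have "(\<lambda>x. (fst x)(p := snd x)) \<in> measurable (exp_product P \<Otimes>\<^sub>M lborel) (PiM P (\<lambda>_. exp_measure))"
  proof (rule measurable_fun_upd[where J = P])
    show "P = P \<union> {p}" using assms by auto
    show "fst \<in> measurable (exp_product P \<Otimes>\<^sub>M lborel) (PiM P (\<lambda>_. exp_measure))"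
      unfolding exp_product_def by (rule measurable_fst)
    show "snd \<in> measurable (exp_product P \<Otimes>\<^sub>M lborel) exp_measure"
      using measurable_snd[of "exp_product P" lborel] by (simp cong: measurable_cong_sets)
  qed
  then show ?thesis unfolding exp_product_def by (simp add: case_prod_beta)
qed

text \<open>Integration by parts in one exponential coordinate.\<close>

lemma exp_product_primitive:
  fixes f :: "('i \<Rightarrow> real) \<Rightarrow> ennreal"
  assumes P: "finite P" "p \<in> P" and f: "f \<in> borel_measurable (exp_product P)"
  shows "(\<integral>\<^sup>+A. (\<integral>\<^sup>+t. f (A(p := t)) * indicator {0..<A p} t \<partial>lborel) \<partial>exp_product P) =
    (\<integral>\<^sup>+A. f A \<partial>exp_product P)"
proof -
  define P' where "P' = P - {p}"
  have P': "P = insert p P'" "finite P'" "p \<notin> P'" using P unfolding P'_def by auto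
  have upd: "(\<lambda>(A, t). f (A(p := t))) \<in> borel_measurable (exp_product P \<Otimes>\<^sub>M lborel)"
    using measurable_compose[OF measurable_exp_product_update[OF P(2)] f] by (simp add: case_prod_beta')
  have m2: "(\<lambda>(A, t). f (A(p := t)) * indicator {0..<A p} t) \<in> borel_measurable (exp_product P \<Otimes>\<^sub>M lborel)"
    unfolding case_prod_beta'
  proof (rule borel_measurable_times_indicator_Ico)
    show "(\<lambda>x. fst x p) \<in> borel_measurable (exp_product P \<Otimes>\<^sub>M lborel)"
      using measurable_compose[OF measurable_fst measurable_exp_product_component[OF P(2)]] .
    show "(\<lambda>x. f ((fst x)(p := snd x))) \<in> borel_measurable (exp_product P \<Otimes>\<^sub>M lborel)"
      using upd by (simp add: case_prod_beta')
    show "snd \<in> borel_measurable (exp_product P \<Otimes>\<^sub>M lborel)"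
      using measurable_snd[of "exp_product P" lborel] by simp
  qed
  have gm: "(\<lambda>A. \<integral>\<^sup>+t. f (A(p := t)) * indicator {0..<A p} t \<partial>lborel) \<in> borel_measurable (exp_product P)"
    using lborel.borel_measurable_nn_integral[OF m2] by simp
  have sec: "(\<lambda>t. f (x(p := t))) \<in> borel_measurable borel" if "x \<in> space (exp_product P')" for x
  proof -
    have "(\<lambda>t. x(p := t)) \<in> measurable borel (exp_product P)"
      unfolding exp_product_def P'(1)
      using that measurable_fun_upd[of "insert p P'" P' p "\<lambda>_. x" borel "\<lambda>_. exp_measure" "\<lambda>t. t"]
      by (simp add: exp_product_def cong: measurable_cong_sets)
    then show ?thesis using f by (rule measurable_compose)
  qed
  have "(\<integral>\<^sup>+A. (\<integral>\<^sup>+t. f (A(p := t)) * indicator {0..<A p} t \<partial>lborel) \<partial>exp_product P) =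
      (\<integral>\<^sup>+x. (\<integral>\<^sup>+y. (\<integral>\<^sup>+t. f ((x(p := y))(p := t)) * indicator {0..<(x(p := y)) p} t \<partial>lborel)
        \<partial>exp_measure) \<partial>exp_product P')"
    using exp_prod.product_nn_integral_insert[OF P'(2,3), of "\<lambda>A. \<integral>\<^sup>+t. f (A(p := t)) * indicator {0..<A p} t \<partial>lborel"] gm
    unfolding exp_product_def P'(1) by simp
  also have "\<dots> = (\<integral>\<^sup>+x. (\<integral>\<^sup>+y. f (x(p := y)) \<partial>exp_measure) \<partial>exp_product P')"
  proof (rule nn_integral_cong)
    fix x assume "x \<in> space (exp_product P')"
    then show "(\<integral>\<^sup>+y. (\<integral>\<^sup>+t. f ((x(p := y))(p := t)) * indicator {0..<(x(p := y)) p} t \<partial>lborel)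
        \<partial>exp_measure) = (\<integral>\<^sup>+y. f (x(p := y)) \<partial>exp_measure)"
      using exp_nn_integral_primitive[OF sec] by simp
  qed
  also have "\<dots> = (\<integral>\<^sup>+A. f A \<partial>exp_product P)"
    using exp_prod.product_nn_integral_insert[OF P'(2,3), of f] f unfolding exp_product_def P'(1) by simp
  finally show ?thesis .
qed

section \<open>Almost sure properties and integrability\<close>

lemma AE_exp_measure_neq: "AE y in exp_measure. y \<noteq> c"
  unfolding exp_measure_def by (subst AE_density) (auto intro: AE_lborel_singleton AE_mp)

lemma AE_exp_measure_pos: "AE y in exp_measure. 0 < y"
proof -
  have "AE y in exp_measure. 0 \<le> y"
    unfolding exp_measure_def by (subst AE_density) (auto simp: exponential_density_def)
  then show ?thesis using AE_exp_measure_neq[of 0] by eventually_elim simp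
qed

lemma AE_exp_product_pos:
  assumes "finite P"
  shows "AE A in exp_product P. \<forall>p\<in>P. 0 < A p"
proof -
  have "AE A in exp_product P. 0 < A p" if "p \<in> P" for p
    unfolding exp_product_def
    by (rule AE_PiM_component[OF prob_space_exp_measure that AE_exp_measure_pos])
  then show ?thesis using assms by (simp add: AE_finite_all)
qed

text \<open>With the other coordinates fixed \<open>g\<close> is constant, and one exponential
  variable almost surely avoids a constant.\<close>

lemma AE_exp_product_neq:
  assumes P: "finite P" "p \<in> P" and g: "g \<in> borel_measurable (exp_product P)"
    and ind: "\<And>A t. g (A(p := t)) = g A"
  shows "AE A in exp_product P. A p \<noteq> (g A :: real)"
proof -
  define P' where "P' = P - {p}"
  have P': "P = insert p P'" "finite P'" "p \<notin> P'" using P unfolding P'_def by auto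
  have S: "{A \<in> space (exp_product P). A p = g A} \<in> sets (exp_product P)"
    by (rule borel_measurable_eq[OF measurable_exp_product_component[OF P(2)] g])
  have "emeasure (exp_product P) {A \<in> space (exp_product P). A p = g A} =
      (\<integral>\<^sup>+A. indicator {A \<in> space (exp_product P). A p = g A} A \<partial>exp_product P)"
    using S by simp
  also have "\<dots> = (\<integral>\<^sup>+x. (\<integral>\<^sup>+y. indicator {A \<in> space (exp_product P). A p = g A} (x(p := y))
      \<partial>exp_measure) \<partial>exp_product P')"
    using exp_prod.product_nn_integral_insert[OF P'(2,3), of "indicator {A \<in> space (exp_product P). A p = g A}"] S
    unfolding exp_product_def P'(1) by simp
  also have "\<dots> = (\<integral>\<^sup>+x. 0 \<partial>exp_product P')"
  proof (rule nn_integral_cong)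
    fix x
    have "(\<integral>\<^sup>+y. indicator {A \<in> space (exp_product P). A p = g A} (x(p := y)) \<partial>exp_measure) =
        (\<integral>\<^sup>+y. 0 \<partial>exp_measure)"
      by (rule nn_integral_cong_AE) (use AE_exp_measure_neq[of "g x"] in \<open>eventually_elim, simp add: ind\<close>)
    then show "(\<integral>\<^sup>+y. indicator {A \<in> space (exp_product P). A p = g A} (x(p := y)) \<partial>exp_measure) = 0"
      by simp
  qed
  finally have "emeasure (exp_product P) {A \<in> space (exp_product P). A p = g A} = 0" by simp
  then show ?thesis using S by (intro AE_I[where N = "{A \<in> space (exp_product P). A p = g A}"]) auto
qed

lemma integrable_exp_product_component:
  assumes "p \<in> P"
  shows "integrable (exp_product P) (\<lambda>A. A p)"
proof -
  have "integrable exp_measure (\<lambda>x. x ^ 1)"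
    using exp.erlang_ith_moment_integrable[of 1 "\<lambda>x. x" 0 1] distributed_exp_measure by simp
  then have "integrable (distr (exp_product P) exp_measure (\<lambda>A. A p)) (\<lambda>x. x)"
    unfolding exp_product_def using distr_PiM_component[of P "\<lambda>_. exp_measure" p] assms prob_space_exp_measure by simp
  then show ?thesis
    using measurable_exp_product_component[OF assms]
    by (subst (asm) integrable_distr_eq) (auto cong: measurable_cong_sets)
qed

section \<open>Weights of the row urn\<close>

text \<open>The expected time during which a given set of \<open>r\<close> clocks are exactly those that have rung, for
  \<open>n\<close> independent exponential clocks of rate 1.\<close>

definition urn_weight :: "nat \<Rightarrow> nat \<Rightarrow> real" where
  "urn_weight n r = 1 / (real n * real ((n - 1) choose r))"

lemma urn_weight_0: "0 < n \<Longrightarrow> real n * urn_weight n 0 = 1"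
  unfolding urn_weight_def by simp

lemma choose_pred_mult:
  assumes "0 < r" "r < n"
  shows "real (n - r) * real ((n - 1) choose (r - 1)) = real r * real ((n - 1) choose r)"
proof -
  obtain r' where r': "r = Suc r'" using assms(1) by (cases r) auto
  obtain n' where n': "n = Suc n'" using assms(2) by (cases n) auto
  have "Suc r' * (n' choose Suc r') = (n' choose r') * (n' - r')"
    by (metis binomial_absorb_comp binomial_absorption mult.commute)
  then have "real (Suc r') * real (n' choose Suc r') = real (n' choose r') * real (n' - r')"
    by (metis of_nat_mult)
  then show ?thesis unfolding r' n' by (simp only: diff_Suc_Suc diff_Suc_1 diff_zero mult.commute)
qed

text \<open>Balance of flow: a set of \<open>r\<close> rung clocks is left at rate
  \<open>n - r\<close> and entered at rate 1 from each of its \<open>r\<close> subsets with one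
  clock less.\<close>

lemma urn_weight_rec:
  assumes "0 < r" "r < n"
  shows "real (n - r) * urn_weight n r = real r * urn_weight n (r - 1)"
proof -
  have "0 < real ((n - 1) choose r)" "0 < real ((n - 1) choose (r - 1))"
    using assms by (simp_all add: zero_less_binomial_iff)
  moreover have "a * (1 / (N * q)) = b * (1 / (N * p))" if "a * p = b * q" "0 < q" "0 < p"
    for a b p q N :: real
    using that by (simp add: divide_simps)
  ultimately show ?thesis
    unfolding urn_weight_def using choose_pred_mult[OF assms] by blast
qed

section \<open>Urn weight of a flat and its balance equation\<close>

context zero_pattern
begin

text \<open>For \<open>F \<noteq> I\<close>, the expected time during which the rows drawn so far
  have closure \<open>F\<close>.\<close>

definition flat_weight :: "nat set \<Rightarrow> real" where
  "flat_weight F = (\<Sum>R | R \<in> Pow I \<and> cl R = F. urn_weight (card I) (card R))"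

lemma finite_flats: "finite {F. flat F \<and> Q F}"
  by (rule finite_subset[of _ "Pow I"]) (auto dest: flat_subset simp: fin)

lemma insert_cl:
  assumes "R \<subseteq> I" "l \<in> I"
  shows "cl (insert l (cl R)) = cl (insert l R)"
proof -
  have i: "insert l R \<subseteq> I" "insert l (cl R) \<subseteq> I" using assms cl_subset[OF assms(1)] by auto
  show ?thesis
  proof (rule antisym)
    have "cl R \<subseteq> cl (insert l R)" by (rule cl_mono[OF _ i(1)]) blast
    then show "cl (insert l (cl R)) \<subseteq> cl (insert l R)"
      using subset_cl[OF i(1)] by (intro cl_least flat_cl[OF i(1)]) blast
    show "cl (insert l R) \<subseteq> cl (insert l (cl R))"
      using subset_cl[OF assms(1)] by (intro cl_mono[OF _ i(2)]) blast
  qed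
qed

lemma cl_insert_absorb:
  assumes "R \<subseteq> I" "l \<in> cl R"
  shows "cl (insert l R) = cl R"
proof (rule antisym)
  have i: "insert l R \<subseteq> I" using assms cl_subset[OF assms(1)] by auto
  show "cl (insert l R) \<subseteq> cl R"
    using assms(2) subset_cl[OF assms(1)] by (intro cl_least flat_cl[OF assms(1)]) blast
  show "cl R \<subseteq> cl (insert l R)" by (rule cl_mono[OF _ i]) blast
qed

text \<open>Balance of flow for the closure process: drawing a row of \<open>F\<close> does not
  change the closure, so the exit rate is \<open>card I - card F\<close>, and the right side is the
  probability of starting in \<open>F\<close> plus the flow from smaller flats.\<close>

lemma flat_weight_rec:
  assumes F: "flat F" and lt: "card F < card I"
  shows "real (card I - card F) * flat_weight F =
    (if cl {} = F then 1 else 0) +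
    (\<Sum>(F0, l) | flat F0 \<and> l \<in> I - F0 \<and> cl (insert l F0) = F. flat_weight F0)"
proof -
  let ?w = "\<lambda>R. urn_weight (card I) (card R)"
  define C where "C = {R. R \<in> Pow I \<and> cl R = F}"
  have finC: "finite C" unfolding C_def using fin(1) by simp
  have CR: "R \<subseteq> F" "finite R" "card R \<le> card F" if "R \<in> C" for R
  proof -
    have "R \<subseteq> I" "cl R = F" using that unfolding C_def by auto
    then show "R \<subseteq> F" using subset_cl by blast
    then show "finite R" "card R \<le> card F"
      using finite_rows[OF flat_subset[OF F]] finite_subset card_mono by blast+
  qed
  \<comment> \<open>Pairs in \<open>T3\<close> mark a last row drawn. Without it the closure is
    either smaller (\<open>T1\<close>) or already \<open>F\<close> (\<open>T2\<close>); the
    \<open>T2\<close> terms, moved to the left, turn the rates \<open>card I - card R\<close> into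
    the common rate \<open>card I - card F\<close>.\<close>
  define T1 where "T1 = {(R, l). R \<in> Pow I \<and> l \<in> I - cl R \<and> cl (insert l R) = F}"
  define T2 where "T2 = {(R, l). R \<in> C \<and> l \<in> F - R}"
  define T3 where "T3 = {(R, l). R \<in> C \<and> l \<in> R}"
  have finT: "finite T1" "finite T2" "finite T3"
    unfolding T1_def T2_def T3_def C_def
    by (rule finite_subset[of _ "Pow I \<times> I"]; use fin(1) flat_subset[OF F] in blast)+
  have "(\<Sum>R\<in>C. real (card I - card R) * ?w R) =
      (\<Sum>R\<in>C. (if R = {} then 1 else 0) + real (card R) * urn_weight (card I) (card R - 1))"
  proof (rule sum.cong[OF refl])
    fix R assume R: "R \<in> C"
    show "real (card I - card R) * ?w R =
        (if R = {} then 1 else 0) + real (card R) * urn_weight (card I) (card R - 1)"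
    proof (cases "R = {}")
      case True
      then show ?thesis using urn_weight_0[of "card I"] lt by simp
    next
      case False
      then have "0 < card R" "card R < card I" using CR[OF R] lt by (auto simp: card_gt_0_iff)
      then show ?thesis using urn_weight_rec False by simp
    qed
  qed
  also have "\<dots> = (\<Sum>R\<in>C. if R = {} then 1 else 0) + (\<Sum>R\<in>C. \<Sum>l\<in>R. urn_weight (card I) (card R - 1))"
    by (simp add: sum.distrib)
  also have "(\<Sum>R\<in>C. if R = {} then 1 else 0) = (if cl {} = F then 1 else (0::real))"
    using finC by (simp add: C_def)
  also have "(\<Sum>R\<in>C. \<Sum>l\<in>R. urn_weight (card I) (card R - 1)) =
      (\<Sum>(R, l)\<in>T3. urn_weight (card I) (card R - 1))"
    unfolding T3_def using finC CR(2) by (subst sum.Sigma) (auto intro!: sum.cong)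
  also have "\<dots> = (\<Sum>(R, l)\<in>T1 \<union> T2. ?w R)"
  proof (rule sum.reindex_bij_witness[where i = "\<lambda>(R, l). (insert l R, l)" and j = "\<lambda>(R, l). (R - {l}, l)"])
    fix x assume x: "x \<in> T3"
    obtain R l where xl: "x = (R, l)" by (cases x)
    have R: "R \<in> C" "l \<in> R" using x xl unfolding T3_def by auto
    have RI: "R \<subseteq> I" "cl R = F" using R unfolding C_def by auto
    show "(\<lambda>(R, l). (insert l R, l)) ((\<lambda>(R, l). (R - {l}, l)) x) = x" using xl R by auto
    have ir: "insert l (R - {l}) = R" using R by auto
    have "(R - {l}, l) \<in> T1 \<union> T2"
    proof (cases "l \<in> cl (R - {l})")
      case True
      have "R - {l} \<subseteq> I" using RI by blast
      then have "cl (R - {l}) = F" using cl_insert_absorb[OF _ True] ir RI by simp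
      then show ?thesis using RI R CR(1)[OF R(1)] unfolding T2_def C_def by blast
    next
      case False
      then show ?thesis using RI R ir unfolding T1_def by auto
    qed
    then show "(\<lambda>(R, l). (R - {l}, l)) x \<in> T1 \<union> T2" using xl by simp
    show "(\<lambda>(R, l). ?w R) ((\<lambda>(R, l). (R - {l}, l)) x) = (\<lambda>(R, l). urn_weight (card I) (card R - 1)) x"
      using xl R CR(2)[OF R(1)] by simp
  next
    fix y assume y: "y \<in> T1 \<union> T2"
    obtain R l where yl: "y = (R, l)" by (cases y)
    have n: "l \<notin> R \<and> insert l R \<in> C"
    proof (cases "y \<in> T1")
      case True
      then have "R \<subseteq> I" "l \<in> I - cl R" "cl (insert l R) = F" using yl unfolding T1_def by auto
      then show ?thesis using subset_cl[of R] unfolding C_def by auto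
    next
      case False
      then have R: "R \<in> C" "l \<in> F - R" using y yl unfolding T2_def by auto
      then have "R \<subseteq> I" "cl R = F" unfolding C_def by auto
      then show ?thesis using cl_insert_absorb[of R l] R flat_subset[OF F] unfolding C_def by auto
    qed
    show "(\<lambda>(R, l). (R - {l}, l)) ((\<lambda>(R, l). (insert l R, l)) y) = y" using yl n by auto
    show "(\<lambda>(R, l). (insert l R, l)) y \<in> T3" using yl n unfolding T3_def by auto
  qed
  also have "\<dots> = (\<Sum>(R, l)\<in>T1. ?w R) + (\<Sum>(R, l)\<in>T2. ?w R)"
  proof (rule sum.union_disjoint[OF finT(1,2)])
    show "T1 \<inter> T2 = {}" unfolding T1_def T2_def C_def by auto
  qed
  also have "(\<Sum>(R, l)\<in>T2. ?w R) = (\<Sum>R\<in>C. \<Sum>l\<in>F - R. ?w R)"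
    unfolding T2_def using finC finite_rows[OF flat_subset[OF F]]
    by (subst sum.Sigma) (auto intro!: sum.cong)
  also have "\<dots> = (\<Sum>R\<in>C. (real (card F) - real (card R)) * ?w R)"
  proof (rule sum.cong[OF refl])
    fix R assume R: "R \<in> C"
    have "real (card (F - R)) = real (card F) - real (card R)"
      using CR[OF R] by (simp add: card_Diff_subset of_nat_diff)
    then show "(\<Sum>l\<in>F - R. ?w R) = (real (card F) - real (card R)) * ?w R" by simp
  qed
  also have "(\<Sum>(R, l)\<in>T1. ?w R) =
      (\<Sum>(F0, l) | flat F0 \<and> l \<in> I - F0 \<and> cl (insert l F0) = F. flat_weight F0)"
  proof -
    define S where "S = {(F0, l). flat F0 \<and> l \<in> I - F0 \<and> cl (insert l F0) = F}"
    have finS: "finite S" unfolding S_def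
      by (rule finite_subset[of _ "Pow I \<times> I"]) (use fin(1) flat_subset in auto)
    have "(\<Sum>(F0, l)\<in>S. flat_weight F0) =
        (\<Sum>y\<in>S. \<Sum>x | x \<in> T1 \<and> (\<lambda>(R, l). (cl R, l)) x = y. (\<lambda>(R, l). ?w R) x)"
    proof (rule sum.cong[OF refl])
      fix y assume y: "y \<in> S"
      obtain F0 l where yl: "y = (F0, l)" by (cases y)
      have F0: "flat F0" "l \<in> I - F0" "cl (insert l F0) = F" using y yl unfolding S_def by auto
      have eq: "{x \<in> T1. (\<lambda>(R, l). (cl R, l)) x = y} = (\<lambda>R. (R, l)) ` {R. R \<in> Pow I \<and> cl R = F0}"
        unfolding T1_def yl using F0 insert_cl[of _ l] by auto
      have "(\<Sum>x | x \<in> T1 \<and> (\<lambda>(R, l). (cl R, l)) x = y. (\<lambda>(R, l). ?w R) x) =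
          (\<Sum>R | R \<in> Pow I \<and> cl R = F0. ?w R)"
        unfolding eq by (subst sum.reindex) (auto simp: inj_on_def)
      then show "(case y of (F0, l) \<Rightarrow> flat_weight F0) =
          (\<Sum>x | x \<in> T1 \<and> (\<lambda>(R, l). (cl R, l)) x = y. (\<lambda>(R, l). ?w R) x)"
        unfolding flat_weight_def yl by simp
    qed
    also have "\<dots> = (\<Sum>x\<in>T1. (\<lambda>(R, l). ?w R) x)"
    proof (rule sum.group[OF finT(1) finS])
      show "(\<lambda>(R, l). (cl R, l)) ` T1 \<subseteq> S"
        unfolding T1_def S_def using flat_cl insert_cl by auto
    qed
    finally show ?thesis unfolding S_def by simp
  qed
  finally have main: "(\<Sum>R\<in>C. real (card I - card R) * ?w R) = (if cl {} = F then 1 else 0) +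
      ((\<Sum>(F0, l) | flat F0 \<and> l \<in> I - F0 \<and> cl (insert l F0) = F. flat_weight F0) +
       (\<Sum>R\<in>C. (real (card F) - real (card R)) * ?w R))" .
  have "(\<Sum>R\<in>C. real (card I - card R) * ?w R) - (\<Sum>R\<in>C. (real (card F) - real (card R)) * ?w R) =
      (\<Sum>R\<in>C. real (card I - card F) * ?w R)"
    unfolding sum_subtractf[symmetric]
  proof (rule sum.cong[OF refl])
    fix R assume R: "R \<in> C"
    have "real (card I - card R) - (real (card F) - real (card R)) = real (card I - card F)"
      using CR(3)[OF R] lt by (simp add: of_nat_diff)
    then show "real (card I - card R) * ?w R - (real (card F) - real (card R)) * ?w R =
        real (card I - card F) * ?w R" by (metis left_diff_distrib)
  qed
  also have "\<dots> = real (card I - card F) * flat_weight F"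
    unfolding flat_weight_def C_def by (simp add: sum_distrib_left)
  finally show ?thesis using main by linarith
qed

lemma sum_flat_weight:
  "(\<Sum>F | flat F \<and> cover_size F < k. flat_weight F) =
    (\<Sum>R | R \<subseteq> I \<and> cover_size (cl R) < k. urn_weight (card I) (card R))"
proof -
  let ?S = "{R. R \<subseteq> I \<and> cover_size (cl R) < k}" and ?T = "{F. flat F \<and> cover_size F < k}"
  have "(\<Sum>F\<in>?T. flat_weight F) = (\<Sum>F\<in>?T. \<Sum>R | R \<in> ?S \<and> cl R = F. urn_weight (card I) (card R))"
    unfolding flat_weight_def by (rule sum.cong[OF refl], rule sum.cong) auto
  also have "\<dots> = (\<Sum>R\<in>?S. urn_weight (card I) (card R))"
  proof (rule sum.group)
    show "finite ?S" by (rule finite_subset[of _ "Pow I"]) (auto simp: fin)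
    show "finite ?T" by (rule finite_flats)
    show "cl ` ?S \<subseteq> ?T" using flat_cl by auto
  qed
  finally show ?thesis .
qed

end

section \<open>The distribution of the tight flat\<close>

text \<open>Truncation at 0 makes entries nonnegative at every sample point, so the deterministic
  results apply without exceptional sets.\<close>

definition matrix_of :: "(nat \<times> nat) set \<Rightarrow> (nat \<times> nat \<Rightarrow> real) \<Rightarrow> nat \<times> nat \<Rightarrow> real" where
  "matrix_of P A p = (if p \<in> P then max 0 (A p) else 0)"

lemma matrix_of_update: "p \<in> P \<Longrightarrow> 0 \<le> t \<Longrightarrow> matrix_of P (A(p := t)) = (matrix_of P A)(p := t)"
  unfolding matrix_of_def by auto

lemma measurable_matrix_of: "(\<lambda>A. matrix_of P A p) \<in> borel_measurable (exp_product P)"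
proof (cases "p \<in> P")
  case True
  then show ?thesis unfolding matrix_of_def
    by simp (intro borel_measurable_max borel_measurable_const measurable_exp_product_component)
next
  case False
  then show ?thesis unfolding matrix_of_def by simp
qed

lemma measurable_opt:
  assumes "finite I" "finite K"
  shows "(\<lambda>A. opt (matrix_of P A) s I K) \<in> borel_measurable (exp_product P)"
  unfolding opt_def cost_def
  by (intro borel_measurable_Min finite_assigns assms borel_measurable_sum measurable_matrix_of)

lemma integrable_matrix_of: "integrable (exp_product P) (\<lambda>A. matrix_of P A p)"
proof (cases "p \<in> P")
  case True
  then show ?thesis unfolding matrix_of_def
    using integrable_max[OF _ integrable_exp_product_component[OF True], of "\<lambda>_. 0"] by simp
next
  case False
  then show ?thesis unfolding matrix_of_def by simp
qed

lemma integrable_opt: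
  assumes "finite I" "finite K" "s \<le> card I" "s \<le> card K"
  shows "integrable (exp_product P) (\<lambda>A. opt (matrix_of P A) s I K)"
proof -
  obtain S where S: "S \<in> assigns s I K" using assigns_nonempty[OF assms] by blast
  have "integrable (exp_product P) (\<lambda>A. cost (matrix_of P A) S)"
    unfolding cost_def by (intro Bochner_Integration.integrable_sum integrable_matrix_of)
  then show ?thesis
  proof (rule Bochner_Integration.integrable_bound)
    show "(\<lambda>A. opt (matrix_of P A) s I K) \<in> borel_measurable (exp_product P)"
      by (rule measurable_opt[OF assms(1,2)])
    have "0 \<le> opt (matrix_of P A) s I K" for A
      by (rule opt_nonneg[OF assms]) (simp add: matrix_of_def)
    moreover have "opt (matrix_of P A) s I K \<le> cost (matrix_of P A) S" for A
      by (rule opt_le[OF assms(1,2) S])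
    ultimately have "norm (opt (matrix_of P A) s I K) \<le> norm (cost (matrix_of P A) S)" for A
      by (smt (verit) real_norm_def)
    then show "AE A in exp_product P. norm (opt (matrix_of P A) s I K) \<le> norm (cost (matrix_of P A) S)"
      by simp
  qed
qed

lemma borel_measurable_indicator_times_ennreal:
  assumes [measurable]: "E \<in> sets N" "f \<in> borel_measurable N"
  shows "(\<lambda>x. indicator E x * ennreal (f x)) \<in> borel_measurable N"
  by measurable

text \<open>Comparing indicators almost everywhere allows the events to overlap or to leave
  \<open>E\<close> on a null set.\<close>

lemma (in prob_space) prob_eq_sum_AE:
  assumes S: "finite S" and E: "E \<in> events" and T: "\<And>i. i \<in> S \<Longrightarrow> T i \<in> events"
    and ae: "AE x in M. if x \<in> E then \<exists>!i. i \<in> S \<and> x \<in> T i else \<forall>i\<in>S. x \<notin> T i"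
  shows "prob E = (\<Sum>i\<in>S. prob (T i))"
proof -
  have "prob E = (\<integral>x. indicator E x \<partial>M)" using E by simp
  also have "\<dots> = (\<integral>x. (\<Sum>i\<in>S. indicator (T i) x) \<partial>M)"
  proof (rule integral_cong_AE)
    show "indicator E \<in> borel_measurable M" using E by simp
    show "(\<lambda>x. \<Sum>i\<in>S. indicator (T i) x :: real) \<in> borel_measurable M"
      by (intro borel_measurable_sum borel_measurable_indicator T)
    show "AE x in M. indicator E x = (\<Sum>i\<in>S. indicator (T i) x :: real)"
      using ae
    proof eventually_elim
      case (elim x)
      show ?case
      proof (cases "x \<in> E")
        case True
        then have "\<exists>!i. i \<in> S \<and> x \<in> T i" using elim by simp
        then obtain i where i: "i \<in> S" "\<forall>i'\<in>S. x \<in> T i' \<longleftrightarrow> i' = i" by blast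
        have "(\<Sum>i'\<in>S. indicator (T i') x :: real) = (\<Sum>i'\<in>S. if i' = i then 1 else 0)"
          by (intro sum.cong refl) (simp add: i(2) indicator_def)
        then show ?thesis using True S i(1) by simp
      next
        case False
        then show ?thesis using elim by (simp add: indicator_def)
      qed
    qed
  qed
  also have "\<dots> = (\<Sum>i\<in>S. prob (T i))"
    using T by (subst Bochner_Integration.integral_sum) (auto simp: emeasure_eq_measure)
  finally show ?thesis .
qed

text \<open>The inclusion \<open>I \<times> K - Z \<subseteq> P\<close> lets one product space serve
  while columns are deleted from \<open>K\<close>.\<close>

locale random_zero_pattern = zero_pattern +
  fixes P :: "(nat \<times> nat) set"
  assumes finite_P: "finite P" and nonzero_P: "I \<times> K - Z \<subseteq> P" and P_Z: "P \<inter> Z = {}"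
begin

abbreviation Q :: "(nat \<times> nat \<Rightarrow> real) measure" where
  "Q \<equiv> exp_product P"

abbreviation mat :: "(nat \<times> nat \<Rightarrow> real) \<Rightarrow> nat \<times> nat \<Rightarrow> real" where
  "mat \<equiv> matrix_of P"

sublocale prob_space Q
  by (rule prob_space_exp_product)

lemma weighted: "weighted_zero_pattern I K Z (mat A)"
  using P_Z by unfold_locales (auto simp: matrix_of_def)

lemma entry_in_P: "flat F \<Longrightarrow> p \<in> (I - F) \<times> free_cols F \<Longrightarrow> p \<in> P"
  using nonzero_P unfolding free_cols_def zero_cols_def by auto

lemma measurable_flat_cost:
  assumes "F \<subseteq> I"
  shows "(\<lambda>A. flat_cost (mat A) F) \<in> borel_measurable (Q)"
    "(\<lambda>A. flat_cost_minus (mat A) F j) \<in> borel_measurable (Q)"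
  unfolding flat_cost_def flat_cost_minus_def
  by (intro measurable_opt finite_rows assms finite_free_cols finite_Diff)+

lemma measurable_link_cost:
  assumes "F \<subseteq> I"
  shows "(\<lambda>A. link_cost (mat A) F p) \<in> borel_measurable (Q)"
  unfolding link_cost_def
  by (intro borel_measurable_add measurable_matrix_of measurable_flat_cost assms)

lemma measurable_delta: "(\<lambda>A. delta (mat A) s j) \<in> borel_measurable (Q)"
  unfolding delta_def by (intro borel_measurable_diff measurable_opt fin finite_Diff)

section \<open>Events of a flat being tight and of an entry being chosen\<close>

definition tight_event :: "nat set \<Rightarrow> (nat \<times> nat \<Rightarrow> real) set" where
  "tight_event F = {A \<in> space (Q). tight (mat A) F}"

definition chosen_event :: "nat set \<Rightarrow> nat \<times> nat \<Rightarrow> (nat \<times> nat \<Rightarrow> real) set" where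
  "chosen_event F p = {A \<in> space (Q). tight (mat A) F \<and> chosen (mat A) F p}"

lemma tight_event_sets: "F \<subseteq> I \<Longrightarrow> tight_event F \<in> events"
  unfolding tight_event_def tight_def
  by (intro borel_measurable_eq measurable_opt fin measurable_flat_cost)

lemma chosen_event_sets:
  assumes "F \<subseteq> I"
  shows "chosen_event F p \<in> events"
proof -
  have "{A \<in> space (Q). \<forall>q\<in>(I - F) \<times> free_cols F - {p}.
      link_cost (mat A) F p < link_cost (mat A) F q} \<in> events"
    by (intro sets.sets_Collect_finite_All borel_measurable_less measurable_link_cost assms
        finite_Diff finite_cartesian_product fin finite_free_cols)
  moreover have "chosen_event F p = tight_event F \<inter> {A \<in> space (Q).
      \<forall>q\<in>(I - F) \<times> free_cols F - {p}. link_cost (mat A) F p < link_cost (mat A) F q}"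
    unfolding chosen_event_def tight_event_def chosen_def by auto
  ultimately show ?thesis using tight_event_sets[OF assms] by simp
qed

lemma delta_nonneg:
  assumes "s \<le> card I" "s \<le> card K"
  shows "0 \<le> delta (mat A) s j"
  using assms
proof (induction s)
  case (Suc s)
  then show ?case
    using weighted_zero_pattern.delta_mono[OF weighted, of s A j] by linarith
qed (simp add: delta_0)

definition total_delta :: "(nat \<times> nat \<Rightarrow> real) \<Rightarrow> nat \<Rightarrow> real" where
  "total_delta A s = (\<Sum>j\<in>K. delta (mat A) s j)"

lemma measurable_total_delta: "(\<lambda>A. total_delta A s) \<in> borel_measurable (Q)"
  unfolding total_delta_def by (intro borel_measurable_sum measurable_delta)

lemma total_delta_mono:
  assumes "s < card I" "s < card K"
  shows "total_delta A s \<le> total_delta A (Suc s)"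
  unfolding total_delta_def
  by (intro sum_mono weighted_zero_pattern.delta_mono[OF weighted] assms)

text \<open>\<open>exp_product_primitive\<close> in the coordinate \<open>(l, j)\<close> turns the
  probability into the mean length of the set of lowered values at which \<open>(l, j)\<close> would
  be chosen; by \<open>delta_increment\<close> this length is the increment of \<open>delta\<close>.
  The left side does not contain \<open>l\<close>.\<close>

lemma chosen_event_emeasure:
  assumes F: "flat F" and s: "cover_size F < card I" "cover_size F < card K"
    and p: "l \<in> I - F" "j \<in> free_cols F"
  shows "(\<integral>\<^sup>+A. indicator (tight_event F) A * ennreal (delta (mat A) (Suc (cover_size F)) j -
      delta (mat A) (cover_size F) j) \<partial>Q) = emeasure (Q) (chosen_event F (l, j))"
proof -
  let ?f = "indicator (chosen_event F (l, j)) :: _ \<Rightarrow> ennreal"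
  have FI: "F \<subseteq> I" by (rule flat_subset[OF F])
  have pP: "(l, j) \<in> P" using entry_in_P[OF F] p by simp
  have "emeasure (Q) (chosen_event F (l, j)) = (\<integral>\<^sup>+A. ?f A \<partial>Q)"
    using chosen_event_sets[OF FI] by simp
  also have "\<dots> = (\<integral>\<^sup>+A. (\<integral>\<^sup>+t. ?f (A((l, j) := t)) * indicator {0..<A (l, j)} t \<partial>lborel) \<partial>Q)"
    by (rule exp_product_primitive[OF finite_P pP, symmetric])
      (intro borel_measurable_indicator chosen_event_sets[OF FI])
  also have "\<dots> = (\<integral>\<^sup>+A. indicator (tight_event F) A * ennreal (delta (mat A) (Suc (cover_size F)) j -
      delta (mat A) (cover_size F) j) \<partial>Q)"
  proof (rule nn_integral_cong)
    fix A assume A: "A \<in> space (Q)"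
    let ?B = "mat A" and ?s = "cover_size F"
    let ?d = "delta ?B ?s j" and ?u = "opt ?B (Suc ?s) I K - flat_cost_minus ?B F j"
    have d0: "0 \<le> ?d" using s by (intro delta_nonneg) auto
    have sp: "A((l, j) := t) \<in> space (Q)" for t
      using A pP unfolding exp_product_def space_PiM by (auto simp: PiE_def extensional_def)
    have "?f (A((l, j) := t)) * indicator {0..<A (l, j)} t =
        indicator (tight_event F) A * indicator {?d..<?u} t" for t
    proof (cases "0 \<le> t")
      case True
      have "A((l, j) := t) \<in> chosen_event F (l, j) \<and> t < A (l, j) \<longleftrightarrow>
          t < ?B (l, j) \<and> tight (?B((l, j) := t)) F \<and> chosen (?B((l, j) := t)) F (l, j)"
      proof -
        have "A((l, j) := t) \<in> chosen_event F (l, j) \<longleftrightarrow>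
            tight (?B((l, j) := t)) F \<and> chosen (?B((l, j) := t)) F (l, j)"
          using sp[of t] by (simp add: chosen_event_def matrix_of_update[OF pP True])
        moreover have "t < A (l, j) \<longleftrightarrow> t < ?B (l, j)" using True pP by (auto simp: matrix_of_def)
        ultimately show ?thesis by blast
      qed
      also have "\<dots> \<longleftrightarrow> tight ?B F \<and> ?d \<le> t \<and> t + flat_cost_minus ?B F j < opt ?B (Suc ?s) I K"
        by (rule weighted_zero_pattern.lowered_entry_chosen_iff[OF weighted F s p True])
      also have "\<dots> \<longleftrightarrow> A \<in> tight_event F \<and> t \<in> {?d..<?u}"
        unfolding tight_event_def using A by auto
      finally show ?thesis using True by (auto simp: indicator_def)
    next
      case False
      \<comment> \<open>The interval starts at a nonnegative \<open>delta\<close>, so it contains no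
        negative \<open>t\<close>.\<close>
      then show ?thesis using d0 by (auto simp: indicator_def)
    qed
    then have "(\<integral>\<^sup>+t. ?f (A((l, j) := t)) * indicator {0..<A (l, j)} t \<partial>lborel) =
        (\<integral>\<^sup>+t. indicator (tight_event F) A * indicator {?d..<?u} t \<partial>lborel)" by simp
    also have "\<dots> = indicator (tight_event F) A * emeasure lborel {?d..<?u}"
      by (rule nn_integral_cmult_indicator) simp
    also have "emeasure lborel {?d..<?u} = ennreal (max 0 (?u - ?d))"
      by (cases "?d \<le> ?u") (simp_all add: max_def)
    also have "indicator (tight_event F) A * ennreal (max 0 (?u - ?d)) =
        indicator (tight_event F) A * ennreal (delta ?B (Suc ?s) j - ?d)"
    proof (cases "A \<in> tight_event F")
      case True
      then have "tight ?B F" unfolding tight_event_def by simp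
      then show ?thesis
        using weighted_zero_pattern.delta_increment[OF weighted F s _ p(2), of A] by simp
    qed simp
    finally show "(\<integral>\<^sup>+t. ?f (A((l, j) := t)) * indicator {0..<A (l, j)} t \<partial>lborel) =
        indicator (tight_event F) A * ennreal (delta ?B (Suc ?s) j - ?d)" .
  qed
  finally show ?thesis by simp
qed

definition chosen_row_prob :: "nat set \<Rightarrow> nat \<Rightarrow> real" where
  "chosen_row_prob F l = (\<Sum>j\<in>free_cols F. prob (chosen_event F (l, j)))"

text \<open>Columns in \<open>zero_cols (I - F)\<close> add nothing, so the free columns carry the
  whole increment. The left side is free of \<open>l\<close>: all rows outside \<open>F\<close> are
  equally likely to join.\<close>

lemma chosen_row_prob_eq:
  assumes F: "flat F" and s: "cover_size F < card I" "cover_size F < card K" and l: "l \<in> I - F"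
  shows "(\<integral>\<^sup>+A. indicator (tight_event F) A *
      ennreal (total_delta A (Suc (cover_size F)) - total_delta A (cover_size F)) \<partial>Q) =
    ennreal (chosen_row_prob F l)"
proof -
  let ?d = "\<lambda>A j. delta (mat A) (Suc (cover_size F)) j - delta (mat A) (cover_size F) j"
  have nn: "0 \<le> ?d A j" for A j using weighted_zero_pattern.delta_mono[OF weighted s, of A j] by simp
  have "indicator (tight_event F) A *
      ennreal (total_delta A (Suc (cover_size F)) - total_delta A (cover_size F)) =
      (\<Sum>j\<in>free_cols F. indicator (tight_event F) A * ennreal (?d A j))" for A
  proof (cases "A \<in> tight_event F")
    case True
    then have t: "tight (mat A) F" unfolding tight_event_def by simp
    have "total_delta A (Suc (cover_size F)) - total_delta A (cover_size F) = (\<Sum>j\<in>K. ?d A j)"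
      unfolding total_delta_def by (simp add: sum_subtractf)
    also have "\<dots> = (\<Sum>j\<in>free_cols F. ?d A j)"
    proof (rule sum.mono_neutral_right[OF fin(2) free_cols_subset], rule ballI)
      fix j assume "j \<in> K - free_cols F"
      then have "j \<in> zero_cols (I - F)" unfolding free_cols_def by blast
      then show "?d A j = 0" using weighted_zero_pattern.delta_increment_zero[OF weighted F s t] by simp
    qed
    finally show ?thesis using True nn by (simp add: sum_ennreal)
  qed simp
  then have "(\<integral>\<^sup>+A. indicator (tight_event F) A *
      ennreal (total_delta A (Suc (cover_size F)) - total_delta A (cover_size F)) \<partial>Q) =
      (\<integral>\<^sup>+A. (\<Sum>j\<in>free_cols F. indicator (tight_event F) A * ennreal (?d A j)) \<partial>Q)" by simp
  also have "\<dots> = (\<Sum>j\<in>free_cols F. \<integral>\<^sup>+A. indicator (tight_event F) A * ennreal (?d A j) \<partial>Q)"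
    by (intro nn_integral_sum borel_measurable_indicator_times_ennreal tight_event_sets
        flat_subset[OF F] borel_measurable_diff measurable_delta)
  also have "\<dots> = (\<Sum>j\<in>free_cols F. ennreal (prob (chosen_event F (l, j))))"
    using chosen_event_emeasure[OF F s l] by (intro sum.cong refl) (simp add: emeasure_eq_measure)
  also have "\<dots> = ennreal (chosen_row_prob F l)"
    unfolding chosen_row_prob_def by (simp add: sum_ennreal)
  finally show ?thesis .
qed

text \<open>The entry at \<open>p\<close> occurs in the link cost of \<open>p\<close> only: its row
  is outside \<open>F\<close>, so the costs of \<open>F\<close> do not see it. A tie would determine
  one exponential coordinate by the others.\<close>

lemma AE_generic: "AE A in Q. generic (mat A)"
proof -
  define S where "S = {(F, p, q). F \<in> Pow I \<and> p \<in> (I - F) \<times> free_cols F \<and> q \<in> (I - F) \<times> free_cols F \<and> p \<noteq> q}"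
  have finS: "finite S"
    by (rule finite_subset[of _ "Pow I \<times> (I \<times> K) \<times> (I \<times> K)"])
      (use fin free_cols_subset in \<open>auto simp: S_def\<close>)
  have "AE A in Q. link_cost (mat A) F p \<noteq> link_cost (mat A) F q"
    if "(F, p, q) \<in> S" for F p q
  proof -
    have F: "F \<subseteq> I" and p: "fst p \<in> I - F" "snd p \<in> free_cols F" and pq: "p \<noteq> q"
      using that unfolding S_def by auto
    have pP: "p \<in> P" using nonzero_P p unfolding free_cols_def zero_cols_def
      by (cases p) auto
    define g where "g = (\<lambda>A. link_cost (mat A) F q - flat_cost_minus (mat A) F (snd p))"
    have gm: "g \<in> borel_measurable (Q)"
      unfolding g_def by (intro borel_measurable_diff measurable_link_cost measurable_flat_cost F)
    have ind: "g (A(p := t)) = g A" for A t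
    proof -
      have "matrix_of P (A(p := t)) r = mat A r" if "r \<noteq> p" for r
        using that unfolding matrix_of_def by simp
      moreover have "r \<noteq> p" if "r \<in> F \<times> C" for r C using that p(1) by auto
      ultimately have "opt (matrix_of P (A(p := t))) s F C = opt (mat A) s F C" for s C
        by (metis opt_cong)
      then show ?thesis unfolding g_def link_cost_def flat_cost_minus_def matrix_of_def using pq by simp
    qed
    have "AE A in Q. A p \<noteq> g A" by (rule AE_exp_product_neq[OF finite_P pP gm ind])
    then show ?thesis using AE_exp_product_pos[OF finite_P]
    proof eventually_elim
      case (elim A)
      have "mat A p = A p" using elim(2) pP unfolding matrix_of_def by (simp add: max_def less_imp_le)
      then show ?case using elim(1) unfolding g_def link_cost_def[of _ _ p] by auto
    qed
  qed
  then have "AE A in Q. \<forall>x\<in>S. link_cost (mat A) (fst x) (fst (snd x)) \<noteq>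
      link_cost (mat A) (fst x) (snd (snd x))"
    using finS by (intro AE_finite_allI) auto
  then show ?thesis
  proof eventually_elim
    case (elim A)
    show ?case unfolding generic_def
    proof (intro ballI impI)
      fix F p q assume "F \<in> Pow I" "p \<in> (I - F) \<times> free_cols F" "q \<in> (I - F) \<times> free_cols F" "p \<noteq> q"
      then have "(F, p, q) \<in> S" unfolding S_def by blast
      then show "link_cost (mat A) F p \<noteq> link_cost (mat A) F q" using elim by force
    qed
  qed
qed

text \<open>Almost surely exactly one entry is chosen at a tight flat, and
  \<open>chosen_event\<close> includes tightness.\<close>

lemma prob_tight_event_rows:
  assumes F: "flat F" and s: "cover_size F < card I" "cover_size F < card K"
  shows "prob (tight_event F) = (\<Sum>l\<in>I - F. chosen_row_prob F l)"
proof -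
  let ?S = "(I - F) \<times> free_cols F"
  have "prob (tight_event F) = (\<Sum>p\<in>?S. prob (chosen_event F p))"
  proof (rule prob_eq_sum_AE)
    show "finite ?S" using fin(1) finite_free_cols by blast
    show "AE A in Q. if A \<in> tight_event F then \<exists>!p. p \<in> ?S \<and> A \<in> chosen_event F p
        else \<forall>p\<in>?S. A \<notin> chosen_event F p"
      using AE_generic
    proof eventually_elim
      case (elim A)
      interpret W: weighted_zero_pattern I K Z "mat A" by (rule weighted)
      show ?case
      proof (cases "A \<in> tight_event F")
        case True
        obtain p where p: "p \<in> ?S" "chosen (mat A) F p" using W.chosen_exists[OF elim F s] .
        have "A \<in> chosen_event F p" using True p unfolding chosen_event_def tight_event_def by simp
        moreover have "q = p" if "q \<in> ?S" "A \<in> chosen_event F q" for q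
          using W.chosen_unique[OF that(1) p(1) _ p(2)] that(2) unfolding chosen_event_def by simp
        ultimately show ?thesis using True p(1) by auto
      next
        case False
        then show ?thesis unfolding chosen_event_def tight_event_def by auto
      qed
    qed
  qed (intro tight_event_sets chosen_event_sets flat_subset[OF F])+
  also have "\<dots> = (\<Sum>l\<in>I - F. chosen_row_prob F l)"
    unfolding chosen_row_prob_def by (simp add: sum.cartesian_product)
  finally show ?thesis .
qed

text \<open>Almost surely a tight flat above the lowest rank has one predecessor:
  \<open>tight_exists\<close> supplies a tight flat one rank lower, \<open>tight_step\<close> leads
  from its chosen entry to a tight flat of the rank of \<open>F\<close>, and
  \<open>tight_unique\<close> identifies both.\<close>

lemma prob_tight_event_step:
  assumes F: "flat F" and s: "cover_size F < card I" "cover_size F < card K"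
    and gt: "cover_size (cl {}) < cover_size F"
  shows "prob (tight_event F) =
    (\<Sum>(F0, l) | flat F0 \<and> l \<in> I - F0 \<and> cl (insert l F0) = F. chosen_row_prob F0 l)"
proof -
  define S where "S = {(F0, l). flat F0 \<and> l \<in> I - F0 \<and> cl (insert l F0) = F}"
  have finS: "finite S" unfolding S_def
    by (rule finite_subset[of _ "Pow I \<times> I"]) (use fin(1) flat_subset in auto)
  let ?S = "Sigma S (\<lambda>x. free_cols (fst x))"
  let ?T = "\<lambda>x. chosen_event (fst (fst x)) (snd (fst x), snd x)"
  have S: "flat F0" "l \<in> I - F0" "cl (insert l F0) = F" "cover_size F = Suc (cover_size F0)" "F0 \<subseteq> I"
    if "(F0, l) \<in> S" for F0 l
    using that cover_size_cl_insert[of F0 l] flat_subset[of F0] unfolding S_def by auto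
  have "prob (tight_event F) = (\<Sum>x\<in>?S. prob (?T x))"
  proof (rule prob_eq_sum_AE)
    show "finite ?S" using finS finite_free_cols by blast
    show "tight_event F \<in> events" by (intro tight_event_sets flat_subset[OF F])
    show "?T x \<in> events" if "x \<in> ?S" for x
      using that S(5)[of "fst (fst x)" "snd (fst x)"] by (intro chosen_event_sets) auto
    show "AE A in Q. if A \<in> tight_event F then \<exists>!x. x \<in> ?S \<and> A \<in> ?T x
        else \<forall>x\<in>?S. A \<notin> ?T x"
      using AE_generic
    proof eventually_elim
      case (elim A)
      interpret W: weighted_zero_pattern I K Z "mat A" by (rule weighted)
      let ?B = "mat A"
      have imp: "A \<in> tight_event F" if "x \<in> ?S" "A \<in> ?T x" for x
      proof -
        obtain F0 l j where x: "x = ((F0, l), j)" by (metis surj_pair)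
        have x1: "(F0, l) \<in> S" "j \<in> free_cols F0" using that(1) x by auto
        have c: "tight ?B F0" "chosen ?B F0 (l, j)" "A \<in> space (Q)"
          using that(2) x unfolding chosen_event_def by auto
        have "tight ?B (cl (insert l F0))"
          using S(4)[OF x1(1)] s by (intro W.tight_step[OF S(1)[OF x1(1)] _ _ c(1) S(2)[OF x1(1)] x1(2) c(2)]) auto
        then show ?thesis using c(3) S(3)[OF x1(1)] unfolding tight_event_def by simp
      qed
      show ?case
      proof (cases "A \<in> tight_event F")
        case True
        then have t: "tight ?B F" "A \<in> space (Q)" unfolding tight_event_def by auto
        obtain s0 where s0: "cover_size F = Suc s0" using gt by (cases "cover_size F") auto
        have b: "cover_size (cl {}) \<le> s0" "s0 < card I" "s0 < card K" using gt s s0 by auto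
        obtain F0 where F0: "flat F0" "cover_size F0 = s0" "tight ?B F0"
          using W.tight_exists[OF elim b] by blast
        have b': "cover_size F0 < card I" "cover_size F0 < card K" using b F0(2) by auto
        obtain p where p: "p \<in> (I - F0) \<times> free_cols F0" "chosen ?B F0 p"
          using W.chosen_exists[OF elim F0(1) b'] .
        obtain l j where lj: "p = (l, j)" by (cases p)
        have l: "l \<in> I - F0" "j \<in> free_cols F0" "chosen ?B F0 (l, j)" using p lj by auto
        have R: "insert l F0 \<subseteq> I" using l(1) flat_subset[OF F0(1)] by blast
        have "tight ?B (cl (insert l F0))"
          using s s0 F0(2) by (intro W.tight_step[OF F0(1) _ _ F0(3) l]) auto
        moreover have "cover_size (cl (insert l F0)) = cover_size F"
          using cover_size_cl_insert[OF F0(1) l(1)] F0(2) s0 by simp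
        ultimately have "cl (insert l F0) = F"
          using W.tight_unique[OF elim s F t(1) flat_cl[OF R]] by blast
        then have m: "((F0, l), j) \<in> ?S" unfolding S_def using F0(1) l by auto
        have mT: "A \<in> ?T ((F0, l), j)" unfolding chosen_event_def using t(2) F0(3) l(3) by simp
        have uq: "x = ((F0, l), j)" if x: "x \<in> ?S" "A \<in> ?T x" for x
        proof -
          obtain F1 l1 j1 where x1: "x = ((F1, l1), j1)" by (metis surj_pair)
          have y: "(F1, l1) \<in> S" "j1 \<in> free_cols F1" using x(1) x1 by auto
          have c: "tight ?B F1" "chosen ?B F1 (l1, j1)" using x(2) x1 unfolding chosen_event_def by auto
          have "cover_size F1 = cover_size F0" using S(4)[OF y(1)] s0 F0(2) by simp
          then have "F1 = F0" using W.tight_unique[OF elim b' F0(1,3) S(1)[OF y(1)] c(1)] by blast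
          moreover have "(l1, j1) = (l, j)"
            using W.chosen_unique[of "(l1, j1)" F0 "(l, j)"] S(2)[OF y(1)] y(2) l c(2) \<open>F1 = F0\<close> by auto
          ultimately show ?thesis using x1 by simp
        qed
        have "\<exists>!x. x \<in> ?S \<and> A \<in> ?T x"
        proof (rule ex1I[of _ "((F0, l), j)"])
          show "((F0, l), j) \<in> ?S \<and> A \<in> ?T ((F0, l), j)" using m mT by (rule conjI)
          fix x assume "x \<in> ?S \<and> A \<in> ?T x"
          then show "x = ((F0, l), j)" by (elim conjE) (rule uq)
        qed
        then show ?thesis by (simp only: True if_True)
      next
        case False
        have "\<forall>x\<in>?S. A \<notin> ?T x"
        proof (intro ballI notI)
          fix x assume "x \<in> ?S" "A \<in> ?T x"
          then have "A \<in> tight_event F" by (rule imp)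
          then show False using False by contradiction
        qed
        then show ?thesis by (simp only: False if_False)
      qed
    qed
  qed
  also have "\<dots> = (\<Sum>x\<in>S. \<Sum>j\<in>free_cols (fst x). prob (chosen_event (fst x) (snd x, j)))"
    using finS finite_free_cols by (subst sum.Sigma) (auto simp: case_prod_beta')
  also have "\<dots> = (\<Sum>(F0, l)\<in>S. chosen_row_prob F0 l)"
    unfolding chosen_row_prob_def by (simp add: case_prod_beta')
  finally show ?thesis unfolding S_def .
qed

lemma prob_tight_event_base:
  assumes "cover_size (cl {}) < card I" "cover_size (cl {}) \<le> card K"
  shows "prob (tight_event (cl {})) = 1"
proof -
  have "tight_event (cl {}) = space (Q)"
    unfolding tight_event_def using weighted_zero_pattern.tight_base[OF weighted assms] by blast
  then show ?thesis by (simp add: prob_space)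
qed

text \<open>As all rows are equally likely, \<open>prob (tight_event F)\<close> is the number of
  rows outside \<open>F\<close> times \<open>chosen_row_prob F l\<close>. Splitting the same
  probability over the predecessors gives the recursion of \<open>flat_weight_rec\<close>.\<close>

lemma chosen_row_prob_eq_weight:
  assumes "flat F" "cover_size F < card I" "cover_size F < card K" "l \<in> I - F"
  shows "chosen_row_prob F l = flat_weight F"
  using assms
proof (induction "cover_size F" arbitrary: F l rule: less_induct)
  case less
  note F = less.prems(1) and s = less.prems(2,3)
  have cF: "card F < card I" using s unfolding cover_size_def by linarith
  have nn: "0 \<le> chosen_row_prob F l'" for l'
    unfolding chosen_row_prob_def by (intro sum_nonneg measure_nonneg)
  have const: "chosen_row_prob F l' = chosen_row_prob F l" if "l' \<in> I - F" for l'
    using chosen_row_prob_eq[OF F s that] chosen_row_prob_eq[OF F s less.prems(4)] nn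
    by (metis ennreal_inj)
  have "real (card I - card F) * chosen_row_prob F l = (\<Sum>l'\<in>I - F. chosen_row_prob F l')"
    using const flat_subset[OF F] finite_rows by (simp add: card_Diff_subset)
  also have "\<dots> = prob (tight_event F)" using prob_tight_event_rows[OF F s] by simp
  also have "\<dots> = real (card I - card F) * flat_weight F"
  proof (cases "cover_size (cl {}) < cover_size F")
    case True
    then have ne: "cl {} \<noteq> F" by auto
    have "prob (tight_event F) =
        (\<Sum>(F0, l) | flat F0 \<and> l \<in> I - F0 \<and> cl (insert l F0) = F. chosen_row_prob F0 l)"
      by (rule prob_tight_event_step[OF F s True])
    also have "\<dots> = (\<Sum>(F0, l) | flat F0 \<and> l \<in> I - F0 \<and> cl (insert l F0) = F. flat_weight F0)"
    proof (rule sum.cong[OF refl], clarify)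
      fix F0 l0 assume F0: "flat F0" "l0 \<in> I" "l0 \<notin> F0" "F = cl (insert l0 F0)"
      have "cover_size F = Suc (cover_size F0)" using cover_size_cl_insert[of F0 l0] F0 by simp
      then show "chosen_row_prob F0 l0 = flat_weight F0"
        using less.hyps[of F0 l0] F0 s by simp
    qed
    also have "\<dots> = real (card I - card F) * flat_weight F"
      using flat_weight_rec[OF F cF] ne by simp
    finally show ?thesis .
  next
    case False
    \<comment> \<open>At the lowest rank \<open>F\<close> is \<open>cl {}\<close>, which has no
      predecessor and is always tight.\<close>
    have sub: "cl {} \<subseteq> F" by (rule cl_least[OF _ F]) simp
    have "cover_size (cl {}) \<le> cover_size F" using cover_size_cl_le[of "{}" F] flat_subset[OF F] by simp
    then have eq: "cl {} = F" using False sub flat_cl[of "{}"] F by (intro flat_eqI) auto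
    have "{(F0, l). flat F0 \<and> l \<in> I - F0 \<and> cl (insert l F0) = F} = {}"
    proof -
      have False if "flat F0" "l0 \<in> I - F0" "cl (insert l0 F0) = F" for F0 l0
        using cover_size_cl_insert[OF that(1,2)] that(3) eq cover_size_cl_le[of "{}" F0]
          flat_subset[OF that(1)] by simp
      then show ?thesis by auto
    qed
    then have 0: "(\<Sum>(F0, l) | flat F0 \<and> l \<in> I - F0 \<and> cl (insert l F0) = F. flat_weight F0) = 0"
      by (simp only: sum.empty)
    have "real (card I - card F) * flat_weight F = 1"
      by (simp only: flat_weight_rec[OF F cF] 0 eq if_True add_0_right simp_thms)
    moreover have "prob (tight_event F) = 1" using prob_tight_event_base s eq by simp
    ultimately show ?thesis by metis
  qed
  finally show ?case using cF by simp
qed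

text \<open>Almost surely exactly one flat of rank \<open>s\<close> is tight, and any row outside it
  serves to evaluate the increment. Below the rank of \<open>cl {}\<close> there are no flats, and
  zeros alone make both values of \<open>delta\<close> vanish.\<close>

lemma nn_integral_total_delta_step:
  assumes s: "s < card I" "s < card K"
  shows "(\<integral>\<^sup>+A. ennreal (total_delta A (Suc s) - total_delta A s) \<partial>Q) =
    (\<Sum>F | flat F \<and> cover_size F = s. ennreal (flat_weight F))"
proof (cases "cover_size (cl {}) \<le> s")
  case False
  have "{F. flat F \<and> cover_size F = s} = {}"
    using False cover_size_cl_le[of "{}"] flat_subset by auto
  then have "(\<Sum>F | flat F \<and> cover_size F = s. ennreal (flat_weight F)) = 0" by (simp only: sum.empty)
  moreover have "total_delta A (Suc s) - total_delta A s = 0" for A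
    unfolding total_delta_def using weighted_zero_pattern.delta_eq_0[OF weighted] s False by simp
  ultimately show ?thesis by simp
next
  case True
  let ?S = "{F. flat F \<and> cover_size F = s}"
  let ?d = "\<lambda>A. ennreal (total_delta A (Suc s) - total_delta A s)"
  have "(\<integral>\<^sup>+A. ?d A \<partial>Q) = (\<integral>\<^sup>+A. (\<Sum>F\<in>?S. indicator (tight_event F) A * ?d A) \<partial>Q)"
  proof (rule nn_integral_cong_AE)
    show "AE A in Q. ?d A = (\<Sum>F\<in>?S. indicator (tight_event F) A * ?d A)"
      using AE_generic AE_space
    proof eventually_elim
      case (elim A)
      interpret W: weighted_zero_pattern I K Z "mat A" by (rule weighted)
      obtain F where F: "flat F" "cover_size F = s" "tight (mat A) F"
        using W.tight_exists[OF elim(1) True s] by blast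
      have "(\<Sum>F'\<in>?S. indicator (tight_event F') A * ?d A) = (\<Sum>F'\<in>?S. if F' = F then ?d A else 0)"
      proof (rule sum.cong[OF refl])
        fix F' assume F': "F' \<in> ?S"
        have "A \<in> tight_event F' \<longleftrightarrow> F' = F"
        proof
          assume "A \<in> tight_event F'"
          then have "tight (mat A) F'" unfolding tight_event_def by simp
          then show "F' = F" using W.tight_unique[OF elim(1) _ _ F(1,3)] F' F(2) s by auto
        next
          assume "F' = F"
          then show "A \<in> tight_event F'" unfolding tight_event_def using F(3) elim(2) by simp
        qed
        then show "indicator (tight_event F') A * ?d A = (if F' = F then ?d A else 0)"
          by (cases "F' = F") auto
      qed
      also have "\<dots> = ?d A" using finite_flats[of "\<lambda>F. cover_size F = s"] F by simp
      finally show ?case by simp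
    qed
  qed
  also have "\<dots> = (\<Sum>F\<in>?S. \<integral>\<^sup>+A. indicator (tight_event F) A * ?d A \<partial>Q)"
    by (intro nn_integral_sum borel_measurable_indicator_times_ennreal tight_event_sets
        borel_measurable_diff measurable_total_delta) (auto dest: flat_subset)
  also have "\<dots> = (\<Sum>F\<in>?S. ennreal (flat_weight F))"
  proof (rule sum.cong[OF refl])
    fix F assume "F \<in> ?S"
    then have F: "flat F" "cover_size F = s" by auto
    obtain l where l: "l \<in> I - F"
      using s F card_mono[OF finite_rows[OF flat_subset[OF F(1)]], of I] unfolding cover_size_def by fastforce
    show "(\<integral>\<^sup>+A. indicator (tight_event F) A * ?d A \<partial>Q) = ennreal (flat_weight F)"
      using chosen_row_prob_eq[OF F(1) _ _ l] chosen_row_prob_eq_weight[OF F(1) _ _ l] s F(2) by simp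
  qed
  finally show ?thesis .
qed

lemma flat_weight_nonneg: "0 \<le> flat_weight F"
  unfolding flat_weight_def urn_weight_def by (intro sum_nonneg) simp

lemma nn_integral_total_delta:
  assumes "k \<le> card I" "k \<le> card K"
  shows "(\<integral>\<^sup>+A. ennreal (total_delta A k) \<partial>Q) =
    (\<Sum>F | flat F \<and> cover_size F < k. ennreal (flat_weight F))"
  using assms
proof (induction k)
  case 0
  then show ?case by (simp add: total_delta_def delta_0)
next
  case (Suc k)
  have "0 \<le> total_delta A k" for A
    unfolding total_delta_def using Suc.prems by (intro sum_nonneg delta_nonneg) auto
  then have "ennreal (total_delta A (Suc k)) =
      ennreal (total_delta A k) + ennreal (total_delta A (Suc k) - total_delta A k)" for A
    using total_delta_mono[of k A] Suc.prems by (subst ennreal_plus[symmetric]) auto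
  then have "(\<integral>\<^sup>+A. ennreal (total_delta A (Suc k)) \<partial>Q) =
      (\<integral>\<^sup>+A. ennreal (total_delta A k) \<partial>Q) +
      (\<integral>\<^sup>+A. ennreal (total_delta A (Suc k) - total_delta A k) \<partial>Q)"
    by (simp, intro nn_integral_add measurable_compose[OF _ measurable_ennreal]
        borel_measurable_diff measurable_total_delta)
  also have "\<dots> = (\<Sum>F | flat F \<and> cover_size F < k. ennreal (flat_weight F)) +
      (\<Sum>F | flat F \<and> cover_size F = k. ennreal (flat_weight F))"
    using Suc nn_integral_total_delta_step[of k] by simp
  also have "\<dots> = (\<Sum>F \<in> {F. flat F \<and> cover_size F < k} \<union> {F. flat F \<and> cover_size F = k}. ennreal (flat_weight F))"
    by (intro sum.union_disjoint[symmetric] finite_flats) auto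
  also have "{F. flat F \<and> cover_size F < k} \<union> {F. flat F \<and> cover_size F = k} = {F. flat F \<and> cover_size F < Suc k}"
    by auto
  finally show ?case .
qed

text \<open>The right-hand side is the expected time that the row urn spends at sets whose closure has
  rank below \<open>k\<close>.\<close>

lemma expectation_recursion:
  assumes k: "0 < k" "k \<le> card I" "k \<le> card K"
  shows "real (card K) * expectation (\<lambda>A. opt (mat A) k I K) -
      (\<Sum>j\<in>K. expectation (\<lambda>A. opt (mat A) (k - 1) I (K - {j}))) =
    (\<Sum>R | R \<subseteq> I \<and> cover_size (cl R) < k. urn_weight (card I) (card R))"
proof -
  have i1: "integrable (Q) (\<lambda>A. opt (mat A) k I K)"
    by (rule integrable_opt[OF fin k(2,3)])
  have i2: "integrable (Q) (\<lambda>A. opt (mat A) (k - 1) I (K - {j}))" for j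
    using k fin by (intro integrable_opt) (auto simp: card_Diff_singleton_if)
  have "real (card K) * expectation (\<lambda>A. opt (mat A) k I K) -
      (\<Sum>j\<in>K. expectation (\<lambda>A. opt (mat A) (k - 1) I (K - {j}))) =
      (\<Sum>j\<in>K. expectation (\<lambda>A. opt (mat A) k I K) -
        expectation (\<lambda>A. opt (mat A) (k - 1) I (K - {j})))"
    by (simp add: sum_subtractf)
  also have "\<dots> = (\<Sum>j\<in>K. expectation (\<lambda>A. delta (mat A) k j))"
    unfolding delta_def using i1 i2 by simp
  also have "\<dots> = expectation (\<lambda>A. total_delta A k)"
    unfolding total_delta_def using i1 i2
    by (subst Bochner_Integration.integral_sum) (simp_all add: delta_def)
  also have "\<dots> = enn2real (\<integral>\<^sup>+A. ennreal (total_delta A k) \<partial>Q)"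
  proof (rule integral_eq_nn_integral)
    show "(\<lambda>A. total_delta A k) \<in> borel_measurable (Q)" by (rule measurable_total_delta)
    show "AE A in Q. 0 \<le> total_delta A k"
      unfolding total_delta_def using k by (intro AE_I2 sum_nonneg delta_nonneg) auto
  qed
  also have "\<dots> = (\<Sum>F | flat F \<and> cover_size F < k. flat_weight F)"
    unfolding nn_integral_total_delta[OF k(2,3)]
    by (simp add: sum_ennreal flat_weight_nonneg sum_nonneg)
  finally show ?thesis unfolding sum_flat_weight .
qed

end

section \<open>The cover formula\<close>

text \<open>Deleting one of \<open>c\<close> columns: by this identity the terms with nonempty
  column sets cancel in the recursion.\<close>

lemma urn_weight_shift:
  assumes "0 < c" "c < n"
  shows "real n * urn_weight n c = real c * urn_weight (n - 1) (c - 1)"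
proof -
  obtain c' where c': "c = Suc c'" using assms(1) by (cases c) auto
  obtain n' where n': "n = Suc (Suc n')" using assms by (cases n; cases "n - 1") auto
  have "Suc c' \<le> Suc n'" "c' \<le> n'" using assms c' n' by auto
  then have pos: "0 < real (Suc n' choose Suc c')" "0 < real (n' choose c')"
    by (simp_all only: of_nat_0_less_iff zero_less_binomial_iff)
  have "real (Suc c') * real (Suc n' choose Suc c') = real (Suc n') * real (n' choose c')"
    by (metis Suc_times_binomial of_nat_mult)
  moreover have "N * (1 / (N * q)) = a * (1 / (b * p))" if "a * q = b * p" "0 < q" "0 < p" "0 < N" "0 < b"
    for a b p q N :: real
    using that by (simp add: divide_simps mult.commute)
  ultimately have "real (Suc (Suc n')) * (1 / (real (Suc (Suc n')) * real (Suc n' choose Suc c'))) =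
      real (Suc c') * (1 / (real (Suc n') * real (n' choose c')))"
    using pos by (metis of_nat_0_less_iff zero_less_Suc)
  then show ?thesis unfolding urn_weight_def c' n' by (simp only: diff_Suc_1 diff_Suc_Suc diff_zero)
qed

text \<open>Restricting the zeros to \<open>I \<times> K\<close> allows columns to be deleted while
  \<open>Z\<close> stays fixed.\<close>

definition extends_to_cover ::
    "nat set \<Rightarrow> nat set \<Rightarrow> (nat \<times> nat) set \<Rightarrow> nat \<Rightarrow> nat set \<Rightarrow> nat set \<Rightarrow> bool" where
  "extends_to_cover I K Z s R C \<longleftrightarrow> (\<exists>R' C'. R \<subseteq> R' \<and> R' \<subseteq> I \<and> C \<subseteq> C' \<and> C' \<subseteq> K \<and>
     card R' + card C' = s \<and> covers (R', C') (Z \<inter> I \<times> K))"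

lemma extends_to_coverD:
  assumes "finite K" "extends_to_cover I K Z s R C"
  shows "card C \<le> s"
proof -
  obtain R' C' where h: "R \<subseteq> R'" "C \<subseteq> C'" "C' \<subseteq> K" "card R' + card C' = s"
    using assms(2) unfolding extends_to_cover_def by blast
  show ?thesis using card_mono[OF finite_subset[OF h(3) assms(1)] h(2)] h(4) by linarith
qed

text \<open>Column \<open>j\<close> takes care of its own zeros, so the other members of the cover
  only have to serve the matrix without it.\<close>

lemma extends_to_cover_insert:
  assumes K: "finite K" and j: "j \<in> K"
  shows "extends_to_cover I K Z (Suc s) R (insert j C) \<longleftrightarrow> extends_to_cover I (K - {j}) Z s R (C - {j})"
proof
  assume "extends_to_cover I K Z (Suc s) R (insert j C)"
  then obtain R' C' where h: "R \<subseteq> R'" "R' \<subseteq> I" "insert j C \<subseteq> C'" "C' \<subseteq> K"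
      "card R' + card C' = Suc s" "covers (R', C') (Z \<inter> I \<times> K)"
    unfolding extends_to_cover_def by blast
  have "card R' + card (C' - {j}) = s"
    using h(3,5) card_Suc_Diff1[OF finite_subset[OF h(4) K], of j] by auto
  moreover have "covers (R', C' - {j}) (Z \<inter> I \<times> (K - {j}))" using h(6) unfolding covers_def by auto
  moreover have "C - {j} \<subseteq> C' - {j}" "C' - {j} \<subseteq> K - {j}" using h(3,4) by auto
  ultimately show "extends_to_cover I (K - {j}) Z s R (C - {j})"
    using h(1,2) unfolding extends_to_cover_def by blast
next
  assume "extends_to_cover I (K - {j}) Z s R (C - {j})"
  then obtain R' C' where h: "R \<subseteq> R'" "R' \<subseteq> I" "C - {j} \<subseteq> C'" "C' \<subseteq> K - {j}"
      "card R' + card C' = s" "covers (R', C') (Z \<inter> I \<times> (K - {j}))"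
    unfolding extends_to_cover_def by blast
  have "card R' + card (insert j C') = Suc s"
    using h(4,5) finite_subset[OF h(4)] K by (subst card_insert_disjoint) auto
  moreover have "covers (R', insert j C') (Z \<inter> I \<times> K)" using h(6) unfolding covers_def by auto
  moreover have "insert j C \<subseteq> insert j C'" "insert j C' \<subseteq> K" using h(3,4) j by auto
  ultimately show "extends_to_cover I K Z (Suc s) R (insert j C)"
    using h(1,2) unfolding extends_to_cover_def by blast
qed

text \<open>A minimum cover containing \<open>R\<close> is filled up to exactly \<open>s\<close>
  members by arbitrary columns; \<open>s \<le> card K\<close> provides enough of them.\<close>

lemma (in zero_pattern) extends_to_cover_rows:
  assumes R: "R \<subseteq> I" and s: "s \<le> card K"
  shows "extends_to_cover I K Z s R {} \<longleftrightarrow> cover_size (cl R) \<le> s"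
proof
  assume "extends_to_cover I K Z s R {}"
  then obtain R' C' where h: "R \<subseteq> R'" "R' \<subseteq> I" "C' \<subseteq> K" "card R' + card C' = s"
      "covers (R', C') (Z \<inter> I \<times> K)"
    unfolding extends_to_cover_def by blast
  have "zero_cols (I - R') \<subseteq> C'"
    using h(5) unfolding zero_cols_def covers_def by auto
  then have "cover_size R' \<le> s"
    unfolding cover_size_def using h(4) card_mono[OF finite_subset[OF h(3) fin(2)], of "zero_cols (I - R')"]
    by linarith
  then show "cover_size (cl R) \<le> s" using cover_size_cl_le[OF R h(1,2)] by simp
next
  assume s': "cover_size (cl R) \<le> s"
  then have "card (zero_cols (I - cl R)) \<le> s - card (cl R)" "card (cl R) \<le> s"
    unfolding cover_size_def by auto
  moreover have "s - card (cl R) \<le> card K" using s by simp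
  ultimately obtain C' where C': "zero_cols (I - cl R) \<subseteq> C'" "C' \<subseteq> K" "card C' = s - card (cl R)"
    using exists_subset_between[OF _ _ zero_cols_subset fin(2)] by blast
  have "covers (cl R, C') (Z \<inter> I \<times> K)"
    unfolding covers_def using C'(1) unfolding zero_cols_def by auto
  then show "extends_to_cover I K Z s R {}"
    unfolding extends_to_cover_def using C' subset_cl[OF R] cl_subset[OF R] \<open>card (cl R) \<le> s\<close>
    by (intro exI[of _ "cl R"] exI[of _ C']) auto
qed

text \<open>The claimed expectation before grouping by cardinalities, for any submatrix. The value
  at \<open>k = 0\<close> is set apart because the truncated \<open>k - 1\<close> would admit covers
  of size 0.\<close>

definition cover_sum :: "nat set \<Rightarrow> (nat \<times> nat) set \<Rightarrow> nat \<Rightarrow> nat set \<Rightarrow> real" where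
  "cover_sum I Z k K = (if k = 0 then 0 else
     \<Sum>R\<in>Pow I. \<Sum>C | C \<in> Pow K \<and> extends_to_cover I K Z (k - 1) R C.
       urn_weight (card I) (card R) * urn_weight (card K) (card C))"

lemma sum_Pow_pointed:
  fixes f :: "nat set \<Rightarrow> nat \<Rightarrow> real"
  assumes K: "finite K"
  shows "(\<Sum>C\<in>Pow K. \<Sum>j\<in>C. f (C - {j}) j) = (\<Sum>j\<in>K. \<Sum>C\<in>Pow (K - {j}). f C j)"
proof -
  have "(\<Sum>C\<in>Pow K. \<Sum>j\<in>C. f (C - {j}) j) = (\<Sum>(C, j)\<in>Sigma (Pow K) (\<lambda>C. C). f (C - {j}) j)"
    using K by (intro sum.Sigma) (auto intro: finite_subset)
  also have "\<dots> = (\<Sum>(j, C)\<in>Sigma K (\<lambda>j. Pow (K - {j})). f C j)"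
    by (rule sum.reindex_bij_witness[where i = "\<lambda>(j, C). (insert j C, j)" and j = "\<lambda>(C, j). (j, C - {j})"])
      auto
  also have "\<dots> = (\<Sum>j\<in>K. \<Sum>C\<in>Pow (K - {j}). f C j)"
    using K by (intro sum.Sigma[symmetric]) auto
  finally show ?thesis .
qed

text \<open>\<open>urn_weight_shift\<close> distributes each nonempty \<open>C\<close> over its
  columns \<open>j\<close>, and deleting \<open>j\<close> from cover and matrix gives the terms for
  \<open>K - {j}\<close>; only \<open>C = {}\<close> is left over. The guard \<open>0 < s\<close>
  stops the truncated \<open>s - 1\<close> from creating covers at \<open>s = 0\<close>.\<close>

lemma cover_sum_cols_rec:
  assumes K: "finite K" and k: "Suc s \<le> card K"
  shows "real (card K) * (\<Sum>C | C \<in> Pow K \<and> extends_to_cover I K Z s R C. urn_weight (card K) (card C)) =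
    (if extends_to_cover I K Z s R {} then 1 else 0) +
    (\<Sum>j\<in>K. \<Sum>C | C \<in> Pow (K - {j}) \<and> 0 < s \<and> extends_to_cover I (K - {j}) Z (s - 1) R C.
      urn_weight (card K - 1) (card C))"
proof -
  let ?n = "card K" and ?e = "extends_to_cover I K Z s R"
  let ?g = "\<lambda>C j. if ?e (insert j C) then urn_weight (?n - 1) (card C) else 0"
  have fP: "finite (Pow K)" using K by simp
  have "real ?n * (\<Sum>C | C \<in> Pow K \<and> ?e C. urn_weight ?n (card C)) =
      (\<Sum>C\<in>Pow K. if ?e C then real ?n * urn_weight ?n (card C) else 0)"
    by (subst sum_distrib_left) (rule sum.inter_filter[OF fP])
  also have "\<dots> = (\<Sum>C\<in>Pow K. (if C = {} then (if ?e {} then 1 else 0) else 0) + (\<Sum>j\<in>C. ?g (C - {j}) j))"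
  proof (rule sum.cong[OF refl])
    fix C assume C: "C \<in> Pow K"
    have fC: "finite C" using C K finite_subset by auto
    have g: "(\<Sum>j\<in>C. ?g (C - {j}) j) = (\<Sum>j\<in>C. if ?e C then urn_weight (?n - 1) (card C - 1) else 0)"
      using fC by (intro sum.cong refl) (simp add: insert_absorb)
    show "(if ?e C then real ?n * urn_weight ?n (card C) else 0) =
        (if C = {} then (if ?e {} then 1 else 0) else 0) + (\<Sum>j\<in>C. ?g (C - {j}) j)"
    proof (cases "C = {}")
      case True
      then show ?thesis using urn_weight_0[of ?n] k by simp
    next
      case False
      have "real ?n * urn_weight ?n (card C) = real (card C) * urn_weight (?n - 1) (card C - 1)" if "?e C"
        using extends_to_coverD[OF K that] k False fC by (intro urn_weight_shift) (auto simp: card_gt_0_iff)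
      then show ?thesis unfolding g using False by simp
    qed
  qed
  also have "\<dots> = (if ?e {} then 1 else 0) + (\<Sum>C\<in>Pow K. \<Sum>j\<in>C. ?g (C - {j}) j)"
    using fP by (simp add: sum.distrib)
  also have "(\<Sum>C\<in>Pow K. \<Sum>j\<in>C. ?g (C - {j}) j) = (\<Sum>j\<in>K. \<Sum>C\<in>Pow (K - {j}). ?g C j)"
    by (rule sum_Pow_pointed[OF K])
  also have "\<dots> = (\<Sum>j\<in>K. \<Sum>C | C \<in> Pow (K - {j}) \<and> 0 < s \<and> extends_to_cover I (K - {j}) Z (s - 1) R C.
      urn_weight (?n - 1) (card C))"
  proof (rule sum.cong[OF refl])
    fix j assume j: "j \<in> K"
    have "?e (insert j C) \<longleftrightarrow> 0 < s \<and> extends_to_cover I (K - {j}) Z (s - 1) R C"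
      if C: "C \<in> Pow (K - {j})" for C
    proof (cases s)
      case 0
      have "finite (insert j C)" using finite_subset[of C "K - {j}"] C K by auto
      then have "0 < card (insert j C)" by (simp add: card_gt_0_iff)
      then show ?thesis using extends_to_coverD[OF K, of I Z s R "insert j C"] 0 by auto
    next
      case (Suc s')
      have "C - {j} = C" using C by auto
      then show ?thesis using extends_to_cover_insert[OF K j, of I Z s' R C] Suc by simp
    qed
    then show "(\<Sum>C\<in>Pow (K - {j}). ?g C j) =
        (\<Sum>C | C \<in> Pow (K - {j}) \<and> 0 < s \<and> extends_to_cover I (K - {j}) Z (s - 1) R C.
          urn_weight (?n - 1) (card C))"
      using K by (subst sum.inter_filter) (auto intro!: sum.cong)
  qed
  finally show ?thesis .
qed

lemma cover_sum_rec:
  assumes fin: "finite I" "finite K" and k: "0 < k" "k \<le> card K"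
  shows "real (card K) * cover_sum I Z k K =
    (\<Sum>R | R \<subseteq> I \<and> extends_to_cover I K Z (k - 1) R {}. urn_weight (card I) (card R)) +
    (\<Sum>j\<in>K. cover_sum I Z (k - 1) (K - {j}))"
proof -
  let ?w = "\<lambda>R. urn_weight (card I) (card R)"
  have fP: "finite (Pow I)" using fin by simp
  have "real (card K) * cover_sum I Z k K = (\<Sum>R\<in>Pow I. ?w R * (real (card K) *
      (\<Sum>C | C \<in> Pow K \<and> extends_to_cover I K Z (k - 1) R C. urn_weight (card K) (card C))))"
    unfolding cover_sum_def using k(1) by (simp add: sum_distrib_left mult.left_commute)
  also have "\<dots> = (\<Sum>R\<in>Pow I. ?w R * ((if extends_to_cover I K Z (k - 1) R {} then 1 else 0) +
      (\<Sum>j\<in>K. \<Sum>C | C \<in> Pow (K - {j}) \<and> 0 < k - 1 \<and> extends_to_cover I (K - {j}) Z (k - 1 - 1) R C.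
        urn_weight (card K - 1) (card C))))"
    using cover_sum_cols_rec[OF fin(2), of "k - 1"] k by (intro sum.cong refl) simp
  also have "\<dots> = (\<Sum>R\<in>Pow I. if extends_to_cover I K Z (k - 1) R {} then ?w R else 0) +
      (\<Sum>R\<in>Pow I. \<Sum>j\<in>K. \<Sum>C | C \<in> Pow (K - {j}) \<and> 0 < k - 1 \<and>
        extends_to_cover I (K - {j}) Z (k - 1 - 1) R C. ?w R * urn_weight (card K - 1) (card C))"
    unfolding sum.distrib[symmetric]
  proof (rule sum.cong[OF refl])
    fix R
    let ?S = "\<Sum>j\<in>K. \<Sum>C | C \<in> Pow (K - {j}) \<and> 0 < k - 1 \<and>
      extends_to_cover I (K - {j}) Z (k - 1 - 1) R C. urn_weight (card K - 1) (card C)"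
    have "?w R * ((if extends_to_cover I K Z (k - 1) R {} then 1 else 0) + ?S) =
        (if extends_to_cover I K Z (k - 1) R {} then ?w R else 0) + ?w R * ?S"
      by (cases "extends_to_cover I K Z (k - 1) R {}")
        (simp_all only: if_True if_False distrib_left mult_1_right mult_zero_right)
    then show "?w R * ((if extends_to_cover I K Z (k - 1) R {} then 1 else 0) + ?S) =
        (if extends_to_cover I K Z (k - 1) R {} then ?w R else 0) +
        (\<Sum>j\<in>K. \<Sum>C | C \<in> Pow (K - {j}) \<and> 0 < k - 1 \<and>
          extends_to_cover I (K - {j}) Z (k - 1 - 1) R C. ?w R * urn_weight (card K - 1) (card C))"
      by (simp only: sum_distrib_left)
  qed
  also have "(\<Sum>R\<in>Pow I. if extends_to_cover I K Z (k - 1) R {} then ?w R else 0) =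
      (\<Sum>R | R \<subseteq> I \<and> extends_to_cover I K Z (k - 1) R {}. ?w R)"
    using fP by (subst sum.inter_filter[symmetric]) (auto intro: sum.cong)
  also have "(\<Sum>R\<in>Pow I. \<Sum>j\<in>K. \<Sum>C | C \<in> Pow (K - {j}) \<and> 0 < k - 1 \<and>
        extends_to_cover I (K - {j}) Z (k - 1 - 1) R C. ?w R * urn_weight (card K - 1) (card C)) =
      (\<Sum>j\<in>K. \<Sum>R\<in>Pow I. \<Sum>C | C \<in> Pow (K - {j}) \<and> 0 < k - 1 \<and>
        extends_to_cover I (K - {j}) Z (k - 1 - 1) R C. ?w R * urn_weight (card K - 1) (card C))"
    by (rule sum.swap)
  also have "\<dots> = (\<Sum>j\<in>K. cover_sum I Z (k - 1) (K - {j}))"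
    by (rule sum.cong[OF refl]) (simp add: cover_sum_def)
  finally show ?thesis .
qed

text \<open>\<open>expectation_recursion\<close> and \<open>cover_sum_rec\<close> are the same
  recursion, once ranks are read as extendability to covers. The column set varies in the induction;
  the rows and the probability space stay fixed.\<close>

lemma expectation_opt:
  assumes "finite I" "finite P" "P \<inter> Z = {}" "finite K" "I \<times> K - Z \<subseteq> P" "k \<le> card I" "k \<le> card K"
  shows "(\<integral>A. opt (matrix_of P A) k I K \<partial>exp_product P) = cover_sum I Z k K"
  using assms(4-7)
proof (induction k arbitrary: K)
  case 0
  then show ?case by (simp add: opt_0 cover_sum_def)
next
  case (Suc k)
  interpret W: random_zero_pattern I K Z P
    using assms(1-3) Suc.prems by unfold_locales auto
  have "(\<integral>A. opt (matrix_of P A) k I (K - {j}) \<partial>exp_product P) = cover_sum I Z k (K - {j})" if "j \<in> K" for j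
    using Suc.prems that by (intro Suc.IH) auto
  then have "real (card K) * (\<integral>A. opt (matrix_of P A) (Suc k) I K \<partial>exp_product P) -
      (\<Sum>j\<in>K. cover_sum I Z k (K - {j})) =
      (\<Sum>R | R \<subseteq> I \<and> W.cover_size (W.cl R) < Suc k. urn_weight (card I) (card R))"
    using W.expectation_recursion[of "Suc k"] Suc.prems by simp
  also have "{R. R \<subseteq> I \<and> W.cover_size (W.cl R) < Suc k} = {R. R \<subseteq> I \<and> extends_to_cover I K Z k R {}}"
    using W.extends_to_cover_rows[of _ k] Suc.prems by auto
  also have "(\<Sum>R | R \<subseteq> I \<and> extends_to_cover I K Z k R {}. urn_weight (card I) (card R)) =
      real (card K) * cover_sum I Z (Suc k) K - (\<Sum>j\<in>K. cover_sum I Z k (K - {j}))"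
    using cover_sum_rec[OF assms(1) Suc.prems(1), of "Suc k" Z] Suc.prems(4) by simp
  finally have "real (card K) * (\<integral>A. opt (matrix_of P A) (Suc k) I K \<partial>exp_product P) =
      real (card K) * cover_sum I Z (Suc k) K" by linarith
  then show ?case using Suc.prems(4) by auto
qed

section \<open>Identification with the standard random assignment problem\<close>

lemma assignments_eq: "assignments k m n = assigns k {..<m} {..<n}"
proof -
  have "finite S" if "S \<subseteq> positions m n" for S
    using that finite_subset unfolding positions_def by blast
  then show ?thesis
    unfolding assignments_def assigns_def matching_def positions_def by blast
qed

lemma min_cost_eq: "min_cost k m n A = opt A k {..<m} {..<n}"
  unfolding min_cost_def opt_def assignments_eq ..

lemma cover_sum_eq_cover_coeff:
  assumes k: "0 < k" and Z: "Z \<subseteq> positions m n"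
  shows "cover_sum {..<m} Z k {..<n} = 1 / (real m * real n) *
      (\<Sum>(i, j)\<in>{(i, j). i + j < k}.
         real (cover_coeff k m n Z i j) / (real ((m - 1) choose i) * real ((n - 1) choose j)))"
proof -
  let ?S = "partial_s_covers (k - 1) m n Z"
  let ?h = "\<lambda>(i, j). 1 / (real ((m - 1) choose i) * real ((n - 1) choose j))"
  have ZI: "Z \<inter> {..<m} \<times> {..<n} = Z" using Z unfolding positions_def by blast
  have S: "?S = {(R, C). R \<in> Pow {..<m} \<and> C \<in> Pow {..<n} \<and> extends_to_cover {..<m} {..<n} Z (k - 1) R C}"
    unfolding partial_s_covers_def s_covers_def extends_to_cover_def ZI by auto
  have finS: "finite ?S" unfolding S
    by (rule finite_subset[of _ "Pow {..<m} \<times> Pow {..<n}"]) auto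
  have finT: "finite {(i, j). i + j < k}"
    by (rule finite_subset[of _ "{..<k} \<times> {..<k}"]) auto
  have "cover_sum {..<m} Z k {..<n} = (\<Sum>(R, C)\<in>?S. urn_weight m (card R) * urn_weight n (card C))"
    unfolding cover_sum_def S using k by (subst sum.Sigma) (auto intro!: sum.cong)
  also have "\<dots> = (\<Sum>x\<in>?S. 1 / (real m * real n) * ?h (card (fst x), card (snd x)))"
    unfolding urn_weight_def by (intro sum.cong refl) (simp add: case_prod_beta' mult.assoc mult.left_commute)
  also have "\<dots> = 1 / (real m * real n) * (\<Sum>x\<in>?S. ?h (card (fst x), card (snd x)))"
    by (rule sum_distrib_left[symmetric])
  also have "(\<Sum>x\<in>?S. ?h (card (fst x), card (snd x))) =
      (\<Sum>y\<in>{(i, j). i + j < k}. \<Sum>x | x \<in> ?S \<and> (card (fst x), card (snd x)) = y. ?h (card (fst x), card (snd x)))"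
  proof (rule sum.group[OF finS finT, symmetric])
    have "card R + card C < k" if RC: "(R, C) \<in> ?S" for R C
    proof -
      obtain R' C' where h: "R \<subseteq> R'" "R' \<subseteq> {..<m}" "C \<subseteq> C'" "C' \<subseteq> {..<n}" "card R' + card C' = k - 1"
        using RC unfolding S extends_to_cover_def by blast
      have "card R \<le> card R'" "card C \<le> card C'"
        using h by (meson card_mono finite_lessThan finite_subset)+
      then show ?thesis using h(5) k by linarith
    qed
    then show "(\<lambda>x. (card (fst x), card (snd x))) ` ?S \<subseteq> {(i, j). i + j < k}" by auto
  qed
  also have "\<dots> = (\<Sum>(i, j)\<in>{(i, j). i + j < k}.
         real (cover_coeff k m n Z i j) / (real ((m - 1) choose i) * real ((n - 1) choose j)))"
  proof (rule sum.cong[OF refl])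
    fix y :: "nat \<times> nat" assume "y \<in> {(i, j). i + j < k}"
    obtain i j where y: "y = (i, j)" by (cases y)
    have "{x. x \<in> ?S \<and> (card (fst x), card (snd x)) = y} = {(R, C) \<in> ?S. card R = i \<and> card C = j}"
      unfolding y by auto
    then have "(\<Sum>x | x \<in> ?S \<and> (card (fst x), card (snd x)) = y. ?h (card (fst x), card (snd x))) =
        (\<Sum>x\<in>{(R, C) \<in> ?S. card R = i \<and> card C = j}. ?h (i, j))"
      by (intro sum.cong) auto
    also have "\<dots> = real (cover_coeff k m n Z i j) * ?h (i, j)"
      unfolding cover_coeff_def by simp
    finally show "(\<Sum>x | x \<in> ?S \<and> (card (fst x), card (snd x)) = y. ?h (card (fst x), card (snd x))) =
        (case y of (i, j) \<Rightarrow> real (cover_coeff k m n Z i j) /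
          (real ((m - 1) choose i) * real ((n - 1) choose j)))"
      unfolding y by simp
  qed
  finally show ?thesis .
qed

lemma (in standard_RAP) distr_entries:
  assumes "positions m n - Z \<noteq> {}"
  shows "(\<lambda>\<omega>. \<lambda>p\<in>positions m n - Z. X p \<omega>) \<in> measurable M (exp_product (positions m n - Z))"
    "distr M (exp_product (positions m n - Z)) (\<lambda>\<omega>. \<lambda>p\<in>positions m n - Z. X p \<omega>) =
      exp_product (positions m n - Z)"
proof -
  let ?P = "positions m n - Z" and ?Y = "\<lambda>\<omega>. \<lambda>p\<in>positions m n - Z. X p \<omega>"
  have rv: "X p \<in> borel_measurable M" if "p \<in> ?P" for p
    using distributed_measurable[OF exponential_entries[OF that]] by simp
  have d: "distr M borel (X p) = exp_measure" if "p \<in> ?P" for p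
  proof -
    have "distr M borel (X p) = distr M lborel (X p)" by (rule distr_cong) auto
    then show ?thesis
      using distributed_distr_eq_density[OF exponential_entries[OF that]] unfolding exp_measure_def by simp
  qed
  have sets: "sets (PiM ?P (\<lambda>_. borel)) = sets (exp_product ?P)"
    unfolding exp_product_def by (intro sets_PiM_cong) auto
  have "?Y \<in> measurable M (PiM ?P (\<lambda>_. borel))" using rv by (intro measurable_restrict)
  then show "?Y \<in> measurable M (exp_product ?P)"
    using measurable_cong_sets[OF refl sets] by blast
  have "distr M (PiM ?P (\<lambda>_. borel)) ?Y = PiM ?P (\<lambda>p. distr M borel (X p))"
    using indep_vars_iff_distr_eq_PiM'[OF assms, where X = X and M' = "\<lambda>_. borel"] rv indep_entries by blast
  also have "\<dots> = exp_product ?P" unfolding exp_product_def using d by (intro PiM_cong) auto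
  also have "distr M (PiM ?P (\<lambda>_. borel)) ?Y = distr M (exp_product ?P) ?Y"
    using sets by (intro distr_cong) auto
  finally show "distr M (exp_product ?P) ?Y = exp_product ?P" .
qed

text \<open>Off \<open>Z\<close> the entries are almost surely positive, so the truncation in
  \<open>matrix_of\<close> changes nothing, and the expectation depends only on their joint
  law.\<close>

lemma (in standard_RAP) expectation_min_cost:
  "expectation (\<lambda>\<omega>. min_cost k m n (\<lambda>p. X p \<omega>)) =
    (\<integral>A. opt (matrix_of (positions m n - Z) A) k {..<m} {..<n} \<partial>exp_product (positions m n - Z))"
proof -
  let ?P = "positions m n - Z" and ?Y = "\<lambda>\<omega>. \<lambda>p\<in>positions m n - Z. X p \<omega>"
  let ?opt = "\<lambda>A. opt A k {..<m} {..<n}"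
  interpret Q: prob_space "exp_product ?P" by (rule prob_space_exp_product)
  have X0: "min_cost k m n (\<lambda>p. X p \<omega>) = ?opt (\<lambda>p. if p \<in> ?P then X p \<omega> else 0)"
    if "\<omega> \<in> space M" for \<omega>
    unfolding min_cost_eq using zero_entries that
    by (intro opt_cong) (auto simp: positions_def)
  have E: "expectation (\<lambda>\<omega>. min_cost k m n (\<lambda>p. X p \<omega>)) =
      expectation (\<lambda>\<omega>. ?opt (\<lambda>p. if p \<in> ?P then X p \<omega> else 0))"
    by (intro Bochner_Integration.integral_cong refl X0)
  show ?thesis
  proof (cases "?P = {}")
    case True
    \<comment> \<open>With no random position both sides are expectations of one and the same
      constant.\<close>
    have "matrix_of {} A = (\<lambda>p. 0)" for A by (auto simp: matrix_of_def fun_eq_iff)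
    then show ?thesis using Q.prob_space unfolding E True by (simp add: prob_space)
  next
    case False
    note Y = distr_entries[OF False]
    have finP: "finite ?P" unfolding positions_def by simp
    have rv: "(\<lambda>\<omega>. if p \<in> ?P then X p \<omega> else 0) \<in> borel_measurable M" for p
    proof (cases "p \<in> ?P")
      case True
      then show ?thesis using distributed_measurable[OF exponential_entries[OF True]] by simp
    next
      case False
      then have "(\<lambda>\<omega>. if p \<in> ?P then X p \<omega> else 0) = (\<lambda>\<omega>. 0)" by (simp only: if_False)
      then show ?thesis by simp
    qed
    have m: "(\<lambda>A. ?opt (matrix_of ?P A)) \<in> borel_measurable (exp_product ?P)"
      by (rule measurable_opt) auto
    have "AE A in distr M (exp_product ?P) ?Y. \<forall>p\<in>?P. 0 < A p"
      unfolding Y(2) by (rule AE_exp_product_pos[OF finP])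
    then have "AE \<omega> in M. \<forall>p\<in>?P. 0 < ?Y \<omega> p" by (rule AE_distrD[OF Y(1)])
    then have "AE \<omega> in M. ?opt (\<lambda>p. if p \<in> ?P then X p \<omega> else 0) = ?opt (matrix_of ?P (?Y \<omega>))"
    proof eventually_elim
      case (elim \<omega>)
      have "(\<lambda>p. if p \<in> ?P then X p \<omega> else 0) = matrix_of ?P (?Y \<omega>)"
        using elim by (auto simp: matrix_of_def max_def less_imp_le fun_eq_iff)
      then show ?case by simp
    qed
    then have "expectation (\<lambda>\<omega>. ?opt (\<lambda>p. if p \<in> ?P then X p \<omega> else 0)) =
        expectation (\<lambda>\<omega>. ?opt (matrix_of ?P (?Y \<omega>)))"
    proof (rule integral_cong_AE[rotated 2])
      show "(\<lambda>\<omega>. ?opt (\<lambda>p. if p \<in> ?P then X p \<omega> else 0)) \<in> borel_measurable M"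
        unfolding opt_def cost_def
        by (intro borel_measurable_Min finite_assigns borel_measurable_sum rv) auto
      show "(\<lambda>\<omega>. ?opt (matrix_of ?P (?Y \<omega>))) \<in> borel_measurable M"
        by (rule measurable_compose[OF Y(1) m])
    qed
    also have "\<dots> = (\<integral>A. ?opt (matrix_of ?P A) \<partial>distr M (exp_product ?P) ?Y)"
      by (rule integral_distr[OF Y(1) m, symmetric])
    finally show ?thesis unfolding E Y(2) .
  qed
qed

theorem theorem1p3:
  fixes k m n :: nat and Z :: "(nat \<times> nat) set"
    and M :: "'a measure" and X :: "nat \<times> nat \<Rightarrow> 'a \<Rightarrow> real"
  assumes "standard_RAP k m n Z M X"
  shows "prob_space.expectation M (\<lambda>\<omega>. min_cost k m n (\<lambda>p. X p \<omega>)) =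
    1 / (real m * real n) *
      (\<Sum>(i, j)\<in>{(i, j). i + j < k}.
         real (cover_coeff k m n Z i j) /
           (real ((m - 1) choose i) * real ((n - 1) choose j)))"
proof -
  interpret standard_RAP k m n Z M X by (rule assms)
  have "expectation (\<lambda>\<omega>. min_cost k m n (\<lambda>p. X p \<omega>)) = cover_sum {..<m} Z k {..<n}"
    unfolding expectation_min_cost
    using k_le by (intro expectation_opt) (auto simp: positions_def)
  then show ?thesis using cover_sum_eq_cover_coeff[OF k_pos Z_subset] by simp
qed

end
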